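(* Let $\mathbb{K}$ be an algebraically closed field of characteristic zero and let $R$ be the $\mathbb{K}$-algebra with generators $x_1,x_2,x_3,x_4$ and relations $x_1x_2+x_2x_1$, $x_1x_3+x_4x_2$, $x_1x_4-x_3x_2$, $x_2x_3-x_4x_1$, $x_2x_4+x_3x_1$, $x_3x_4+x_4x_3$. Let $P=M_{12}M_{34}-M_{13}M_{24}+M_{14}M_{23}$ be the Plücker polynomial. The irreducible components of the line scheme $\mathcal{L}(R)\subset\mathbb{P}^5$ are: $$\begin{aligned} C_1&=\mathcal{V}(M_{12},\,M_{13}-M_{23},\,M_{14}-M_{24}), & C_2&=\mathcal{V}(M_{12},\,M_{13}+M_{23},\,M_{14}+M_{24}),\\ C_3&=\mathcal{V}(M_{34},\,M_{13}-M_{14},\,M_{23}-M_{24}), & C_4&=\mathcal{V}(M_{34},\,M_{13}+M_{14},\,M_{23}+M_{24}),\\ C_5&=\mathcal{V}(M_{12},\,M_{34},\,P), & C_6&=\mathcal{V}(M_{14}-M_{23},\,M_{13}-M_{24},\,P),\\ C_7&=\mathcal{V}(M_{14}+M_{23},\,M_{13}+M_{24},\,P). \end{aligned}$$ The components $C_1,C_2,C_3,C_4$ are isomorphic to $\mathbb{P}^2$; the components $C_5,C_6,C_7$ are isomorphic to $\mathbb{P}^1\times\mathbb{P}^1$. The scheme $\mathcal{L}(R)$ is equidimensional of dimension two and is a reduced scheme.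
   Context: Line scheme: let $A$ be a quadratic algebra with degree-one generators $x_1,\dots,x_4$ and six quadratic relations $r_1,\dots,r_6$. Let $z_1,\dots,z_4$ be the dual basis of $A_1^*$ and $f_1,\dots,f_{10}$ a basis of the relations of the quadratic dual $A^!$ (so $f_i(r_j)=0$). Write these relations as $\hat M\mathbf{z}=\mathbf{0}$, with $\hat M$ a $10\times4$ matrix of linear forms in the $z_i$ and $\mathbf{z}=(z_1,\dots,z_4)^T$. In $\mathbb{K}[u_1,\dots,u_4,v_1,\dots,v_4]$ let $\mathcal{M}=[\hat M_u\ \hat M_v]$ be the $10\times8$ matrix obtained by concatenating $\hat M$ with $z_i$ replaced by $u_i$ and $\hat M$ with $z_i$ replaced by $v_i$. Its forty-five $8\times8$ minors are expressible as quartic polynomials in $N_{ij}=u_iv_j-u_jv_i$, $1\le i<j\le4$. Substitute $N_{12}\mapsto M_{34}$, $N_{13}\mapsto -M_{24}$, $N_{14}\mapsto M_{23}$, $N_{23}\mapsto M_{14}$, $N_{24}\mapsto -M_{13}$, $N_{34}\mapsto M_{12}$. The line scheme $\mathcal{L}(A)$ is the closed subscheme of $\mathbb{P}^5$, with homogeneous coordinates $M_{12},M_{13},M_{14},M_{23},M_{24},M_{34}$, defined by the resulting forty-five quartics together with $P$. $\mathcal{V}(\cdot)$ denotes the zero locus. *)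

theory Defs
  imports
    "HOL-Library.Poly_Mapping"
    "HOL-Library.Numeral_Type"
    "HOL-Library.Extended_Nat"
    "HOL-Computational_Algebra.Polynomial"
    "HOL-Analysis.Abstract_Topology"
    "Jordan_Normal_Form.Determinant"
begin

text \<open>The free algebra on letters of type \<open>'x\<close> is the monoid algebra of the free monoid; words are
  wrapped so that the product of the library type of finitely supported functions is the
  convolution with respect to concatenation.\<close>

datatype 'x word = Word "'x list"

instantiation word :: (type) monoid_add
begin
definition zero_word :: "'a word" where "0 = Word []"
fun plus_word :: "'a word \<Rightarrow> 'a word \<Rightarrow> 'a word" where "Word xs + Word ys = Word (xs @ ys)"
instance
proof
  fix a b c :: "'a word"
  show "a + b + c = a + (b + c)" by (cases a; cases b; cases c) simp
  show "0 + a = a" by (cases a) (simp add: zero_word_def)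
  show "a + 0 = a" by (cases a) (simp add: zero_word_def)
qed
end

type_synonym ('x, 'k) free_alg = "'x word \<Rightarrow>\<^sub>0 'k"
type_synonym ('v, 'k) mpoly = "('v \<Rightarrow>\<^sub>0 nat) \<Rightarrow>\<^sub>0 'k"

definition gen :: "'x \<Rightarrow> ('x, 'k::field) free_alg" where
  "gen x = Poly_Mapping.single (Word [x]) 1"

definition var :: "'v \<Rightarrow> ('v, 'k::field) mpoly" where
  "var v = Poly_Mapping.single (Poly_Mapping.single v 1) 1"

definition const :: "'k \<Rightarrow> 'm::zero \<Rightarrow>\<^sub>0 'k::field" where
  "const c = Poly_Mapping.single 0 c"

definition eval :: "('v \<Rightarrow> 'k) \<Rightarrow> ('v, 'k::field) mpoly \<Rightarrow> 'k" where
  "eval x f = (\<Sum>m\<in>Poly_Mapping.keys f. Poly_Mapping.lookup f m *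
     (\<Prod>v\<in>Poly_Mapping.keys m. x v ^ Poly_Mapping.lookup m v))"

definition subst :: "('v \<Rightarrow> ('w, 'k) mpoly) \<Rightarrow> ('v, 'k::field) mpoly \<Rightarrow> ('w, 'k) mpoly" where
  "subst \<sigma> f = (\<Sum>m\<in>Poly_Mapping.keys f. const (Poly_Mapping.lookup f m) *
     (\<Prod>v\<in>Poly_Mapping.keys m. \<sigma> v ^ Poly_Mapping.lookup m v))"

text \<open>\<open>gr\<close> assigns to every variable one factor of a product of projective spaces; \<open>d i\<close> is the
  degree in the variables of the factor \<open>i\<close>.\<close>

definition multihomogeneous :: "('v::finite \<Rightarrow> 'i) \<Rightarrow> ('i \<Rightarrow> nat) \<Rightarrow> ('v, 'k::field) mpoly \<Rightarrow> bool" where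
  "multihomogeneous gr d f \<longleftrightarrow>
     (\<forall>m\<in>Poly_Mapping.keys f. \<forall>i. (\<Sum>v | gr v = i. Poly_Mapping.lookup m v) = d i)"

definition std_grading :: "'v \<Rightarrow> unit" where
  "std_grading v = ()"

abbreviation homogeneous :: "nat \<Rightarrow> ('v::finite, 'k::field) mpoly \<Rightarrow> bool" where
  "homogeneous n \<equiv> multihomogeneous std_grading (\<lambda>_. n)"

abbreviation ideal_gen :: "'a::comm_ring_1 set \<Rightarrow> 'a set" where
  "ideal_gen \<equiv> Modules.module.span (*)"

lemma module_mult: "Modules.module ((*) :: 'a::comm_ring_1 \<Rightarrow> 'a \<Rightarrow> 'a)"
  by unfold_locales (simp_all add: algebra_simps)

lemma multihomogeneous_mult:
  assumes "multihomogeneous gr d f" "multihomogeneous gr e g"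
  shows "multihomogeneous gr (\<lambda>i. d i + e i) (f * g)"
  unfolding multihomogeneous_def
proof (intro ballI allI)
  fix m i assume "m \<in> Poly_Mapping.keys (f * g)"
  then obtain a b where "a \<in> Poly_Mapping.keys f" "b \<in> Poly_Mapping.keys g" "m = a + b"
    using keys_mult[of f g] by blast
  with assms show "(\<Sum>v | gr v = i. Poly_Mapping.lookup m v) = d i + e i"
    by (simp add: multihomogeneous_def lookup_add sum.distrib)
qed

lemma eval_superset:
  assumes "finite A" "Poly_Mapping.keys f \<subseteq> A"
  shows "eval x f = (\<Sum>m\<in>A. Poly_Mapping.lookup f m *
     (\<Prod>v\<in>Poly_Mapping.keys m. x v ^ Poly_Mapping.lookup m v))"
  unfolding eval_def using assms
  by (intro sum.mono_neutral_left) (auto simp: in_keys_iff)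

lemma eval_add: "eval x (f + g) = eval x f + eval x g"
proof -
  let ?A = "Poly_Mapping.keys f \<union> Poly_Mapping.keys g"
  have "Poly_Mapping.keys (f + g) \<subseteq> ?A" by (rule Poly_Mapping.keys_add)
  then show ?thesis
    by (simp add: eval_superset[of ?A] lookup_add distrib_right sum.distrib)
qed

lemma monomial_add:
  fixes x :: "'v \<Rightarrow> 'k::field"
  shows "(\<Prod>v\<in>Poly_Mapping.keys (a + b). x v ^ Poly_Mapping.lookup (a + b) v) =
    (\<Prod>v\<in>Poly_Mapping.keys a. x v ^ Poly_Mapping.lookup a v) *
    (\<Prod>v\<in>Poly_Mapping.keys b. x v ^ Poly_Mapping.lookup b v)"
proof -
  let ?A = "Poly_Mapping.keys a \<union> Poly_Mapping.keys b"
  have ext: "(\<Prod>v\<in>Poly_Mapping.keys c. x v ^ Poly_Mapping.lookup c v) =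
      (\<Prod>v\<in>?A. x v ^ Poly_Mapping.lookup c v)" if "Poly_Mapping.keys c \<subseteq> ?A" for c
    using that by (intro prod.mono_neutral_left) (auto simp: in_keys_iff)
  show ?thesis
    using ext[of a] ext[of b] ext[of "a + b"] Poly_Mapping.keys_add[of a b]
    by (simp add: lookup_add power_add prod.distrib)
qed

lemma eval_single:
  "eval x (Poly_Mapping.single m c) = c * (\<Prod>v\<in>Poly_Mapping.keys m. x v ^ Poly_Mapping.lookup m v)"
  by (simp add: eval_def)

lemma poly_mapping_add_induct:
  fixes f :: "'a \<Rightarrow>\<^sub>0 'b::ab_group_add"
  assumes "P 0" "\<And>m c. P (Poly_Mapping.single m c)" "\<And>f g. P f \<Longrightarrow> P g \<Longrightarrow> P (f + g)"
  shows "P f"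
proof -
  have "P (\<Sum>m\<in>A. Poly_Mapping.single m (Poly_Mapping.lookup f m))" if "finite A" for A
    using that by induction (auto intro: assms)
  moreover have "f = (\<Sum>m\<in>Poly_Mapping.keys f. Poly_Mapping.single m (Poly_Mapping.lookup f m))"
    by (rule poly_mapping_eqI) (simp add: lookup_sum lookup_single when_def in_keys_iff)
  ultimately show ?thesis by (metis finite_keys)
qed

lemma eval_mult: "eval x (f * g) = eval x f * eval x g"
proof (induction f rule: poly_mapping_add_induct)
  case (2 m c)
  show ?case
  proof (induction g rule: poly_mapping_add_induct)
    case (2 n d)
    show ?case by (simp add: mult_single eval_single monomial_add)
  qed (auto simp: eval_add distrib_left eval_def[of _ 0])
qed (auto simp: eval_add distrib_right eval_def[of _ 0])

definition irreducible_in :: "'a topology \<Rightarrow> 'a set \<Rightarrow> bool" where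
  "irreducible_in X Z \<longleftrightarrow> Z \<subseteq> topspace X \<and> Z \<noteq> {} \<and>
     (\<forall>A B. closedin X A \<and> closedin X B \<and> Z \<subseteq> A \<union> B \<longrightarrow> Z \<subseteq> A \<or> Z \<subseteq> B)"

definition irreducible_components :: "'a topology \<Rightarrow> 'a set set" where
  "irreducible_components X =
     {Z. irreducible_in X Z \<and> (\<forall>Z'. irreducible_in X Z' \<and> Z \<subseteq> Z' \<longrightarrow> Z' = Z)}"

text \<open>The supremum is taken in the extended naturals, so the empty space gets dimension 0.\<close>

definition krull_dim :: "'a topology \<Rightarrow> enat" where
  "krull_dim X = Sup {enat n | n. \<exists>Z.
     (\<forall>i\<le>n. irreducible_in X (Z i) \<and> closedin X (Z i)) \<and> (\<forall>i<n. Z i \<subset> Z (Suc i))}"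

definition homogeneous_ideal :: "('v::finite, 'k::field) mpoly set \<Rightarrow> bool" where
  "homogeneous_ideal J \<longleftrightarrow> J = ideal_gen {f \<in> J. \<exists>n. homogeneous n f}"

definition prime_ideal :: "'a::comm_ring_1 set \<Rightarrow> bool" where
  "prime_ideal J \<longleftrightarrow> Modules.module.subspace (*) J \<and> 1 \<notin> J \<and>
     (\<forall>a b. a * b \<in> J \<longrightarrow> a \<in> J \<or> b \<in> J)"

text \<open>The points of projective space, in the sense of schemes: the homogeneous primes
  that do not contain the irrelevant ideal.\<close>

definition Proj :: "('v::finite, 'k::field) mpoly set set" where
  "Proj = {p. prime_ideal p \<and> homogeneous_ideal p \<and> (\<exists>v. var v \<notin> p)}"

text \<open>The lemmas \<open>istopology_proj\<close> and \<open>istopology_zariski\<close> below show that the two families of sets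
  are topologies, so that \<open>openin\<close> of the resulting values of type \<open>topology\<close> is the stated predicate.\<close>

definition proj_topology :: "('v::finite, 'k::field) mpoly set topology" where
  "proj_topology = topology (\<lambda>U. \<exists>F. (\<forall>f\<in>F. \<exists>n. homogeneous n f) \<and> U = {p \<in> Proj. \<not> F \<subseteq> p})"

definition vanishing_locus :: "('v::finite, 'k::field) mpoly set \<Rightarrow> ('v, 'k) mpoly set set" (\<open>\<V>\<close>) where
  "\<V> F = {p \<in> Proj. F \<subseteq> p}"

lemma istopology_proj:
  "istopology (\<lambda>U. \<exists>F. (\<forall>f\<in>F. \<exists>n. homogeneous n f) \<and>
     U = {p \<in> (Proj :: ('v::finite, 'k::field) mpoly set set). \<not> F \<subseteq> p})"
  unfolding istopology_def
proof (intro conjI allI impI)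
  fix S T :: "('v, 'k) mpoly set set"
  assume "\<exists>F. (\<forall>f\<in>F. \<exists>n. homogeneous n f) \<and> S = {p \<in> Proj. \<not> F \<subseteq> p}"
    and "\<exists>F. (\<forall>f\<in>F. \<exists>n. homogeneous n f) \<and> T = {p \<in> Proj. \<not> F \<subseteq> p}"
  then obtain F G where FG: "\<forall>f\<in>F. \<exists>n. homogeneous n f" "\<forall>f\<in>G. \<exists>n. homogeneous n f"
    and ST: "S = {p \<in> Proj. \<not> F \<subseteq> p}" "T = {p \<in> Proj. \<not> G \<subseteq> p}" by auto
  let ?H = "{f * g | f g. f \<in> F \<and> g \<in> G}"
  have "\<forall>h\<in>?H. \<exists>n. homogeneous n h"
    using FG multihomogeneous_mult[of std_grading "\<lambda>_. _" _ "\<lambda>_. _"] by blast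
  moreover have "(\<not> ?H \<subseteq> p) = (\<not> F \<subseteq> p \<and> \<not> G \<subseteq> p)" if "p \<in> Proj" for p
  proof (rule iffI)
    assume "\<not> ?H \<subseteq> p"
    then obtain f g where fg: "f \<in> F" "g \<in> G" "f * g \<notin> p" by auto
    have id: "a * b \<in> p" if "b \<in> p" for a b
      using \<open>p \<in> Proj\<close> that Modules.module.subspace_def[of "(*)" p, OF module_mult]
      by (auto simp: Proj_def prime_ideal_def)
    from fg id[of g f] id[of f g] show "\<not> F \<subseteq> p \<and> \<not> G \<subseteq> p" by (auto simp: mult.commute)
  next
    assume "\<not> F \<subseteq> p \<and> \<not> G \<subseteq> p"
    then show "\<not> ?H \<subseteq> p" using that by (fastforce simp: Proj_def prime_ideal_def)
  qed
  then have "S \<inter> T = {p \<in> Proj. \<not> ?H \<subseteq> p}" unfolding ST by blast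
  ultimately show "\<exists>F. (\<forall>f\<in>F. \<exists>n. homogeneous n f) \<and> S \<inter> T = {p \<in> Proj. \<not> F \<subseteq> p}" by blast
next
  fix K :: "('v, 'k) mpoly set set set"
  assume "\<forall>U\<in>K. \<exists>F. (\<forall>f\<in>F. \<exists>n. homogeneous n f) \<and> U = {p \<in> Proj. \<not> F \<subseteq> p}"
  from bchoice[OF this] obtain \<F> where "\<forall>U\<in>K. (\<forall>f\<in>\<F> U. \<exists>n. homogeneous n f) \<and> U = {p \<in> Proj. \<not> \<F> U \<subseteq> p}"
    by (rule exE)
  then have hom: "\<And>U. U \<in> K \<Longrightarrow> \<forall>f\<in>\<F> U. \<exists>n. homogeneous n f"
    and mem: "\<And>U p. U \<in> K \<Longrightarrow> p \<in> U \<longleftrightarrow> p \<in> Proj \<and> \<not> \<F> U \<subseteq> p" by auto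
  have "\<forall>f\<in>(\<Union>U\<in>K. \<F> U). \<exists>n. homogeneous n f" using hom by simp
  moreover have "\<Union>K = {p \<in> Proj. \<not> (\<Union>U\<in>K. \<F> U) \<subseteq> p}"
    by (rule Set.set_eqI) (use mem in blast)
  ultimately show "\<exists>F. (\<forall>f\<in>F. \<exists>n. homogeneous n f) \<and> \<Union>K = {p \<in> Proj. \<not> F \<subseteq> p}" by blast
qed

text \<open>A closed subscheme is given by the set \<open>I\<close> of its equations, here a homogeneous ideal. Its
  local ring at \<open>p\<close> consists of the fractions \<open>a / s\<close> with \<open>a\<close>, \<open>s\<close> homogeneous of the same degree
  and \<open>s \<notin> p\<close>, taken modulo \<open>I\<close>; such a fraction is zero iff \<open>t * a \<in> I\<close> for some homogeneous
  \<open>t \<notin> p\<close>. A scheme is reduced if no local ring has nonzero nilpotents.\<close>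

definition subscheme_space :: "('v::finite, 'k::field) mpoly set \<Rightarrow> ('v, 'k) mpoly set topology" where
  "subscheme_space I = subtopology proj_topology (\<V> I)"

definition zero_in_stalk ::
  "('v::finite, 'k::field) mpoly set \<Rightarrow> ('v, 'k) mpoly set \<Rightarrow> ('v, 'k) mpoly \<Rightarrow> bool" where
  "zero_in_stalk I p a \<longleftrightarrow> (\<exists>t n. homogeneous n t \<and> t \<notin> p \<and> t * a \<in> I)"

definition reduced_subscheme :: "('v::finite, 'k::field) mpoly set \<Rightarrow> bool" where
  "reduced_subscheme I \<longleftrightarrow> (\<forall>p\<in>\<V> I. \<forall>a s n. homogeneous n a \<and> homogeneous n s \<and> s \<notin> p \<longrightarrow>
     (\<exists>k. zero_in_stalk I p (a ^ k)) \<longrightarrow> zero_in_stalk I p a)"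

definition equidimensional :: "'a topology \<Rightarrow> nat \<Rightarrow> bool" where
  "equidimensional X d \<longleftrightarrow> (\<forall>Z\<in>irreducible_components X. krull_dim (subtopology X Z) = enat d)"

text \<open>The rational points of the product, over \<open>i\<close> in the range of \<open>gr\<close>, of the projective spaces
  with homogeneous coordinates \<open>{v. gr v = i}\<close>. A point is the set of all its coordinate vectors.
  With \<open>gr = std_grading\<close> this is one projective space.\<close>

type_synonym ('v, 'k) point = "('v \<Rightarrow> 'k) set"

definition multiproj :: "('v::finite \<Rightarrow> 'i) \<Rightarrow> ('v, 'k::field) point set" where
  "multiproj gr = {{\<lambda>v. c (gr v) * x v | c. \<forall>i. c i \<noteq> 0} | x.
     \<forall>i\<in>range gr. \<exists>v. gr v = i \<and> x v \<noteq> 0}"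

definition zariski :: "('v::finite \<Rightarrow> 'i) \<Rightarrow> ('v, 'k::field) point topology" where
  "zariski gr = topology (\<lambda>U. \<exists>F. (\<forall>f\<in>F. \<exists>d. multihomogeneous gr d f) \<and>
     U = {P \<in> multiproj gr. \<exists>f\<in>F. \<forall>x\<in>P. eval x f \<noteq> 0})"

lemma istopology_zariski:
  "istopology (\<lambda>U. \<exists>F. (\<forall>f\<in>F. \<exists>d. multihomogeneous gr d f) \<and>
     U = {P \<in> (multiproj gr :: ('v::finite, 'k::field) point set). \<exists>f\<in>F. \<forall>x\<in>P. eval x f \<noteq> 0})"
  unfolding istopology_def
proof (intro conjI allI impI)
  fix S T :: "('v, 'k) point set"
  assume "\<exists>F. (\<forall>f\<in>F. \<exists>d. multihomogeneous gr d f) \<and>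
      S = {P \<in> multiproj gr. \<exists>f\<in>F. \<forall>x\<in>P. eval x f \<noteq> 0}"
    and "\<exists>F. (\<forall>f\<in>F. \<exists>d. multihomogeneous gr d f) \<and>
      T = {P \<in> multiproj gr. \<exists>f\<in>F. \<forall>x\<in>P. eval x f \<noteq> 0}"
  then obtain F G where FG: "\<forall>f\<in>F. \<exists>d. multihomogeneous gr d f" "\<forall>f\<in>G. \<exists>d. multihomogeneous gr d f"
    and ST: "S = {P \<in> multiproj gr. \<exists>f\<in>F. \<forall>x\<in>P. eval x f \<noteq> 0}"
      "T = {P \<in> multiproj gr. \<exists>f\<in>G. \<forall>x\<in>P. eval x f \<noteq> 0}" by auto
  let ?H = "{f * g | f g. f \<in> F \<and> g \<in> G}"
  have "\<forall>h\<in>?H. \<exists>d. multihomogeneous gr d h"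
    using FG multihomogeneous_mult[of gr] by blast
  moreover have "S \<inter> T = {P \<in> multiproj gr. \<exists>f\<in>?H. \<forall>x\<in>P. eval x f \<noteq> 0}"
  proof -
    have "(\<exists>f\<in>?H. \<forall>x\<in>P. eval x f \<noteq> 0) \<longleftrightarrow>
        (\<exists>f\<in>F. \<forall>x\<in>P. eval x f \<noteq> 0) \<and> (\<exists>g\<in>G. \<forall>x\<in>P. eval x g \<noteq> 0)" for P
    proof (rule iffI)
      assume "\<exists>f\<in>?H. \<forall>x\<in>P. eval x f \<noteq> 0"
      then obtain f g where "f \<in> F" "g \<in> G" "\<forall>x\<in>P. eval x (f * g) \<noteq> 0" by blast
      then show "(\<exists>f\<in>F. \<forall>x\<in>P. eval x f \<noteq> 0) \<and> (\<exists>g\<in>G. \<forall>x\<in>P. eval x g \<noteq> 0)"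
        unfolding eval_mult mult_eq_0_iff by blast
    next
      assume "(\<exists>f\<in>F. \<forall>x\<in>P. eval x f \<noteq> 0) \<and> (\<exists>g\<in>G. \<forall>x\<in>P. eval x g \<noteq> 0)"
      then obtain f g where fg: "f \<in> F" "g \<in> G" "\<forall>x\<in>P. eval x f \<noteq> 0" "\<forall>x\<in>P. eval x g \<noteq> 0"
        by blast
      then have "f * g \<in> ?H" "\<forall>x\<in>P. eval x (f * g) \<noteq> 0"
        by (blast, simp add: eval_mult)
      then show "\<exists>f\<in>?H. \<forall>x\<in>P. eval x f \<noteq> 0" by blast
    qed
    then show ?thesis unfolding ST by blast
  qed
  ultimately show "\<exists>F. (\<forall>f\<in>F. \<exists>d. multihomogeneous gr d f) \<and>
      S \<inter> T = {P \<in> multiproj gr. \<exists>f\<in>F. \<forall>x\<in>P. eval x f \<noteq> 0}" by blast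
next
  fix K :: "('v, 'k) point set set"
  assume "\<forall>U\<in>K. \<exists>F. (\<forall>f\<in>F. \<exists>d. multihomogeneous gr d f) \<and>
      U = {P \<in> multiproj gr. \<exists>f\<in>F. \<forall>x\<in>P. eval x f \<noteq> 0}"
  from bchoice[OF this] obtain \<F> where "\<forall>U\<in>K. (\<forall>f\<in>\<F> U. \<exists>d. multihomogeneous gr d f) \<and>
      U = {P \<in> multiproj gr. \<exists>f\<in>\<F> U. \<forall>x\<in>P. eval x f \<noteq> 0}"
    by (rule exE)
  then have hom: "\<And>U. U \<in> K \<Longrightarrow> \<forall>f\<in>\<F> U. \<exists>d. multihomogeneous gr d f"
    and mem: "\<And>U P. U \<in> K \<Longrightarrow>
      P \<in> U \<longleftrightarrow> P \<in> multiproj gr \<and> (\<exists>f\<in>\<F> U. \<forall>x\<in>P. eval x f \<noteq> 0)" by auto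
  have "\<forall>f\<in>(\<Union>U\<in>K. \<F> U). \<exists>d. multihomogeneous gr d f" using hom by simp
  moreover have "\<Union>K = {P \<in> multiproj gr. \<exists>f\<in>(\<Union>U\<in>K. \<F> U). \<forall>x\<in>P. eval x f \<noteq> 0}"
    by (rule Set.set_eqI) (use mem in blast)
  ultimately show "\<exists>F. (\<forall>f\<in>F. \<exists>d. multihomogeneous gr d f) \<and>
      \<Union>K = {P \<in> multiproj gr. \<exists>f\<in>F. \<forall>x\<in>P. eval x f \<noteq> 0}" by blast
qed

definition variety_space ::
  "('v::finite \<Rightarrow> 'i) \<Rightarrow> ('v, 'k::field) point set \<Rightarrow> ('v, 'k) point topology" where
  "variety_space gr Y = subtopology (zariski gr) Y"

definition regular_on ::
  "('v::finite \<Rightarrow> 'i) \<Rightarrow> ('v, 'k::field) point set \<Rightarrow> ('v, 'k) point set \<Rightarrow> (('v, 'k) point \<Rightarrow> 'k) \<Rightarrow> bool" where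
  "regular_on gr Y U h \<longleftrightarrow> (\<forall>P\<in>U. \<exists>W. openin (variety_space gr Y) W \<and> P \<in> W \<and> W \<subseteq> U \<and>
     (\<exists>a b d. multihomogeneous gr d a \<and> multihomogeneous gr d b \<and>
       (\<forall>Q\<in>W. \<forall>x\<in>Q. eval x b \<noteq> 0 \<and> h Q = eval x a / eval x b)))"

definition isomorphic_varieties ::
  "('v::finite \<Rightarrow> 'i) \<Rightarrow> ('v, 'k::field) point set \<Rightarrow>
   ('w::finite \<Rightarrow> 'j) \<Rightarrow> ('w, 'k) point set \<Rightarrow> bool" where
  "isomorphic_varieties gr Y gr' Y' \<longleftrightarrow> (\<exists>\<phi>.
     homeomorphic_map (variety_space gr Y) (variety_space gr' Y') \<phi> \<and>
     (\<forall>U h. openin (variety_space gr' Y') U \<longrightarrow>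
        regular_on gr' Y' U h = regular_on gr Y {P \<in> Y. \<phi> P \<in> U} (h \<circ> \<phi>)))"

text \<open>A rational point of projective space is identified with the homogeneous prime of all
  polynomials vanishing at it. For a closed subset \<open>Z\<close> of the scheme this yields the variety
  of its rational points.\<close>

definition point_ideal :: "('v::finite, 'k::field) point \<Rightarrow> ('v, 'k) mpoly set" where
  "point_ideal P = ideal_gen {f. (\<exists>n. homogeneous n f) \<and> (\<forall>x\<in>P. eval x f = 0)}"

definition variety_of :: "('v::finite, 'k::field) mpoly set set \<Rightarrow> ('v, 'k) point set" where
  "variety_of Z = {P \<in> multiproj std_grading. point_ideal P \<in> Z}"

definition isomorphic_to_P2 :: "('v::finite, 'k::field) mpoly set set \<Rightarrow> bool" where
  "isomorphic_to_P2 Z \<longleftrightarrow>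
     isomorphic_varieties std_grading (variety_of Z) std_grading (multiproj (std_grading :: 3 \<Rightarrow> unit))"

text \<open>The variables \<open>(i, j)\<close> with fixed \<open>i\<close> are the two homogeneous coordinates of the \<open>i\<close>-th line;
  closed sets and regular functions on the product come from bihomogeneous polynomials.\<close>

definition isomorphic_to_P1_P1 :: "('v::finite, 'k::field) mpoly set set \<Rightarrow> bool" where
  "isomorphic_to_P1_P1 Z \<longleftrightarrow>
     isomorphic_varieties std_grading (variety_of Z) fst (multiproj (fst :: 2 \<times> 2 \<Rightarrow> 2))"

text \<open>The generators are the letters 1, 2, 3, 4. Elements of the free algebra on the dual basis
  are written with the same letters.\<close>

definition quadratic :: "(nat, 'k::field) free_alg \<Rightarrow> bool" where
  "quadratic f \<longleftrightarrow> Poly_Mapping.keys f \<subseteq> {Word [i, j] | i j. i \<in> {1..4} \<and> j \<in> {1..4}}"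

definition pairing :: "(nat, 'k::field) free_alg \<Rightarrow> (nat, 'k) free_alg \<Rightarrow> 'k" where
  "pairing f r = (\<Sum>i=1..4. \<Sum>j=1..4.
     Poly_Mapping.lookup f (Word [i, j]) * Poly_Mapping.lookup r (Word [i, j]))"

definition dual_relations :: "(nat, 'k::field) free_alg set \<Rightarrow> (nat, 'k) free_alg set" where
  "dual_relations rs = {f. quadratic f \<and> (\<forall>r\<in>rs. pairing f r = 0)}"

abbreviation scale :: "'k \<Rightarrow> (nat, 'k::field) free_alg \<Rightarrow> (nat, 'k) free_alg" where
  "scale c f \<equiv> const c * f"

definition dual_basis :: "(nat, 'k::field) free_alg set \<Rightarrow> (nat, 'k) free_alg list \<Rightarrow> bool" where
  "dual_basis rs fs \<longleftrightarrow> length fs = 10 \<and> distinct fs \<and>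
     \<not> Modules.module.dependent scale (set fs) \<and>
     Modules.module.span scale (set fs) = dual_relations rs"

datatype uv = U nat | V nat

text \<open>The entry of the matrix of linear forms in row \<open>i\<close> (from 0) and column \<open>j\<close> (from 1), with \<open>w k\<close>
  substituted for \<open>z\<^sub>k\<close>: the \<open>i\<close>-th relation is the sum over \<open>j\<close> of this entry times \<open>z\<^sub>j\<close>.\<close>

definition hat_M :: "(nat, 'k::field) free_alg list \<Rightarrow> (nat \<Rightarrow> (uv, 'k) mpoly) \<Rightarrow> nat \<Rightarrow> nat \<Rightarrow> (uv, 'k) mpoly" where
  "hat_M fs w i j = (\<Sum>k=1..4. const (Poly_Mapping.lookup (fs ! i) (Word [k, j])) * w k)"

definition uv_matrix :: "(nat, 'k::field) free_alg list \<Rightarrow> (uv, 'k) mpoly mat" where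
  "uv_matrix fs = mat 10 8 (\<lambda>(i, j).
     if j < 4 then hat_M fs (\<lambda>k. var (U k)) i (j + 1) else hat_M fs (\<lambda>k. var (V k)) i (j - 3))"

definition minor_rows :: "nat set set" where
  "minor_rows = {S. S \<subseteq> {..<10} \<and> card S = 8}"

definition minor8 :: "(nat, 'k::field) free_alg list \<Rightarrow> nat set \<Rightarrow> (uv, 'k) mpoly" where
  "minor8 fs S = Determinant.det (mat 8 8 (\<lambda>(i, j). uv_matrix fs $$ (sorted_list_of_set S ! i, j)))"

text \<open>The same variables are used for the \<open>N\<^sub>i\<^sub>j\<close> (before the substitution \<open>M_of_N\<close>) and for the
  coordinates \<open>M\<^sub>i\<^sub>j\<close>.\<close>

datatype plucker = M12 | M13 | M14 | M23 | M24 | M34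

instance plucker :: finite
proof
  have "(UNIV :: plucker set) = {M12, M13, M14, M23, M24, M34}"
    using plucker.exhaust by blast
  then show "finite (UNIV :: plucker set)" by (metis finite.emptyI finite_insert)
qed

definition N_uv :: "nat \<Rightarrow> nat \<Rightarrow> (uv, 'k::field) mpoly" where
  "N_uv i j = var (U i) * var (V j) - var (U j) * var (V i)"

fun N_form :: "plucker \<Rightarrow> (uv, 'k::field) mpoly" where
  "N_form M12 = N_uv 1 2"
| "N_form M13 = N_uv 1 3"
| "N_form M14 = N_uv 1 4"
| "N_form M23 = N_uv 2 3"
| "N_form M24 = N_uv 2 4"
| "N_form M34 = N_uv 3 4"

fun M_of_N :: "plucker \<Rightarrow> (plucker, 'k::field) mpoly" where
  "M_of_N M12 = var M34"
| "M_of_N M13 = - var M24"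
| "M_of_N M14 = var M23"
| "M_of_N M23 = var M14"
| "M_of_N M24 = - var M13"
| "M_of_N M34 = var M12"

definition plucker_poly :: "(plucker, 'k::field) mpoly" where
  "plucker_poly = var M12 * var M34 - var M13 * var M24 + var M14 * var M23"

text \<open>\<open>I\<close> is the ideal of the line scheme computed from some basis \<open>fs\<close> of the relations of the
  quadratic dual and some choice \<open>g S\<close> of quartic expressions in the \<open>N\<^sub>i\<^sub>j\<close> of the forty-five minors.
  The expressions are unique only up to multiples of the Plucker polynomial.\<close>

definition line_scheme_ideal :: "(nat, 'k::field) free_alg set \<Rightarrow> (plucker, 'k) mpoly set \<Rightarrow> bool" where
  "line_scheme_ideal rs I \<longleftrightarrow> (\<exists>fs g. dual_basis rs fs \<and>
     (\<forall>S\<in>minor_rows. homogeneous 4 (g S) \<and> subst N_form (g S) = minor8 fs S) \<and>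
     I = ideal_gen (insert plucker_poly ((\<lambda>S. subst M_of_N (g S)) ` minor_rows)))"

definition R_relations :: "(nat, 'k::field) free_alg set" where
  "R_relations =
    {gen 1 * gen 2 + gen 2 * gen 1,
     gen 1 * gen 3 + gen 4 * gen 2,
     gen 1 * gen 4 - gen 3 * gen 2,
     gen 2 * gen 3 - gen 4 * gen 1,
     gen 2 * gen 4 + gen 3 * gen 1,
     gen 3 * gen 4 + gen 4 * gen 3}"

end

theory Submission
  imports Defs
begin

text \<open>Let \<open>I\<close> be the ideal of the line scheme and \<open>J\<close> the intersection of the ideals of the
  seven surfaces. On every surface a dense set of lines carries an explicit relation of rank two,
  which makes all the minors vanish there, so \<open>I \<subseteq> J\<close>. Conversely, a linear change of coordinates
  that turns the linear equations of the surfaces into monomial ones shows that \<open>J\<close> is generated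
  by \<open>P\<close> and four cubics, which come from four alternating faces of an octahedron. The product
  of each cubic with any variable is an explicit combination of minors and multiples of \<open>P\<close>.
  Hence \<open>I\<close> and \<open>J\<close> agree up to the irrelevant ideal, so the scheme is reduced and
  its components are the seven surfaces. The dimension is bounded above by the argument of Coquand
  and Lombardi, which counts algebraic relations instead of using transcendence degrees, and the
  isomorphisms are given by the parametrisations of the surfaces.\<close>

text \<open>\<open>I\<close> and \<open>J\<close> are different ideals: apart from \<open>P\<close>
  the generators of \<open>I\<close> are quartics, while \<open>J\<close> contains cubics that are
  no multiples of \<open>P\<close>. So only the inclusion of \<open>var v * J\<close> in
  \<open>I\<close> can be aimed at; it suffices because every point of \<open>Proj\<close> misses
  some variable. The statement speaks of homogeneous primes, the proof almost only of vectors over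
  the ground field. In characteristic zero a polynomial is determined by its values, so a surface is
  handled as the cone \<open>X\<close> of its coordinate vectors and its prime as the ideal
  \<open>Van X\<close>; primality, homogeneity and polynomial identities become statements about
  values. Neither the basis of the dual relations nor the quartics are canonical. Values at pairs of
  vectors \<open>u\<close>, \<open>v\<close> avoid both choices: the kernel of the substitution
  \<open>N_form\<close> is generated by \<open>P\<close>, which lies in \<open>I\<close>, and
  multilinearity of the determinant expresses the minors of one basis by those of any other. Thus
  explicit minors are computed only for the sparse basis \<open>rels\<close>.\<close>

lemmas ideal_base = Modules.module.span_base[OF module_mult]
  and ideal_zero = Modules.module.span_zero[OF module_mult]
  and ideal_add = Modules.module.span_add[OF module_mult]
  and ideal_diff = Modules.module.span_diff[OF module_mult]
  and ideal_neg = Modules.module.span_neg[OF module_mult]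
  and ideal_sum = Modules.module.span_sum[OF module_mult]
  and ideal_scale = Modules.module.span_scale[OF module_mult]
  and ideal_minimal = Modules.module.span_minimal[OF module_mult]
  and ideal_mono = Modules.module.span_mono[OF module_mult]
  and ideal_subspace = Modules.module.subspace_span[OF module_mult]
  and subspace_iff = Modules.module.subspace_def[OF module_mult]

section \<open>Evaluation and substitution\<close>

abbreviation mono_eval :: "('v \<Rightarrow> 'k::field) \<Rightarrow> ('v \<Rightarrow>\<^sub>0 nat) \<Rightarrow> 'k" where
  "mono_eval x m \<equiv> (\<Prod>v\<in>Poly_Mapping.keys m. x v ^ Poly_Mapping.lookup m v)"

lemma eval_zero [simp]: "eval x 0 = 0"
  by (simp add: eval_def)

lemma eval_const [simp]: "eval x (const c) = c"
  by (simp add: const_def eval_single)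

lemma eval_one [simp]: "eval x 1 = 1"
  using eval_const[of x 1] by (simp add: const_def)

lemma eval_var [simp]: "eval x (var v) = x v"
  by (simp add: var_def eval_single)

lemma eval_uminus: "eval x (- f) = - eval x f"
  using eval_add[of x f "- f"] by (simp add: add_eq_0_iff2)

lemma eval_diff: "eval x (f - g) = eval x f - eval x g"
  using eval_add[of x f "- g"] by (simp add: eval_uminus)

lemma eval_sum: "eval x (\<Sum>i\<in>A. f i) = (\<Sum>i\<in>A. eval x (f i))"
  by (induction A rule: infinite_finite_induct) (auto simp: eval_add)

lemma eval_prod: "eval x (\<Prod>i\<in>A. f i) = (\<Prod>i\<in>A. eval x (f i))"
  by (induction A rule: infinite_finite_induct) (auto simp: eval_mult)

lemma eval_power: "eval x (f ^ n) = eval x f ^ n"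
  by (induction n) (auto simp: eval_mult)

lemmas eval_simps = eval_add eval_mult eval_uminus eval_diff eval_sum eval_prod eval_power

lemma eval_subst: "eval x (subst \<sigma> f) = eval (\<lambda>v. eval x (\<sigma> v)) f"
  by (simp add: subst_def eval_simps) (simp add: eval_def)

lemma mono_eval_superset:
  assumes "finite B" "Poly_Mapping.keys m \<subseteq> B"
  shows "mono_eval x m = (\<Prod>v\<in>B. x v ^ Poly_Mapping.lookup m v)"
  using assms by (intro prod.mono_neutral_left) (auto simp: in_keys_iff)

lemma mono_eval_scale:
  "mono_eval (x(v := a * x v)) m = a ^ Poly_Mapping.lookup m v * mono_eval x m"
proof -
  let ?B = "insert v (Poly_Mapping.keys m)"
  have "mono_eval (x(v := a * x v)) m =
      (\<Prod>w\<in>?B. (if w = v then a ^ Poly_Mapping.lookup m v else 1) * x w ^ Poly_Mapping.lookup m w)"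
    by (subst mono_eval_superset[of ?B]) (auto intro!: prod.cong simp: power_mult_distrib)
  also have "\<dots> = a ^ Poly_Mapping.lookup m v * (\<Prod>w\<in>?B. x w ^ Poly_Mapping.lookup m w)"
    by (simp add: prod.distrib prod.delta del: prod.insert)
  also have "(\<Prod>w\<in>?B. x w ^ Poly_Mapping.lookup m w) = mono_eval x m"
    by (rule mono_eval_superset[symmetric]) auto
  finally show ?thesis .
qed

lemma mono_eval_split:
  "mono_eval x m = x v ^ Poly_Mapping.lookup m v * mono_eval (x(v := 1)) m"
  using mono_eval_scale[of "x(v := 1)" v "x v" m] by simp

lemma mono_eval_scale_all:
  fixes m :: "'v::finite \<Rightarrow>\<^sub>0 nat"
  shows "mono_eval (\<lambda>v. c * x v) m = c ^ (\<Sum>v\<in>UNIV. Poly_Mapping.lookup m v) * mono_eval x m"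
  by (simp add: mono_eval_superset[of UNIV] power_mult_distrib prod.distrib power_sum)

lemma mono_eval_unused:
  assumes "Poly_Mapping.lookup m v = 0"
  shows "mono_eval (x(v := s)) m = mono_eval x m"
  using assms by (intro prod.cong) (auto simp: in_keys_iff)

text \<open>Monomials with different exponents of some variable are different eigenvectors for the
  scaling of this variable by 2, hence linearly independent as functions.\<close>

lemma mono_eval_independent:
  fixes c :: "('v \<Rightarrow>\<^sub>0 nat) \<Rightarrow> 'k::field_char_0"
  assumes "finite A" "\<And>x. (\<Sum>m\<in>A. c m * mono_eval x m) = 0" "m \<in> A"
  shows "c m = 0"
  using assms
proof (induction A arbitrary: c m rule: finite_induct)
  case (insert n A)
  have c0: "c k = 0" if "k \<in> A" for k
  proof -
    have "k \<noteq> n" using that insert.hyps by auto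
    then have "\<exists>v. Poly_Mapping.lookup k v \<noteq> Poly_Mapping.lookup n v"
      by (metis poly_mapping_eqI)
    then obtain v where v: "Poly_Mapping.lookup k v \<noteq> Poly_Mapping.lookup n v" ..
    \<comment> \<open>Subtracting \<open>2 ^ Poly_Mapping.lookup n v\<close> times the relation from
      the relation at the point with coordinate \<open>v\<close> doubled removes the term of
      \<open>n\<close>.\<close>
    define d where "d m = c m * (2 ^ Poly_Mapping.lookup m v - 2 ^ Poly_Mapping.lookup n v)" for m
    have "(\<Sum>m\<in>A. d m * mono_eval x m) = 0" for x
    proof -
      have "(\<Sum>m\<in>insert n A. d m * mono_eval x m) =
          (\<Sum>m\<in>insert n A. c m * mono_eval (x(v := 2 * x v)) m) -
          2 ^ Poly_Mapping.lookup n v * (\<Sum>m\<in>insert n A. c m * mono_eval x m)"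
        unfolding mono_eval_scale sum_distrib_left sum_subtractf[symmetric]
        by (intro sum.cong) (auto simp: algebra_simps d_def)
      also have "\<dots> = 0" using insert.prems(1) by (simp del: sum.insert)
      finally show ?thesis using insert.hyps by (simp add: d_def)
    qed
    from insert.IH[OF this that] have "c k = 0 \<or> (2::'k) ^ Poly_Mapping.lookup k v = 2 ^ Poly_Mapping.lookup n v"
      by (auto simp: d_def)
    moreover have "(2::'k) ^ Poly_Mapping.lookup k v \<noteq> 2 ^ Poly_Mapping.lookup n v"
    proof
      assume "(2::'k) ^ Poly_Mapping.lookup k v = 2 ^ Poly_Mapping.lookup n v"
      then have "of_nat (2 ^ Poly_Mapping.lookup k v) = (of_nat (2 ^ Poly_Mapping.lookup n v) :: 'k)" by simp
      then show False using v by (simp only: of_nat_eq_iff) simp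
    qed
    ultimately show ?thesis by blast
  qed
  have "c n = 0" using insert.prems(1)[of "\<lambda>_. 1"] insert.hyps c0 by simp
  with c0 insert.prems(2) show ?case by auto
qed auto

text \<open>From here on polynomials may be identified with functions, so identities between them,
  including all rules for \<open>subst\<close>, are checked pointwise.\<close>

lemma poly_zeroI:
  fixes f :: "('v, 'k::field_char_0) mpoly"
  assumes "\<And>x. eval x f = 0"
  shows "f = 0"
proof (rule poly_mapping_eqI)
  fix m
  show "Poly_Mapping.lookup f m = Poly_Mapping.lookup 0 m"
    using mono_eval_independent[of "Poly_Mapping.keys f" "Poly_Mapping.lookup f" m] assms
    by (cases "m \<in> Poly_Mapping.keys f") (auto simp: eval_def in_keys_iff)
qed

lemma poly_eqI:
  fixes f g :: "('v, 'k::field_char_0) mpoly"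
  assumes "\<And>x. eval x f = eval x g"
  shows "f = g"
  using poly_zeroI[of "f - g"] assms by (simp add: eval_diff)

lemma subst_var_id: "subst var f = (f :: ('v, 'k::field_char_0) mpoly)"
  by (rule poly_eqI) (simp add: eval_subst)

lemma subst_add: "subst \<sigma> (f + g) = (subst \<sigma> f + subst \<sigma> g :: ('v, 'k::field_char_0) mpoly)"
  and subst_mult: "subst \<sigma> (f * g) = (subst \<sigma> f * subst \<sigma> g :: ('v, 'k::field_char_0) mpoly)"
  and subst_diff: "subst \<sigma> (f - g) = (subst \<sigma> f - subst \<sigma> g :: ('v, 'k::field_char_0) mpoly)"
  and subst_uminus: "subst \<sigma> (- f) = (- subst \<sigma> f :: ('v, 'k::field_char_0) mpoly)"
  and subst_power: "subst \<sigma> (f ^ n) = (subst \<sigma> f ^ n :: ('v, 'k::field_char_0) mpoly)"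
  and subst_zero: "subst \<sigma> 0 = (0 :: ('v, 'k::field_char_0) mpoly)"
  and subst_one: "subst \<sigma> 1 = (1 :: ('v, 'k::field_char_0) mpoly)"
  and subst_var: "subst \<sigma> (var w) = (\<sigma> w :: ('v, 'k::field_char_0) mpoly)"
  and subst_const: "subst \<sigma> (const c) = (const c :: ('v, 'k::field_char_0) mpoly)"
  by (rule poly_eqI; simp add: eval_subst eval_simps)+

lemma subst_sum: "subst \<sigma> (\<Sum>i\<in>A. f i) = (\<Sum>i\<in>A. subst \<sigma> (f i) :: ('v, 'k::field_char_0) mpoly)"
  and subst_prod: "subst \<sigma> (\<Prod>i\<in>A. f i) = (\<Prod>i\<in>A. subst \<sigma> (f i) :: ('v, 'k::field_char_0) mpoly)"
  and subst_subst: "subst \<sigma> (subst \<tau> h) = (subst (\<lambda>v. subst \<sigma> (\<tau> v)) h :: ('v, 'k::field_char_0) mpoly)"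
  by (rule poly_eqI; simp add: eval_subst eval_simps)+

lemmas subst_simps = subst_add subst_mult subst_diff subst_uminus subst_power subst_zero subst_one
  subst_var subst_const subst_sum subst_prod

section \<open>Homogeneous polynomials\<close>

lemma homogeneous_iff:
  "homogeneous n f \<longleftrightarrow> (\<forall>m\<in>Poly_Mapping.keys f. (\<Sum>v\<in>UNIV. Poly_Mapping.lookup m v) = n)"
  by (simp add: multihomogeneous_def std_grading_def)

lemma multihomogeneous_zero: "multihomogeneous gr d 0"
  by (simp add: multihomogeneous_def)

lemma multihomogeneous_const: "multihomogeneous gr (\<lambda>_. 0) (const c)"
  by (simp add: multihomogeneous_def const_def)

lemma multihomogeneous_one: "multihomogeneous gr (\<lambda>_. 0) 1"
  using multihomogeneous_const[of gr 1] by (simp add: const_def)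

lemma multihomogeneous_var: "multihomogeneous gr (\<lambda>i. if i = gr v then 1 else 0) (var v)"
  by (auto simp: multihomogeneous_def var_def lookup_single when_def)

lemma multihomogeneous_add:
  assumes "multihomogeneous gr d f" "multihomogeneous gr d g"
  shows "multihomogeneous gr d (f + g)"
  using assms Poly_Mapping.keys_add[of f g] unfolding multihomogeneous_def by blast

lemma multihomogeneous_uminus: "multihomogeneous gr d f \<Longrightarrow> multihomogeneous gr d (- f)"
  by (simp add: multihomogeneous_def)

lemma multihomogeneous_diff:
  "multihomogeneous gr d f \<Longrightarrow> multihomogeneous gr d g \<Longrightarrow> multihomogeneous gr d (f - g)"
  using multihomogeneous_add[of gr d f "- g"] by (simp add: multihomogeneous_uminus)

lemma multihomogeneous_sum:
  "(\<And>i. i \<in> A \<Longrightarrow> multihomogeneous gr d (f i)) \<Longrightarrow> multihomogeneous gr d (\<Sum>i\<in>A. f i)"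
  by (induction A rule: infinite_finite_induct) (auto intro: multihomogeneous_zero multihomogeneous_add)

lemma multihomogeneous_prod:
  "(\<And>i. i \<in> A \<Longrightarrow> multihomogeneous gr (d i) (f i)) \<Longrightarrow>
    multihomogeneous gr (\<lambda>j. \<Sum>i\<in>A. d i j) (\<Prod>i\<in>A. f i)"
  by (induction A rule: infinite_finite_induct) (auto intro: multihomogeneous_one multihomogeneous_mult)

lemma multihomogeneous_power:
  "multihomogeneous gr d f \<Longrightarrow> multihomogeneous gr (\<lambda>j. n * d j) (f ^ n)"
  by (induction n) (auto intro: multihomogeneous_one multihomogeneous_mult)

lemma homogeneous_var: "homogeneous 1 (var v)"
  using multihomogeneous_var[of std_grading v] by (simp add: std_grading_def)

lemma multihomogeneous_smult:
  "multihomogeneous gr d f \<Longrightarrow> multihomogeneous gr d (const c * f)"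
  using multihomogeneous_mult[OF multihomogeneous_const, of gr d f c] by simp

text \<open>Every block of variables may be replaced by forms of its own multidegree
  \<open>D j\<close>. This is the form needed to pull back equations and fractions along maps
  between products of projective spaces.\<close>

lemma multihomogeneous_subst:
  fixes F :: "'w::finite \<Rightarrow> ('v::finite, 'k::field) mpoly"
  assumes F: "\<And>w. multihomogeneous gr (D (gr' w)) (F w)" and f: "multihomogeneous gr' d f"
  shows "multihomogeneous gr (\<lambda>i. \<Sum>j\<in>range gr'. d j * D j i) (subst F f)"
  unfolding subst_def
proof (intro multihomogeneous_sum multihomogeneous_smult)
  fix m assume m: "m \<in> Poly_Mapping.keys f"
  have "multihomogeneous gr (\<lambda>i. \<Sum>w\<in>Poly_Mapping.keys m. Poly_Mapping.lookup m w * D (gr' w) i)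
      (\<Prod>w\<in>Poly_Mapping.keys m. F w ^ Poly_Mapping.lookup m w)"
    by (intro multihomogeneous_prod multihomogeneous_power F)
  moreover have "(\<Sum>w\<in>Poly_Mapping.keys m. Poly_Mapping.lookup m w * D (gr' w) i) =
      (\<Sum>j\<in>range gr'. d j * D j i)" for i
  proof -
    have "(\<Sum>w\<in>Poly_Mapping.keys m. Poly_Mapping.lookup m w * D (gr' w) i) =
        (\<Sum>w\<in>UNIV. Poly_Mapping.lookup m w * D (gr' w) i)"
      by (intro sum.mono_neutral_left) (auto simp: in_keys_iff)
    also have "\<dots> = (\<Sum>j\<in>range gr'. \<Sum>w | w \<in> UNIV \<and> gr' w = j. Poly_Mapping.lookup m w * D (gr' w) i)"
      by (rule sum.image_gen) simp
    also have "\<dots> = (\<Sum>j\<in>range gr'. d j * D j i)"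
    proof (rule sum.cong)
      fix j
      have "(\<Sum>w | w \<in> UNIV \<and> gr' w = j. Poly_Mapping.lookup m w * D (gr' w) i) =
          (\<Sum>w | gr' w = j. Poly_Mapping.lookup m w) * D j i"
        unfolding sum_distrib_right by (rule sum.cong) auto
      also have "(\<Sum>w | gr' w = j. Poly_Mapping.lookup m w) = d j"
        using f m by (auto simp: multihomogeneous_def)
      finally show "(\<Sum>w | w \<in> UNIV \<and> gr' w = j. Poly_Mapping.lookup m w * D (gr' w) i) = d j * D j i" .
    qed simp
    finally show ?thesis .
  qed
  ultimately show "multihomogeneous gr (\<lambda>i. \<Sum>j\<in>range gr'. d j * D j i)
      (\<Prod>v\<in>Poly_Mapping.keys m. F v ^ Poly_Mapping.lookup m v)" by simp
qed

lemma eval_homogeneous: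
  assumes "multihomogeneous gr d f"
  shows "eval (\<lambda>v. c (gr v) * x v) f = (\<Prod>i\<in>range gr. c i ^ d i) * eval x f"
proof -
  have "mono_eval (\<lambda>v. c (gr v) * x v) m = (\<Prod>i\<in>range gr. c i ^ d i) * mono_eval x m"
    if "m \<in> Poly_Mapping.keys f" for m
  proof -
    have "mono_eval (\<lambda>v. c (gr v) * x v) m =
        (\<Prod>v\<in>UNIV. c (gr v) ^ Poly_Mapping.lookup m v) * mono_eval x m"
      by (simp add: mono_eval_superset[of UNIV] power_mult_distrib prod.distrib)
    also have "(\<Prod>v\<in>UNIV. c (gr v) ^ Poly_Mapping.lookup m v) =
        (\<Prod>i\<in>range gr. \<Prod>v | v \<in> UNIV \<and> gr v = i. c (gr v) ^ Poly_Mapping.lookup m v)"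
      by (rule prod.image_gen) simp
    also have "\<dots> = (\<Prod>i\<in>range gr. c i ^ d i)"
    proof (rule prod.cong)
      fix i
      have "(\<Prod>v | v \<in> UNIV \<and> gr v = i. c (gr v) ^ Poly_Mapping.lookup m v) =
          c i ^ (\<Sum>v | gr v = i. Poly_Mapping.lookup m v)"
        unfolding power_sum by (rule prod.cong) auto
      then show "(\<Prod>v | v \<in> UNIV \<and> gr v = i. c (gr v) ^ Poly_Mapping.lookup m v) = c i ^ d i"
        using assms that by (simp add: multihomogeneous_def)
    qed simp
    finally show ?thesis .
  qed
  then have "Poly_Mapping.lookup f m * mono_eval (\<lambda>v. c (gr v) * x v) m =
      (\<Prod>i\<in>range gr. c i ^ d i) * (Poly_Mapping.lookup f m * mono_eval x m)"
    if "m \<in> Poly_Mapping.keys f" for m using that by (simp only: mult.left_commute)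
  then show ?thesis unfolding eval_def sum_distrib_left by (rule sum.cong[OF refl])
qed

definition hom_part :: "nat \<Rightarrow> ('v::finite, 'k::field) mpoly \<Rightarrow> ('v, 'k) mpoly" where
  "hom_part n f = (\<Sum>m | m \<in> Poly_Mapping.keys f \<and> (\<Sum>v\<in>UNIV. Poly_Mapping.lookup m v) = n.
     Poly_Mapping.single m (Poly_Mapping.lookup f m))"

lemma homogeneous_hom_part: "homogeneous n (hom_part n f)"
  unfolding hom_part_def
  by (intro multihomogeneous_sum) (auto simp: homogeneous_iff)

lemma sum_hom_part:
  "f = (\<Sum>n\<in>(\<lambda>m. \<Sum>v\<in>UNIV. Poly_Mapping.lookup m v) ` Poly_Mapping.keys f. hom_part n f)"
proof -
  have "f = (\<Sum>m\<in>Poly_Mapping.keys f. Poly_Mapping.single m (Poly_Mapping.lookup f m))"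
    by (rule poly_mapping_eqI) (simp add: lookup_sum lookup_single when_def in_keys_iff)
  also have "\<dots> = (\<Sum>n\<in>(\<lambda>m. \<Sum>v\<in>UNIV. Poly_Mapping.lookup m v) ` Poly_Mapping.keys f. hom_part n f)"
    unfolding hom_part_def by (rule sum.image_gen) simp
  finally show ?thesis .
qed

lemma eval_hom_part:
  "eval x (hom_part n f) = (\<Sum>m | m \<in> Poly_Mapping.keys f \<and> (\<Sum>v\<in>UNIV. Poly_Mapping.lookup m v) = n.
     Poly_Mapping.lookup f m * mono_eval x m)"
  by (simp add: hom_part_def eval_sum eval_single)

text \<open>Composition with \<open>T\<close> acts on the functions \<open>\<phi> m\<close> as on
  eigenvectors, and contributions of different eigenvalues are independent. Working on a subset
  \<open>X\<close> stable under \<open>T\<close> makes this usable for monomials restricted to a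
  cone or to a quadric, where they need not be independent.\<close>

lemma eigenvector_separation:
  fixes \<phi> :: "'m \<Rightarrow> 'x \<Rightarrow> 'k::field"
  assumes "finite A" and T: "\<And>x. x \<in> X \<Longrightarrow> T x \<in> X"
    and eig: "\<And>m x. m \<in> A \<Longrightarrow> x \<in> X \<Longrightarrow> \<phi> m (T x) = \<mu> m * \<phi> m x"
    and zero: "\<And>x. x \<in> X \<Longrightarrow> (\<Sum>m\<in>A. c m * \<phi> m x) = 0"
    and "x \<in> X"
  shows "(\<Sum>m | m \<in> A \<and> \<mu> m = e. c m * \<phi> m x) = 0"
proof -
  \<comment> \<open>Induction on the set \<open>M\<close> of eigenvalues other than
    \<open>e\<close>, with the coefficients kept variable.\<close>
  have "finite M \<Longrightarrow> finite A \<Longrightarrow> \<mu> ` A \<subseteq> insert e M \<Longrightarrow> e \<notin> M \<Longrightarrow>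
      (\<And>m x. m \<in> A \<Longrightarrow> x \<in> X \<Longrightarrow> \<phi> m (T x) = \<mu> m * \<phi> m x) \<Longrightarrow>
      (\<And>x. x \<in> X \<Longrightarrow> (\<Sum>m\<in>A. c m * \<phi> m x) = 0) \<Longrightarrow>
      (\<Sum>m | m \<in> A \<and> \<mu> m = e. c m * \<phi> m x) = 0" for M A and c :: "'m \<Rightarrow> 'k"
  proof (induction M arbitrary: A c rule: finite_induct)
    case empty
    then have "{m. m \<in> A \<and> \<mu> m = e} = A" by auto
    with empty \<open>x \<in> X\<close> show ?case by simp
  next
    case (insert d M)
    \<comment> \<open>Comparing the relation at \<open>T y\<close> with \<open>d\<close> times the
      relation at \<open>y\<close> multiplies each term by \<open>\<mu> m - d\<close>, which removes
      the eigenvalue \<open>d\<close>.\<close>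
    let ?A = "{m \<in> A. \<mu> m \<noteq> d}" and ?c = "\<lambda>m. c m * (\<mu> m - d)"
    have "(\<Sum>m\<in>?A. ?c m * \<phi> m y) = 0" if "y \<in> X" for y
    proof -
      have "(\<Sum>m\<in>?A. ?c m * \<phi> m y) = (\<Sum>m\<in>A. ?c m * \<phi> m y)"
        using insert.prems(1) by (intro sum.mono_neutral_left) auto
      also have "\<dots> = (\<Sum>m\<in>A. c m * \<phi> m (T y)) - d * (\<Sum>m\<in>A. c m * \<phi> m y)"
        unfolding sum_distrib_left sum_subtractf[symmetric]
      proof (rule sum.cong)
        fix m assume "m \<in> A"
        from insert.prems(4)[OF this that]
        show "?c m * \<phi> m y = c m * \<phi> m (T y) - d * (c m * \<phi> m y)"
          by (simp only:) (simp add: algebra_simps)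
      qed simp
      also have "\<dots> = 0" using insert.prems(5) T that by simp
      finally show ?thesis .
    qed
    with insert.prems insert.hyps have "(\<Sum>m | m \<in> ?A \<and> \<mu> m = e. ?c m * \<phi> m x) = 0"
      by (intro insert.IH) auto
    also have "(\<Sum>m | m \<in> ?A \<and> \<mu> m = e. ?c m * \<phi> m x) =
        (e - d) * (\<Sum>m | m \<in> A \<and> \<mu> m = e. c m * \<phi> m x)"
      unfolding sum_distrib_left using insert.prems(3) by (intro sum.cong) auto
    finally show ?case using insert.prems(3) by auto
  qed
  from this[of "\<mu> ` A - {e}" A c] assms show ?thesis by auto
qed

section \<open>Vanishing ideals\<close>

definition Van :: "('v \<Rightarrow> 'k) set \<Rightarrow> ('v, 'k::field) mpoly set" where
  "Van X = {f. \<forall>x\<in>X. eval x f = 0}"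

definition conical :: "('v \<Rightarrow> 'k::field) set \<Rightarrow> bool" where
  "conical X \<longleftrightarrow> (\<forall>x\<in>X. \<forall>c. c \<noteq> 0 \<longrightarrow> (\<lambda>v. c * x v) \<in> X)"

text \<open>Irreducibility witnessed by polynomial curves through any two points. It passes at once
  to images of affine spaces under polynomial maps, and all cones below arise in this way.\<close>

definition linked :: "('v \<Rightarrow> 'k::field) set \<Rightarrow> bool" where
  "linked X \<longleftrightarrow> X \<noteq> {} \<and> (\<forall>x\<in>X. \<forall>y\<in>X. \<exists>\<gamma>. (\<forall>t. (\<lambda>v. poly (\<gamma> v) t) \<in> X) \<and>
     (\<lambda>v. poly (\<gamma> v) 0) = x \<and> (\<lambda>v. poly (\<gamma> v) 1) = y)"

lemma subspace_Van: "Modules.module.subspace (*) (Van X)"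
  by (auto simp: subspace_iff Van_def eval_simps)

lemma Van_antimono: "X \<subseteq> Y \<Longrightarrow> Van Y \<subseteq> Van X"
  by (auto simp: Van_def)

lemma eval_path: "\<exists>p. \<forall>t. poly p t = eval (\<lambda>v. poly (\<gamma> v) t) f"
  by (rule exI[of _ "\<Sum>m\<in>Poly_Mapping.keys f. smult (Poly_Mapping.lookup f m)
    (\<Prod>v\<in>Poly_Mapping.keys m. \<gamma> v ^ Poly_Mapping.lookup m v)"])
    (simp add: eval_def poly_sum poly_prod poly_power)

text \<open>The straight line through two parameter vectors is mapped to a polynomial curve.\<close>

lemma linked_range: "linked (range (\<lambda>a v. eval a (\<pi> v)))"
  unfolding linked_def
proof (intro conjI ballI)
  fix x y assume "x \<in> range (\<lambda>a v. eval a (\<pi> v))" "y \<in> range (\<lambda>a v. eval a (\<pi> v))"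
  then obtain a b where xy: "x = (\<lambda>v. eval a (\<pi> v))" "y = (\<lambda>v. eval b (\<pi> v))" by blast
  have "\<exists>\<gamma>. \<forall>v. \<forall>t. poly (\<gamma> v) t = eval (\<lambda>w. poly [:a w, b w - a w:] t) (\<pi> v)"
    by (intro choice allI eval_path)
  then obtain \<gamma> where \<gamma>: "\<And>v t. poly (\<gamma> v) t = eval (\<lambda>w. poly [:a w, b w - a w:] t) (\<pi> v)" by blast
  show "\<exists>\<gamma>. (\<forall>t. (\<lambda>v. poly (\<gamma> v) t) \<in> range (\<lambda>a v. eval a (\<pi> v))) \<and>
     (\<lambda>v. poly (\<gamma> v) 0) = x \<and> (\<lambda>v. poly (\<gamma> v) 1) = y"
    by (rule exI[of _ \<gamma>]) (auto simp: \<gamma> xy)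
qed simp

text \<open>If \<open>f\<close> is nonzero at \<open>x\<close> and \<open>g\<close> at
  \<open>y\<close>, restricting both to a curve from \<open>x\<close> to \<open>y\<close> gives two
  nonzero univariate polynomials, whose product cannot vanish identically.\<close>

lemma prime_ideal_Van:
  fixes X :: "('v \<Rightarrow> 'k::field_char_0) set"
  assumes "linked X"
  shows "prime_ideal (Van X)"
  unfolding prime_ideal_def
proof (intro conjI subspace_Van allI impI)
  show "1 \<notin> Van X" using assms by (auto simp: linked_def Van_def)
next
  fix f g assume fg: "f * g \<in> Van X"
  show "f \<in> Van X \<or> g \<in> Van X"
  proof (rule ccontr)
    assume "\<not> (f \<in> Van X \<or> g \<in> Van X)"
    then obtain x y where xy: "x \<in> X" "y \<in> X" "eval x f \<noteq> 0" "eval y g \<noteq> 0" by (auto simp: Van_def)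
    with assms obtain \<gamma> where \<gamma>: "\<And>t. (\<lambda>v. poly (\<gamma> v) t) \<in> X"
      "(\<lambda>v. poly (\<gamma> v) 0) = x" "(\<lambda>v. poly (\<gamma> v) 1) = y" unfolding linked_def by blast
    obtain p where p: "\<And>t. poly p t = eval (\<lambda>v. poly (\<gamma> v) t) f" using eval_path by blast
    obtain q where q: "\<And>t. poly q t = eval (\<lambda>v. poly (\<gamma> v) t) g" using eval_path by blast
    have "poly (p * q) t = 0" for t
      using fg \<gamma>(1) by (simp add: p q Van_def eval_mult[symmetric])
    then have "p * q = 0" by (metis poly_all_0_iff_0)
    moreover have "poly p 0 \<noteq> 0" "poly q 1 \<noteq> 0" using xy \<gamma> by (auto simp: p q)
    ultimately show False by auto
  qed
qed

lemma two_power_eq_iff: "(2::'k::field_char_0) ^ m = 2 ^ n \<longleftrightarrow> m = n"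
proof
  assume "(2::'k) ^ m = 2 ^ n"
  then have "of_nat (2 ^ m) = (of_nat (2 ^ n) :: 'k)" by simp
  then show "m = n" by (simp only: of_nat_eq_iff) simp
qed simp

text \<open>Doubling all coordinates preserves the cone and acts on the part of degree
  \<open>n\<close> with eigenvalue \<open>2 ^ n\<close>; these eigenvalues are distinct in
  characteristic zero.\<close>

lemma hom_part_Van:
  fixes X :: "('v::finite \<Rightarrow> 'k::field_char_0) set"
  assumes X: "conical X" and f: "f \<in> Van X"
  shows "hom_part n f \<in> Van X"
proof -
  have "(\<Sum>m | m \<in> Poly_Mapping.keys f \<and> (2::'k) ^ (\<Sum>v\<in>UNIV. Poly_Mapping.lookup m v) = 2 ^ n.
      Poly_Mapping.lookup f m * mono_eval x m) = 0" if "x \<in> X" for x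
  proof (rule eigenvector_separation[where \<phi> = "\<lambda>m x. mono_eval x m" and T = "\<lambda>x v. 2 * x v", OF _ _ _ _ that])
    show "\<And>x. x \<in> X \<Longrightarrow> (\<lambda>v. 2 * x v) \<in> X" using X by (simp add: conical_def)
    show "\<And>x. x \<in> X \<Longrightarrow> (\<Sum>m\<in>Poly_Mapping.keys f. Poly_Mapping.lookup f m * mono_eval x m) = 0"
      using f by (auto simp: Van_def eval_def)
    show "mono_eval (\<lambda>v. 2 * x v) m = 2 ^ (\<Sum>v\<in>UNIV. Poly_Mapping.lookup m v) * mono_eval x m" for x :: "'v \<Rightarrow> 'k" and m
      by (rule mono_eval_scale_all)
  qed simp
  then show ?thesis by (simp add: Van_def eval_hom_part two_power_eq_iff)
qed

lemma homogeneous_ideal_Van: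
  fixes X :: "('v::finite \<Rightarrow> 'k::field_char_0) set"
  assumes X: "conical X"
  shows "homogeneous_ideal (Van X)"
  unfolding homogeneous_ideal_def
proof
  let ?H = "{f \<in> Van X. \<exists>n. homogeneous n f}"
  show "Van X \<subseteq> ideal_gen ?H"
  proof
    fix f assume "f \<in> Van X"
    then have "hom_part n f \<in> ideal_gen ?H" for n
      using hom_part_Van[OF X, of f n] homogeneous_hom_part by (intro ideal_base) blast
    then show "f \<in> ideal_gen ?H" by (subst sum_hom_part) (rule ideal_sum)
  qed
  show "ideal_gen ?H \<subseteq> Van X" by (rule ideal_minimal[OF _ subspace_Van]) auto
qed

lemma Van_in_Proj:
  fixes X :: "('v::finite \<Rightarrow> 'k::field_char_0) set"
  assumes "linked X" "conical X" "x \<in> X" "x v \<noteq> 0"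
  shows "Van X \<in> Proj"
  using assms prime_ideal_Van homogeneous_ideal_Van by (auto simp: Proj_def Van_def)

lemma prod_diff_in_ideal:
  assumes "\<And>i. i \<in> A \<Longrightarrow> a i - b i \<in> ideal_gen S"
  shows "(\<Prod>i\<in>A. a i) - (\<Prod>i\<in>A. b i) \<in> ideal_gen S"
  using assms
proof (induction A rule: infinite_finite_induct)
  case (insert i A)
  have "a i * prod a A - b i * prod b A = prod a A * (a i - b i) + b i * (prod a A - prod b A)"
    by (simp add: algebra_simps)
  also have "\<dots> \<in> ideal_gen S" using insert by (intro ideal_add ideal_scale) auto
  finally show ?case using insert by simp
qed (auto intro: ideal_zero)

text \<open>Modulo the ideal every variable equals its substitute, hence so does every polynomial.
  This is how linear equations are used to eliminate variables.\<close>

lemma subst_diff_in_ideal: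
  fixes f :: "('v, 'k::field_char_0) mpoly"
  assumes "\<And>v. var v - \<sigma> v \<in> ideal_gen S"
  shows "f - subst \<sigma> f \<in> ideal_gen S"
proof -
  have pow: "var v ^ n - \<sigma> v ^ n \<in> ideal_gen S" for v n
    using prod_diff_in_ideal[of "{..<n}" "\<lambda>_. var v" "\<lambda>_. \<sigma> v" S] assms by simp
  have "subst var f - subst \<sigma> f \<in> ideal_gen S"
    unfolding subst_def sum_subtractf[symmetric] right_diff_distrib[symmetric]
    by (intro ideal_sum ideal_scale prod_diff_in_ideal pow)
  then show ?thesis by (simp add: subst_var_id)
qed

section \<open>Polynomials vanishing on a hypersurface \<open>x a * x b = D\<close>\<close>

definition free_of :: "'v \<Rightarrow> ('v, 'k::field) mpoly \<Rightarrow> bool" where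
  "free_of v f \<longleftrightarrow> (\<forall>m\<in>Poly_Mapping.keys f. Poly_Mapping.lookup m v = 0)"

lemma free_of_var: "v \<noteq> w \<Longrightarrow> free_of v (var w)"
  by (auto simp: free_of_def var_def lookup_single)

lemma free_of_mult: "free_of v f \<Longrightarrow> free_of v g \<Longrightarrow> free_of v (f * g)"
  using keys_mult[of f g] by (fastforce simp: free_of_def lookup_add)

lemma free_of_add: "free_of v f \<Longrightarrow> free_of v g \<Longrightarrow> free_of v (f + g)"
  using Poly_Mapping.keys_add[of f g] unfolding free_of_def by blast

lemma free_of_uminus: "free_of v f \<Longrightarrow> free_of v (- f)"
  by (simp add: free_of_def)

lemma free_of_diff: "free_of v f \<Longrightarrow> free_of v g \<Longrightarrow> free_of v (f - g)"
  using free_of_add[of v f "- g"] free_of_uminus[of v g] by simp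

lemma eval_free_of: "free_of v f \<Longrightarrow> eval (x(v := s)) f = eval x f"
  unfolding eval_def by (intro sum.cong refl arg_cong2[of _ _ _ _ "(*)"] mono_eval_unused) (simp add: free_of_def)

text \<open>Division with remainder: replacing \<open>x a * x b\<close> by \<open>D\<close> lowers
  the exponent of \<open>x a\<close>, because \<open>D\<close> brings neither variable back.\<close>

lemma quadric_reduce:
  fixes f D :: "('v, 'k::field) mpoly"
  assumes "a \<noteq> b" and D: "free_of a D" "free_of b D"
  shows "\<exists>g. f - g \<in> ideal_gen {var a * var b - D} \<and>
    (\<forall>m\<in>Poly_Mapping.keys g. Poly_Mapping.lookup m a = 0 \<or> Poly_Mapping.lookup m b = 0)"
proof -
  let ?I = "ideal_gen {var a * var b - D}"
  define R :: "('v \<Rightarrow>\<^sub>0 nat) \<Rightarrow> bool" where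
    "R m \<longleftrightarrow> Poly_Mapping.lookup m a = 0 \<or> Poly_Mapping.lookup m b = 0" for m
  define Q where "Q f \<longleftrightarrow> (\<exists>g. f - g \<in> ?I \<and> Poly_Mapping.keys g \<subseteq> Collect R)" for f
  have add: "Q (f + g)" if fg: "Q f" "Q g" for f g
  proof -
    from fg(1) obtain f' where f': "f - f' \<in> ?I" "Poly_Mapping.keys f' \<subseteq> Collect R"
      unfolding Q_def by (elim exE conjE)
    from fg(2) obtain g' where g': "g - g' \<in> ?I" "Poly_Mapping.keys g' \<subseteq> Collect R"
      unfolding Q_def by (elim exE conjE)
    have "f + g - (f' + g') = (f - f') + (g - g')" by simp
    also have "\<dots> \<in> ?I" by (rule ideal_add[OF f'(1) g'(1)])
    finally have "f + g - (f' + g') \<in> ?I" .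
    moreover have "Poly_Mapping.keys (f' + g') \<subseteq> Collect R"
      using f'(2) g'(2) Poly_Mapping.keys_add[of f' g'] by (meson Un_least order_trans)
    ultimately show ?thesis unfolding Q_def by (intro exI conjI)
  qed
  have triv: "Q f" if "Poly_Mapping.keys f \<subseteq> Collect R" for f
    unfolding Q_def by (rule exI[of _ f]) (simp add: that ideal_zero)
  have sum: "Q (\<Sum>i\<in>A. h i)" if "\<And>i. i \<in> A \<Longrightarrow> Q (h i)" for A :: "('v \<Rightarrow>\<^sub>0 nat) set" and h
    using that by (induction A rule: infinite_finite_induct) (simp_all add: add triv)
  have mono: "Q (Poly_Mapping.single m c)" if "Poly_Mapping.lookup m a = k" for m c k
    using that
  proof (induction k arbitrary: m c)
    case 0
    then show ?case by (intro triv) (simp add: R_def)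
  next
    case (Suc k)
    show ?case
    proof (cases "Poly_Mapping.lookup m b = 0")
      case True
      then show ?thesis by (intro triv) (simp add: R_def)
    next
      case False
      define m' where "m' = m - Poly_Mapping.single a 1 - Poly_Mapping.single b 1"
      have m: "m = m' + (Poly_Mapping.single a 1 + Poly_Mapping.single b 1)"
        unfolding m'_def using False Suc.prems \<open>a \<noteq> b\<close>
        by (intro poly_mapping_eqI) (auto simp: lookup_add lookup_minus lookup_single when_def)
      have k: "Poly_Mapping.lookup m' a = k"
        using Suc.prems \<open>a \<noteq> b\<close> by (simp add: m'_def lookup_minus lookup_single)
      have s: "Poly_Mapping.single m c = Poly_Mapping.single m' c * (var a * var b)"
        unfolding m by (simp add: var_def mult_single)
      have D_eq: "D = (\<Sum>d\<in>Poly_Mapping.keys D. Poly_Mapping.single d (Poly_Mapping.lookup D d))"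
        by (rule poly_mapping_eqI) (simp add: lookup_sum lookup_single when_def in_keys_iff)
      have "Poly_Mapping.single m' c * D =
          (\<Sum>d\<in>Poly_Mapping.keys D. Poly_Mapping.single (m' + d) (c * Poly_Mapping.lookup D d))"
        by (subst D_eq) (simp add: sum_distrib_left mult_single)
      moreover have "Q (\<Sum>d\<in>Poly_Mapping.keys D. Poly_Mapping.single (m' + d) (c * Poly_Mapping.lookup D d))"
        using D(1) k by (intro sum Suc.IH) (simp add: lookup_add free_of_def)
      ultimately obtain g where g: "Poly_Mapping.single m' c * D - g \<in> ?I"
        "Poly_Mapping.keys g \<subseteq> Collect R" unfolding Q_def by (auto simp only:)
      have "Poly_Mapping.single m c - g =
          Poly_Mapping.single m' c * (var a * var b - D) + (Poly_Mapping.single m' c * D - g)"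
        by (simp add: s algebra_simps)
      also have "\<dots> \<in> ?I" by (intro ideal_add ideal_scale g(1) ideal_base) simp
      finally show ?thesis using g(2) unfolding Q_def by (intro exI conjI)
    qed
  qed
  have "Q f"
  proof (induction f rule: poly_mapping_add_induct)
    case 1
    show ?case by (rule triv) simp
  qed (simp_all add: mono add)
  then obtain g where "f - g \<in> ?I" "Poly_Mapping.keys g \<subseteq> Collect R" unfolding Q_def by (elim exE conjE)
  then show ?thesis by (intro exI[of _ g]) (auto simp: R_def)
qed

text \<open>A polynomial none of whose monomials is divisible by \<open>x\<^sub>a x\<^sub>b\<close> is determined by its values on
  \<open>x\<^sub>a x\<^sub>b = D\<close>: the torus \<open>(t x\<^sub>a, x\<^sub>b / t)\<close> acts on this hypersurface and separates the exponents
  of \<open>x\<^sub>a\<close> and \<open>x\<^sub>b\<close>, after which one may set \<open>x\<^sub>a = 1\<close> or \<open>x\<^sub>b = 1\<close>.\<close>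

lemma quadric_reduced_zero:
  fixes g D :: "('v, 'k::field_char_0) mpoly"
  assumes "a \<noteq> b" and D: "free_of a D" "free_of b D"
    and red: "\<forall>m\<in>Poly_Mapping.keys g. Poly_Mapping.lookup m a = 0 \<or> Poly_Mapping.lookup m b = 0"
    and van: "\<And>x. x a * x b = eval x D \<Longrightarrow> eval x g = 0"
  shows "g = 0"
proof (rule ccontr)
  assume "g \<noteq> 0"
  then obtain n where n: "n \<in> Poly_Mapping.keys g" by (metis all_not_in_conv keys_eq_empty)
  \<comment> \<open>The eigenvalue of the torus element with \<open>t = 2\<close>, that is, 2 to the
    difference of the two exponents.\<close>
  define \<mu> :: "('v \<Rightarrow>\<^sub>0 nat) \<Rightarrow> 'k" where
    "\<mu> m = 2 ^ Poly_Mapping.lookup m a * (1/2) ^ Poly_Mapping.lookup m b" for m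
  define B where "B = {m. m \<in> Poly_Mapping.keys g \<and> \<mu> m = \<mu> n}"
  let ?X = "{x. x a * x b = eval x D}"
  have sep: "(\<Sum>m\<in>B. Poly_Mapping.lookup g m * mono_eval x m) = 0" if "x a * x b = eval x D" for x
    unfolding B_def
  proof (rule eigenvector_separation[where X = ?X and \<phi> = "\<lambda>m x. mono_eval x m"
        and T = "\<lambda>x. (x(a := 2 * x a))(b := 1/2 * (x(a := 2 * x a)) b)"])
    fix x assume "x \<in> ?X"
    then show "(x(a := 2 * x a))(b := 1/2 * (x(a := 2 * x a)) b) \<in> ?X"
      using \<open>a \<noteq> b\<close> by (simp add: eval_free_of D)
    show "mono_eval ((x(a := 2 * x a))(b := 1/2 * (x(a := 2 * x a)) b)) m = \<mu> m * mono_eval x m" for m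
      unfolding \<mu>_def mono_eval_scale by (simp only: mult_ac)
    show "(\<Sum>m\<in>Poly_Mapping.keys g. Poly_Mapping.lookup g m * mono_eval x m) = 0"
      using van \<open>x \<in> ?X\<close> by (simp add: eval_def)
  qed (use that in simp_all)
  \<comment> \<open>Equality of the exponent differences, written without subtraction. In a reduced
    monomial one of the two exponents is zero, so the difference determines both.\<close>
  have \<mu>_inj: "Poly_Mapping.lookup m a + Poly_Mapping.lookup n b = Poly_Mapping.lookup n a + Poly_Mapping.lookup m b"
    if "m \<in> B" for m
  proof -
    have "\<mu> m * 2 ^ (Poly_Mapping.lookup m b + Poly_Mapping.lookup n b) =
        \<mu> n * 2 ^ (Poly_Mapping.lookup m b + Poly_Mapping.lookup n b)" using that by (simp add: B_def)
    then have "(2::'k) ^ (Poly_Mapping.lookup m a + Poly_Mapping.lookup n b) =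
        2 ^ (Poly_Mapping.lookup n a + Poly_Mapping.lookup m b)"
      by (simp add: \<mu>_def power_add power_divide)
    then show ?thesis by (simp only: two_power_eq_iff)
  qed
  have "(\<Sum>m\<in>B. Poly_Mapping.lookup g m * mono_eval x m) = 0" for x
  proof (cases "Poly_Mapping.lookup n b = 0")
    case True
    \<comment> \<open>This point lies on the hypersurface. The monomials of \<open>B\<close> do not
      contain \<open>x b\<close> and share one power of \<open>x a\<close>, so passing to
      \<open>?y\<close> costs only a common factor.\<close>
    let ?y = "(x(a := 1))(b := eval x D)"
    have "Poly_Mapping.lookup m b = 0 \<and> Poly_Mapping.lookup m a = Poly_Mapping.lookup n a" if "m \<in> B" for m
      using \<mu>_inj[OF that] red that True by (auto simp: B_def)
    then have eq: "mono_eval x m = x a ^ Poly_Mapping.lookup n a * mono_eval ?y m" if "m \<in> B" for m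
      using mono_eval_split[of x m a] mono_eval_unused[of m b "x(a := 1)"] that by metis
    have "(\<Sum>m\<in>B. Poly_Mapping.lookup g m * mono_eval x m) =
        x a ^ Poly_Mapping.lookup n a * (\<Sum>m\<in>B. Poly_Mapping.lookup g m * mono_eval ?y m)"
      unfolding sum_distrib_left by (rule sum.cong[OF refl]) (simp only: eq mult.left_commute)
    also have "(\<Sum>m\<in>B. Poly_Mapping.lookup g m * mono_eval ?y m) = 0"
      by (rule sep[of ?y]) (simp add: eval_free_of D \<open>a \<noteq> b\<close> \<open>a \<noteq> b\<close>[symmetric])
    finally show ?thesis by simp
  next
    case False
    let ?y = "(x(b := 1))(a := eval x D)"
    have "Poly_Mapping.lookup m a = 0 \<and> Poly_Mapping.lookup m b = Poly_Mapping.lookup n b" if "m \<in> B" for m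
      using \<mu>_inj[OF that] red[rule_format, OF n] red[rule_format, of m] that False
      by (auto simp: B_def)
    then have eq: "mono_eval x m = x b ^ Poly_Mapping.lookup n b * mono_eval ?y m" if "m \<in> B" for m
      using mono_eval_split[of x m b] mono_eval_unused[of m a "x(b := 1)"] that by metis
    have "(\<Sum>m\<in>B. Poly_Mapping.lookup g m * mono_eval x m) =
        x b ^ Poly_Mapping.lookup n b * (\<Sum>m\<in>B. Poly_Mapping.lookup g m * mono_eval ?y m)"
      unfolding sum_distrib_left by (rule sum.cong[OF refl]) (simp only: eq mult.left_commute)
    also have "(\<Sum>m\<in>B. Poly_Mapping.lookup g m * mono_eval ?y m) = 0"
      by (rule sep[of ?y]) (simp add: eval_free_of D \<open>a \<noteq> b\<close> \<open>a \<noteq> b\<close>[symmetric])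
    finally show ?thesis by simp
  qed
  then have "Poly_Mapping.lookup g n = 0"
    by (rule mono_eval_independent[of B "Poly_Mapping.lookup g" n, rotated]) (simp_all add: B_def n)
  with n show False by (simp add: in_keys_iff)
qed

text \<open>The reduced remainder of \<open>f\<close> vanishes on the hypersurface as well, hence is
  zero. This gives the vanishing ideal directly from the values at rational points.\<close>

lemma vanishing_on_quadric:
  fixes f D :: "('v, 'k::field_char_0) mpoly"
  assumes ab: "a \<noteq> b" and D: "free_of a D" "free_of b D"
    and van: "\<And>x. x a * x b = eval x D \<Longrightarrow> eval x f = 0"
  shows "f \<in> ideal_gen {var a * var b - D}"
proof -
  obtain g where g: "f - g \<in> ideal_gen {var a * var b - D}"
    and red: "\<forall>m\<in>Poly_Mapping.keys g. Poly_Mapping.lookup m a = 0 \<or> Poly_Mapping.lookup m b = 0"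
    using quadric_reduce[OF ab D] by blast
  have I: "eval x h = 0" if "h \<in> ideal_gen {var a * var b - D}" "x a * x b = eval x D" for h x
    using ideal_minimal[OF _ subspace_Van, of "{var a * var b - D}" "{x}"] that
    by (auto simp: Van_def eval_simps)
  have "g = 0"
  proof (rule quadric_reduced_zero[OF ab D red])
    fix x assume "x a * x b = eval x D"
    with I[OF g this] van show "eval x g = 0" by (simp add: eval_diff)
  qed
  with g show ?thesis by simp
qed

section \<open>Closed subsets of projective space\<close>

lemma ideal_mult_right: "Modules.module.subspace (*) p \<Longrightarrow> f \<in> p \<Longrightarrow> f * g \<in> p"
  by (auto simp: subspace_iff mult.commute[of f])

lemma ideal_mult_left: "Modules.module.subspace (*) p \<Longrightarrow> f \<in> p \<Longrightarrow> g * f \<in> p"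
  by (auto simp: subspace_iff)

lemma prime_ideal_prod:
  assumes "prime_ideal p" "(\<Prod>i\<in>A. f i) \<in> p"
  shows "\<exists>i\<in>A. f i \<in> p"
  using assms by (induction A rule: infinite_finite_induct) (auto simp: prime_ideal_def)

lemma prime_ideal_power: "prime_ideal p \<Longrightarrow> f ^ n \<in> p \<Longrightarrow> f \<in> p"
  by (induction n) (auto simp: prime_ideal_def)

lemma openin_proj:
  "openin proj_topology S \<longleftrightarrow>
    (\<exists>F. (\<forall>f\<in>F. \<exists>n. homogeneous n f) \<and> S = {p \<in> (Proj :: ('v::finite, 'k::field) mpoly set set). \<not> F \<subseteq> p})"
  unfolding proj_topology_def by (simp add: topology_inverse'[OF istopology_proj])

lemma topspace_proj: "topspace proj_topology = (Proj :: ('v::finite, 'k::field) mpoly set set)"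
proof
  show "topspace proj_topology \<subseteq> (Proj :: ('v, 'k) mpoly set set)"
    using openin_topspace[of "proj_topology :: ('v, 'k) mpoly set topology"] unfolding openin_proj by auto
  have "\<exists>n. homogeneous n (1 :: ('v, 'k) mpoly)" using multihomogeneous_one by blast
  then have "openin proj_topology (Proj :: ('v, 'k) mpoly set set)"
    unfolding openin_proj by (intro exI[of _ "{1}"]) (auto simp: Proj_def prime_ideal_def)
  then show "(Proj :: ('v, 'k) mpoly set set) \<subseteq> topspace proj_topology" by (rule openin_subset)
qed

lemma vanishing_locus_subset: "\<V> F \<subseteq> Proj"
  by (auto simp: vanishing_locus_def)

lemma closedin_proj:
  "closedin proj_topology A \<longleftrightarrow>
    (\<exists>F. (\<forall>f\<in>F. \<exists>n. homogeneous n f) \<and> A = \<V> (F :: ('v::finite, 'k::field) mpoly set))"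
proof -
  have eq: "A \<subseteq> Proj \<and> Proj - A = {p \<in> Proj. \<not> F \<subseteq> p} \<longleftrightarrow> A = \<V> F" for F :: "('v, 'k) mpoly set"
    by (auto simp: vanishing_locus_def)
  show ?thesis unfolding closedin_def openin_proj topspace_proj eq[symmetric] by (rule iffI; elim conjE exE; intro exI conjI)
qed

lemma closedin_sub_proj:
  "closedin (subtopology proj_topology Y) A \<longleftrightarrow>
    (\<exists>F. (\<forall>f\<in>F. \<exists>n. homogeneous n f) \<and> A = \<V> (F :: ('v::finite, 'k::field) mpoly set) \<inter> Y)"
  by (auto simp: closedin_subtopology closedin_proj)

text \<open>The prime \<open>p\<close> is itself the generic point: a closed set that contains it
  contains all of its locus.\<close>

lemma irreducible_in_vanishing_locus:
  assumes p: "p \<in> Proj" and Y: "\<V> p \<subseteq> Y"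
  shows "irreducible_in (subtopology proj_topology Y) (\<V> p)"
  unfolding irreducible_in_def
proof (intro conjI allI impI)
  have gen: "p \<in> \<V> p" using p by (simp add: vanishing_locus_def)
  then show "\<V> p \<noteq> {}" by blast
  show "\<V> p \<subseteq> topspace (subtopology proj_topology Y)"
    using Y vanishing_locus_subset by (auto simp: topspace_proj)
  fix A B
  assume AB: "closedin (subtopology proj_topology Y) A \<and> closedin (subtopology proj_topology Y) B \<and> \<V> p \<subseteq> A \<union> B"
  have sub: "\<V> p \<subseteq> A" if A: "closedin (subtopology proj_topology Y) A" "p \<in> A" for A
  proof -
    obtain F where F: "A = \<V> F \<inter> Y" using A(1) by (auto simp: closedin_sub_proj)
    then have "F \<subseteq> p" using A(2) by (simp add: vanishing_locus_def)
    then show ?thesis using Y by (auto simp: F vanishing_locus_def)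
  qed
  have "p \<in> A \<or> p \<in> B" using gen AB by blast
  then show "\<V> p \<subseteq> A \<or> \<V> p \<subseteq> B" using sub AB by metis
qed

text \<open>Closed sets are cut out by homogeneous equations, so \<open>p\<close> is replaced by its
  homogeneous elements, which generate it.\<close>

lemma closedin_vanishing_locus:
  assumes "homogeneous_ideal p" "\<V> p \<subseteq> Y"
  shows "closedin (subtopology proj_topology Y) (\<V> p)"
proof -
  let ?H = "{f \<in> p. \<exists>n. homogeneous n f}"
  have p: "p = ideal_gen ?H" using assms(1) by (simp only: homogeneous_ideal_def)
  have "p \<subseteq> q" if "q \<in> Proj" "?H \<subseteq> q" for q
    using ideal_minimal[of ?H q] that p by (auto simp: Proj_def prime_ideal_def)
  then have "\<V> p = \<V> ?H" by (auto simp: vanishing_locus_def)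
  then have "\<V> p = \<V> ?H \<inter> Y" using assms(2) by blast
  moreover have "\<forall>f\<in>?H. \<exists>n. homogeneous n f" by blast
  ultimately show ?thesis unfolding closedin_sub_proj by blast
qed

lemma irreducible_in_finite_cover:
  assumes "finite \<C>" "irreducible_in T Z" "\<And>C. C \<in> \<C> \<Longrightarrow> closedin T C" "Z \<subseteq> \<Union>\<C>"
  shows "\<exists>C\<in>\<C>. Z \<subseteq> C"
  using assms
proof (induction \<C> rule: finite_induct)
  case (insert C \<C>)
  have "closedin T (\<Union>\<C>)" using insert by (intro closedin_Union) auto
  then have "Z \<subseteq> C \<or> Z \<subseteq> \<Union>\<C>" using insert.prems by (auto simp: irreducible_in_def)
  then show ?case using insert by blast
qed (auto simp: irreducible_in_def)

text \<open>Every irreducible subset lies in some member of the finite closed cover; incomparability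
  of the members then makes each of them maximal.\<close>

lemma irreducible_components_cover:
  assumes "finite \<C>" "\<And>C. C \<in> \<C> \<Longrightarrow> closedin T C" "\<And>C. C \<in> \<C> \<Longrightarrow> irreducible_in T C"
    "topspace T = \<Union>\<C>" "\<And>C C'. C \<in> \<C> \<Longrightarrow> C' \<in> \<C> \<Longrightarrow> C \<subseteq> C' \<Longrightarrow> C = C'"
  shows "irreducible_components T = \<C>"
proof -
  have cov: "\<exists>C\<in>\<C>. Z \<subseteq> C" if "irreducible_in T Z" for Z
    using irreducible_in_finite_cover[OF assms(1) that assms(2)] that assms(4)
    by (auto simp: irreducible_in_def)
  show ?thesis
  proof (intro equalityI subsetI)
    fix Z assume Z: "Z \<in> irreducible_components T"
    then have "irreducible_in T Z" by (simp add: irreducible_components_def)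
    from cov[OF this] obtain C where "C \<in> \<C>" "Z \<subseteq> C" by blast
    then show "Z \<in> \<C>" using Z assms(3) by (auto simp: irreducible_components_def)
  next
    fix C assume C: "C \<in> \<C>"
    have "Z = C" if Z: "irreducible_in T Z" "C \<subseteq> Z" for Z
    proof -
      obtain C' where "C' \<in> \<C>" "Z \<subseteq> C'" using cov[OF Z(1)] by blast
      then show ?thesis using assms(5)[OF C, of C'] Z(2) by blast
    qed
    then show "C \<in> irreducible_components T" using C assms(3) by (auto simp: irreducible_components_def)
  qed
qed

section \<open>Dimension\<close>

text \<open>Primality is tested on homogeneous elements only. Irreducibility of a set of points
  gives exactly this for the intersection of the points, since only homogeneous polynomials define
  closed sets, and the dimension argument uses nothing more.\<close>

definition homogeneous_prime :: "('v::finite, 'k::field) mpoly set \<Rightarrow> bool" where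
  "homogeneous_prime q \<longleftrightarrow> Modules.module.subspace (*) q \<and> 1 \<notin> q \<and>
     (\<forall>f g m n. homogeneous m f \<and> homogeneous n g \<and> f * g \<in> q \<longrightarrow> f \<in> q \<or> g \<in> q)"

lemma homogeneous_primeD:
  "homogeneous_prime q \<Longrightarrow> homogeneous m f \<Longrightarrow> homogeneous n g \<Longrightarrow> f * g \<in> q \<Longrightarrow> f \<in> q \<or> g \<in> q"
  unfolding homogeneous_prime_def by blast

lemma homogeneous_power: "homogeneous n f \<Longrightarrow> homogeneous (k * n) (f ^ k)"
  by (rule multihomogeneous_power)

lemma homogeneous_mult: "homogeneous m f \<Longrightarrow> homogeneous n g \<Longrightarrow> homogeneous (m + n) (f * g)"
  by (rule multihomogeneous_mult)

lemma homogeneous_prime_power: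
  assumes "homogeneous_prime q" "homogeneous n f" "f ^ k \<in> q"
  shows "f \<in> q"
  using assms(3)
proof (induction k)
  case (Suc k)
  then have "f * f ^ k \<in> q" by simp
  with homogeneous_primeD[OF assms(1,2) homogeneous_power[OF assms(2)]]
  show ?case using Suc.IH by blast
qed (use assms(1) in \<open>simp add: homogeneous_prime_def\<close>)

lemma Inter_subspace:
  assumes "Z \<subseteq> Proj"
  shows "Modules.module.subspace (*) (\<Inter>Z)"
  using assms by (auto simp: subspace_iff Proj_def prime_ideal_def subset_iff)

text \<open>If \<open>f * g\<close> lies in all points of \<open>Z\<close>, each point contains
  \<open>f\<close> or \<open>g\<close>, so two closed sets cover \<open>Z\<close> and one of them
  suffices.\<close>

lemma homogeneous_prime_Inter:
  assumes Z: "irreducible_in (subtopology proj_topology Y) Z"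
  shows "homogeneous_prime (\<Inter>Z)"
proof -
  let ?T = "subtopology proj_topology Y"
  have sub: "Z \<subseteq> Proj" "Z \<subseteq> Y" "Z \<noteq> {}" using Z by (auto simp: irreducible_in_def topspace_proj)
  have "f \<in> \<Inter>Z \<or> g \<in> \<Inter>Z" if fg: "homogeneous m f" "homogeneous n g" "f * g \<in> \<Inter>Z" for f g m n
  proof -
    have cl: "closedin ?T (\<V> {f} \<inter> Y)" "closedin ?T (\<V> {g} \<inter> Y)"
      unfolding closedin_sub_proj using fg(1,2) by (intro exI[of _ "{f}"] exI[of _ "{g}"]; auto)+
    have "Z \<subseteq> (\<V> {f} \<inter> Y) \<union> (\<V> {g} \<inter> Y)"
    proof
      fix p assume p: "p \<in> Z"
      then have "prime_ideal p" "f * g \<in> p" "p \<in> Proj" "p \<in> Y" using sub fg(3) by (auto simp: Proj_def)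
      then show "p \<in> (\<V> {f} \<inter> Y) \<union> (\<V> {g} \<inter> Y)"
        by (auto simp: vanishing_locus_def prime_ideal_def)
    qed
    then have "Z \<subseteq> \<V> {f} \<inter> Y \<or> Z \<subseteq> \<V> {g} \<inter> Y"
      using Z cl unfolding irreducible_in_def by blast
    then show ?thesis by (auto simp: vanishing_locus_def)
  qed
  moreover have "1 \<notin> \<Inter>Z" using sub by (auto simp: Proj_def prime_ideal_def)
  ultimately show ?thesis
    unfolding homogeneous_prime_def by (intro conjI Inter_subspace[OF sub(1)]) blast+
qed

lemma separating_element:
  assumes "closedin (subtopology proj_topology Y) Z" "Z \<subset> Z'" "Z' \<subseteq> Proj" "Z' \<subseteq> Y"
  shows "\<exists>f n. homogeneous n f \<and> f \<in> \<Inter>Z \<and> f \<notin> \<Inter>Z'"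
proof -
  obtain F where F: "\<forall>f\<in>F. \<exists>n. homogeneous n f" "Z = \<V> F \<inter> Y"
    using assms(1) by (auto simp: closedin_sub_proj)
  have "\<not> F \<subseteq> \<Inter>Z'"
  proof
    assume "F \<subseteq> \<Inter>Z'"
    then have "Z' \<subseteq> Z" using assms(3,4) by (auto simp: F(2) vanishing_locus_def)
    then show False using assms(2) by blast
  qed
  then obtain f where "f \<in> F" "f \<notin> \<Inter>Z'" by blast
  moreover have "f \<in> \<Inter>Z" using \<open>f \<in> F\<close> by (auto simp: F(2) vanishing_locus_def)
  ultimately show ?thesis using F(1) by blast
qed

text \<open>Gaussian elimination: a homogeneous system with more unknowns than equations loses one
  of each at every pivot \<open>a i0 j\<close>.\<close>

lemma linear_dependence:
  fixes a :: "'i \<Rightarrow> 'j \<Rightarrow> 'k::field"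
  assumes "finite B" "finite A" "card B < card A"
  shows "\<exists>c. (\<exists>i\<in>A. c i \<noteq> 0) \<and> (\<forall>j\<in>B. (\<Sum>i\<in>A. c i * a i j) = 0)"
  using assms
proof (induction B arbitrary: A a rule: finite_induct)
  case empty
  then have "A \<noteq> {}" by auto
  then show ?case by (intro exI[of _ "\<lambda>_. 1"]) auto
next
  case (insert j B)
  show ?case
  proof (cases "\<forall>i\<in>A. a i j = 0")
    case True
    have "card B < card A" using insert by simp
    from insert.IH[OF insert.prems(1) this, of a] True show ?thesis by auto
  next
    case False
    then obtain i0 where i0: "i0 \<in> A" "a i0 j \<noteq> 0" by blast
    let ?A = "A - {i0}"
    have "card B < card ?A" using insert i0 by simp
    from insert.IH[OF _ this, of "\<lambda>i k. a i k - a i j / a i0 j * a i0 k"] insert.prems(1)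
    obtain c where c: "\<exists>i\<in>?A. c i \<noteq> 0"
      "\<And>k. k \<in> B \<Longrightarrow> (\<Sum>i\<in>?A. c i * (a i k - a i j / a i0 j * a i0 k)) = 0" by auto
    define s where "s = - (\<Sum>i\<in>?A. c i * a i j) / a i0 j"
    have split: "(\<Sum>i\<in>A. (c(i0 := s)) i * a i k) = s * a i0 k + (\<Sum>i\<in>?A. c i * a i k)" for k
      using insert.prems(1) i0(1) by (simp add: sum.remove[of A i0])
    have "(\<Sum>i\<in>A. (c(i0 := s)) i * a i k) = 0" if "k \<in> insert j B" for k
    proof (cases "k = j")
      case True
      then show ?thesis unfolding split using i0 by (simp add: s_def)
    next
      case False
      then have "0 = (\<Sum>i\<in>?A. c i * (a i k - a i j / a i0 j * a i0 k))" using c(2) that by simp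
      also have "\<dots> = (\<Sum>i\<in>?A. c i * a i k) - (\<Sum>i\<in>?A. c i * a i j) / a i0 j * a i0 k"
        unfolding sum_divide_distrib sum_distrib_right sum_subtractf[symmetric]
        by (intro sum.cong refl) (simp add: right_diff_distrib)
      finally show ?thesis unfolding split by (simp add: s_def)
    qed
    moreover have "\<exists>i\<in>A. (c(i0 := s)) i \<noteq> 0" using c(1) by auto
    ultimately show ?thesis by blast
  qed
qed

text \<open>One step of the Coquand--Lombardi argument: in an algebraic relation that holds modulo \<open>q\<close>
  the lowest power of \<open>y\<close> is cancelled, and modulo \<open>q'\<close>, which contains \<open>y\<close>, only its coefficient
  survives.\<close>

lemma lowest_coefficient:
  fixes e :: "'i \<Rightarrow> nat" and M :: "'i \<Rightarrow> ('v::finite, 'k::field) mpoly"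
  assumes q: "homogeneous_prime q" "homogeneous_prime q'" "q \<subseteq> q'"
    and y: "homogeneous D y" "y \<notin> q" "y \<in> q'"
    and A: "finite A" "A \<noteq> {}"
    and M: "\<And>i. i \<in> A \<Longrightarrow> homogeneous (N - D * e i) (M i)" "\<And>i. i \<in> A \<Longrightarrow> D * e i \<le> N"
    and rel: "(\<Sum>i\<in>A. const (c i) * (y ^ e i * M i)) \<in> q"
  shows "(\<Sum>i | i \<in> A \<and> e i = Min (e ` A). const (c i) * M i) \<in> q'"
proof -
  let ?a = "Min (e ` A)"
  define S where "S = (\<Sum>i\<in>A. const (c i) * (y ^ (e i - ?a) * M i))"
  have le: "?a \<le> e i" if "i \<in> A" for i using A that by simp
  \<comment> \<open>Homogeneity of the quotient \<open>S\<close> is needed because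
    \<open>homogeneous_prime\<close> cancels \<open>y\<close> only from products of homogeneous
    factors.\<close>
  have hS: "homogeneous (N - D * ?a) S"
    unfolding S_def
  proof (intro multihomogeneous_sum multihomogeneous_smult)
    fix i assume i: "i \<in> A"
    have "homogeneous ((e i - ?a) * D + (N - D * e i)) (y ^ (e i - ?a) * M i)"
      by (intro homogeneous_mult homogeneous_power y(1) M(1) i)
    also have "(e i - ?a) * D + (N - D * e i) = N - D * ?a"
      using le[OF i] M(2)[OF i] mult_le_mono2[OF le[OF i], of D]
      by (simp add: diff_mult_distrib2 mult.commute[of _ D])
    finally show "homogeneous (N - D * ?a) (y ^ (e i - ?a) * M i)" .
  qed
  have "y ^ ?a * S = (\<Sum>i\<in>A. const (c i) * (y ^ e i * M i))"
    unfolding S_def sum_distrib_left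
  proof (rule sum.cong)
    fix i assume "i \<in> A"
    then have "y ^ e i = y ^ ?a * y ^ (e i - ?a)" using le by (simp flip: power_add)
    then show "y ^ ?a * (const (c i) * (y ^ (e i - ?a) * M i)) = const (c i) * (y ^ e i * M i)"
      by (simp only: mult_ac)
  qed simp
  then have "y ^ ?a * S \<in> q" using rel by simp
  from homogeneous_primeD[OF q(1) homogeneous_power[OF y(1)] hS this]
  have "S \<in> q" using homogeneous_prime_power[OF q(1) y(1), of ?a] y(2) by blast
  then have S: "S \<in> q'" using q(3) by blast
  have sub: "Modules.module.subspace (*) q'" using q(2) by (simp add: homogeneous_prime_def)
  have "(\<Sum>i | i \<in> A \<and> e i \<noteq> ?a. const (c i) * (y ^ (e i - ?a) * M i)) \<in> q'"
  proof (rule Modules.module.subspace_sum[OF module_mult sub])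
    fix i assume "i \<in> {i \<in> A. e i \<noteq> ?a}"
    then have "e i - ?a \<noteq> 0" using le[of i] by auto
    then obtain k where "e i - ?a = Suc k" by (cases "e i - ?a") auto
    then have "const (c i) * (y ^ (e i - ?a) * M i) = y * (const (c i) * (y ^ k * M i))"
      by (simp add: mult_ac)
    also have "\<dots> \<in> q'" by (rule ideal_mult_right[OF sub y(3)])
    finally show "const (c i) * (y ^ (e i - ?a) * M i) \<in> q'" .
  qed
  note rest = this
  have "S = (\<Sum>i | i \<in> A \<and> e i = ?a. const (c i) * M i) +
      (\<Sum>i | i \<in> A \<and> e i \<noteq> ?a. const (c i) * (y ^ (e i - ?a) * M i))"
  proof -
    have "S = (\<Sum>i | i \<in> A \<and> e i = ?a. const (c i) * (y ^ (e i - ?a) * M i)) +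
        (\<Sum>i | i \<in> A \<and> e i \<noteq> ?a. const (c i) * (y ^ (e i - ?a) * M i))"
      unfolding S_def using A(1) by (subst sum.union_disjoint[symmetric]) (auto intro: sum.cong)
    moreover have "(\<Sum>i | i \<in> A \<and> e i = ?a. const (c i) * (y ^ (e i - ?a) * M i)) =
        (\<Sum>i | i \<in> A \<and> e i = ?a. const (c i) * M i)" by (rule sum.cong) auto
    ultimately show ?thesis by simp
  qed
  then have "(\<Sum>i | i \<in> A \<and> e i = ?a. const (c i) * M i) =
      S - (\<Sum>i | i \<in> A \<and> e i \<noteq> ?a. const (c i) * (y ^ (e i - ?a) * M i))" by simp
  also have "\<dots> \<in> q'" by (rule Modules.module.subspace_diff[OF module_mult sub S rest])
  finally show ?thesis .
qed

section \<open>Hilbert functions and chains of primes\<close>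

definition linear_form :: "(('v, 'k::field) mpoly \<Rightarrow> 'k) \<Rightarrow> bool" where
  "linear_form l \<longleftrightarrow> (\<forall>f g. l (f + g) = l f + l g) \<and> (\<forall>c f. l (const c * f) = c * l f)"

text \<open>An upper bound for the Hilbert function: the forms of degree \<open>n\<close>,
  restricted to \<open>X\<close>, span a space of dimension at most \<open>(n + 1)\<^sup>2\<close>.
  Linear forms whose common kernel vanishes on \<open>X\<close> express this without quotient
  spaces. The exponent 2 is the expected projective dimension.\<close>

definition quadratic_growth :: "('v::finite \<Rightarrow> 'k::field) set \<Rightarrow> bool" where
  "quadratic_growth X \<longleftrightarrow> (\<forall>n. \<exists>l :: nat \<Rightarrow> ('v, 'k) mpoly \<Rightarrow> 'k. (\<forall>j. linear_form (l j)) \<and>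
     (\<forall>f. homogeneous n f \<and> (\<forall>j<(n + 1)\<^sup>2. l j f = 0) \<longrightarrow> f \<in> Van X))"

lemma linear_form_sum:
  assumes "linear_form l"
  shows "l (\<Sum>i\<in>A. const (c i) * f i) = (\<Sum>i\<in>A. c i * l (f i))"
proof (induction A rule: infinite_finite_induct)
  case (insert i A)
  then show ?case using assms by (simp add: linear_form_def)
next
  have "l 0 = 0" using assms unfolding linear_form_def by (metis add_cancel_left_right)
  then show "l (\<Sum>i\<in>{}. const (c i) * f i) = (\<Sum>i\<in>{}. c i * l (f i))" by simp
  then show "l (\<Sum>i\<in>A. const (c i) * f i) = (\<Sum>i\<in>A. c i * l (f i))" if "infinite A" for A using that by simp
qed

lemma Min_fibre_nonempty:
  assumes "finite A" "A \<noteq> {}"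
  shows "{t \<in> A. f t = Min (f ` A)} \<noteq> {}"
proof -
  have "Min (f ` A) \<in> f ` A" using assms by (intro Min_in) auto
  then obtain t where "t \<in> A" "f t = Min (f ` A)" by (elim imageE) simp
  then show ?thesis by blast
qed

text \<open>Four forms \<open>y0\<close>, ..., \<open>y3\<close> of a common degree have more
  monomials of degree \<open>N\<close> than the growth of \<open>X\<close> allows, so some
  nontrivial combination of them lies in \<open>q3\<close>. Reading off the lowest powers of
  \<open>y0\<close>, \<open>y1\<close>, \<open>y2\<close> one after the other carries the relation
  into \<open>q2\<close>, \<open>q1\<close> and \<open>q0\<close>, where a single power of
  \<open>y3\<close> remains, although \<open>y3\<close> is a power of a variable outside
  \<open>q0\<close>.\<close>

lemma no_long_prime_chain:
  fixes X :: "('v::finite \<Rightarrow> 'k::field) set"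
  assumes growth: "quadratic_growth X"
    and q: "homogeneous_prime q0" "homogeneous_prime q1" "homogeneous_prime q2" "homogeneous_prime q3"
    and sub: "Van X \<subseteq> q3" "q3 \<subseteq> q2" "q2 \<subseteq> q1" "q1 \<subseteq> q0"
    and x: "homogeneous n0 x0" "homogeneous n1 x1" "homogeneous n2 x2"
      "x0 \<in> q2" "x0 \<notin> q3" "x1 \<in> q1" "x1 \<notin> q2" "x2 \<in> q0" "x2 \<notin> q1" "var v \<notin> q0"
  shows False
proof -
  \<comment> \<open>A positive common degree. The factors \<open>var v ^ (D - n0)\<close> and the
    like change no membership, as \<open>var v\<close> lies outside all four primes.\<close>
  define D where "D = n0 + n1 + n2 + 1"
  \<comment> \<open>Chosen so that the \<open>L ^ 3\<close> monomials outnumber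
    \<open>(4 * L * D)\<^sup>2\<close>, which bounds \<open>(N + 1)\<^sup>2\<close>.\<close>
  define L where "L = 16 * D\<^sup>2 + 1"
  define y0 y1 y2 y3 where y_def: "y0 = x0 * var v ^ (D - n0)" "y1 = x1 * var v ^ (D - n1)"
    "y2 = x2 * var v ^ (D - n2)" "y3 = (var v ^ D :: ('v, 'k) mpoly)"
  have hv: "homogeneous k (var v ^ k)" for k using homogeneous_power[OF homogeneous_var, of k v] by simp
  have nD: "n0 \<le> D" "n1 \<le> D" "n2 \<le> D" by (simp_all add: D_def)
  have hy: "homogeneous D y0" "homogeneous D y1" "homogeneous D y2" "homogeneous D y3"
    using homogeneous_mult[OF x(1) hv, of "D - n0"] homogeneous_mult[OF x(2) hv, of "D - n1"]
      homogeneous_mult[OF x(3) hv, of "D - n2"] hv[of D]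
    by (simp_all only: y_def le_add_diff_inverse[OF nD(1)] le_add_diff_inverse[OF nD(2)] le_add_diff_inverse[OF nD(3)])
  have mem: "y0 \<in> q2" "y1 \<in> q1" "y2 \<in> q0"
    using x q by (auto simp: y_def homogeneous_prime_def intro!: ideal_mult_right)
  have vk: "var v ^ k \<notin> q" if "homogeneous_prime q" "q \<subseteq> q0" for q k
    using homogeneous_prime_power[OF that(1) homogeneous_var] x(10) that(2) by blast
  have notmem: "y0 \<notin> q3" "y1 \<notin> q2" "y2 \<notin> q1" "y3 \<notin> q0"
  proof -
    show "y0 \<notin> q3" using homogeneous_primeD[OF q(4) x(1) hv] vk[OF q(4)] x(5) sub by (auto simp: y_def)
    show "y1 \<notin> q2" using homogeneous_primeD[OF q(3) x(2) hv] vk[OF q(3)] x(7) sub by (auto simp: y_def)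
    show "y2 \<notin> q1" using homogeneous_primeD[OF q(2) x(3) hv] vk[OF q(2)] x(9) sub by (auto simp: y_def)
    show "y3 \<notin> q0" using vk[OF q(1)] by (auto simp: y_def)
  qed
  define A where "A = {..<L} \<times> {..<L} \<times> {..<L}"
  define e0 e1 e2 :: "nat \<times> nat \<times> nat \<Rightarrow> nat" where e_def: "e0 = fst" "e1 = fst \<circ> snd" "e2 = snd \<circ> snd"
  \<comment> \<open>The power of \<open>y3\<close> fills every monomial up to total exponent
    \<open>3 * L\<close>. On \<open>A\<close> the other exponents are below \<open>L\<close>, so the
    subtraction never truncates.\<close>
  define M3 where "M3 t = y3 ^ (3 * L - e0 t - e1 t - e2 t)" for t
  define M2 where "M2 t = y2 ^ e2 t * M3 t" for t
  define M1 where "M1 t = y1 ^ e1 t * M2 t" for t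
  define M0 where "M0 t = y0 ^ e0 t * M1 t" for t
  have eL: "e0 t < L" "e1 t < L" "e2 t < L" if "t \<in> A" for t using that by (auto simp: A_def e_def)
  define N where "N = 3 * L * D"
  have h3: "homogeneous ((N - D * e0 t - D * e1 t) - D * e2 t) (M3 t)" if "t \<in> A" for t
  proof -
    have "homogeneous ((3 * L - e0 t - e1 t - e2 t) * D) (M3 t)"
      unfolding M3_def by (rule homogeneous_power[OF hy(4)])
    then show ?thesis by (simp add: N_def diff_mult_distrib2 add_mult_distrib2 mult.commute)
  qed
  have le: "D * e0 t + D * e1 t + D * e2 t \<le> N" if "t \<in> A" for t
  proof -
    have "D * (e0 t + e1 t + e2 t) \<le> D * (3 * L)" using eL[OF that] by (intro mult_le_mono2) simp
    then show ?thesis by (simp add: N_def algebra_simps)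
  qed
  have h2: "homogeneous ((N - D * e0 t) - D * e1 t) (M2 t)" if "t \<in> A" for t
    unfolding M2_def using homogeneous_mult[OF homogeneous_power[OF hy(3), of "e2 t"] h3[OF that]] le[OF that]
    by (simp add: mult.commute)
  have h1: "homogeneous (N - D * e0 t) (M1 t)" if "t \<in> A" for t
    unfolding M1_def using homogeneous_mult[OF homogeneous_power[OF hy(2), of "e1 t"] h2[OF that]] le[OF that]
    by (simp add: mult.commute)
  have h0: "homogeneous N (M0 t)" if "t \<in> A" for t
    unfolding M0_def using homogeneous_mult[OF homogeneous_power[OF hy(1), of "e0 t"] h1[OF that]] le[OF that]
    by (simp add: mult.commute)
  from growth[unfolded quadratic_growth_def, rule_format, of N]
  obtain l where "\<forall>j. linear_form (l j)"
    "\<forall>f. homogeneous N f \<and> (\<forall>j<(N + 1)\<^sup>2. l j f = 0) \<longrightarrow> f \<in> Van X"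
    by (elim exE conjE)
  then have l: "\<And>j. linear_form (l j)"
    "\<And>f. homogeneous N f \<Longrightarrow> (\<And>j. j < (N + 1)\<^sup>2 \<Longrightarrow> l j f = 0) \<Longrightarrow> f \<in> Van X" by simp_all
  have "D \<ge> 1" "L \<ge> 1" by (simp_all add: D_def L_def)
  then have "N + 1 \<le> 4 * L * D" by (simp add: N_def)
  then have "(N + 1)\<^sup>2 \<le> (4 * L * D)\<^sup>2" by (rule power_mono) simp
  also have "\<dots> = L\<^sup>2 * (16 * D\<^sup>2)" by (simp add: power_mult_distrib)
  also have "\<dots> < L\<^sup>2 * L" using \<open>L \<ge> 1\<close> by (simp add: L_def)
  also have "\<dots> = card A" by (simp add: A_def card_cartesian_product power2_eq_square)
  finally have "card {..<(N + 1)\<^sup>2} < card A" by simp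
  from linear_dependence[OF _ _ this, of "\<lambda>t j. l j (M0 t)"]
  obtain c where c: "\<exists>t\<in>A. c t \<noteq> 0" "\<And>j. j < (N + 1)\<^sup>2 \<Longrightarrow> (\<Sum>t\<in>A. c t * l j (M0 t)) = 0"
    by (auto simp: A_def)
  \<comment> \<open>Only terms with nonzero coefficient are kept, so that the last surviving
    coefficient can be inverted.\<close>
  define A0 where "A0 = {t \<in> A. c t \<noteq> 0}"
  have fin: "finite A0" "A0 \<noteq> {}" "A0 \<subseteq> A" using c(1) by (auto simp: A0_def A_def)
  have "(\<Sum>t\<in>A. const (c t) * M0 t) \<in> Van X"
  proof (rule l(2))
    show "homogeneous N (\<Sum>t\<in>A. const (c t) * M0 t)"
      by (rule multihomogeneous_sum, rule multihomogeneous_smult, rule h0)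
    show "l j (\<Sum>t\<in>A. const (c t) * M0 t) = 0" if "j < (N + 1)\<^sup>2" for j
      using c(2)[OF that] linear_form_sum[OF l(1), of j c M0 A] by simp
  qed
  also have "(\<Sum>t\<in>A. const (c t) * M0 t) = (\<Sum>t\<in>A0. const (c t) * M0 t)"
    by (rule sum.mono_neutral_right) (auto simp: A0_def A_def const_def)
  finally have r0: "(\<Sum>t\<in>A0. const (c t) * (y0 ^ e0 t * M1 t)) \<in> q3" using sub(1) by (auto simp: M0_def)
  define A1 where "A1 = {t \<in> A0. e0 t = Min (e0 ` A0)}"
  have h1': "homogeneous (N - D * e0 t) (M1 t)" if "t \<in> A0" for t
    using h1[of t] that fin(3) by blast
  have le1: "D * e0 t \<le> N" if "t \<in> A0" for t
    using le[of t] that fin(3) by auto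
  have r1: "(\<Sum>t\<in>A1. const (c t) * (y1 ^ e1 t * M2 t)) \<in> q2"
    unfolding A1_def M1_def[symmetric]
    by (rule lowest_coefficient[OF q(4,3) sub(2) hy(1) notmem(1) mem(1) fin(1,2) h1' le1 r0])
  have fin1: "finite A1" "A1 \<noteq> {}" "A1 \<subseteq> A"
  proof -
    show "A1 \<noteq> {}" unfolding A1_def by (rule Min_fibre_nonempty[OF fin(1,2)])
    show "finite A1" unfolding A1_def by (rule finite_subset[OF _ fin(1)]) blast
    show "A1 \<subseteq> A" unfolding A1_def using fin(3) by blast
  qed
  define a where "a = Min (e0 ` A0)"
  have e0a: "e0 t = a" if "t \<in> A1" for t using that by (simp add: A1_def a_def)
  define A2 where "A2 = {t \<in> A1. e1 t = Min (e1 ` A1)}"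
  have h2': "homogeneous ((N - D * a) - D * e1 t) (M2 t)" if "t \<in> A1" for t
    using h2[of t] e0a[OF that] that fin1(3) by auto
  have le2: "D * e1 t \<le> N - D * a" if "t \<in> A1" for t
    using le[of t] e0a[OF that] that fin1(3) by auto
  have r2: "(\<Sum>t\<in>A2. const (c t) * (y2 ^ e2 t * M3 t)) \<in> q1"
    unfolding A2_def M2_def[symmetric]
    by (rule lowest_coefficient[OF q(3,2) sub(3) hy(2) notmem(2) mem(2) fin1(1,2) h2' le2 r1])
  have fin2: "finite A2" "A2 \<noteq> {}" "A2 \<subseteq> A1"
  proof -
    show "A2 \<noteq> {}" unfolding A2_def by (rule Min_fibre_nonempty[OF fin1(1,2)])
    show "finite A2" unfolding A2_def by (rule finite_subset[OF _ fin1(1)]) blast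
    show "A2 \<subseteq> A1" unfolding A2_def using fin1(3) by blast
  qed
  define b where "b = Min (e1 ` A1)"
  have e1b: "e1 t = b" if "t \<in> A2" for t using that by (simp add: A2_def b_def)
  define A3 where "A3 = {t \<in> A2. e2 t = Min (e2 ` A2)}"
  have h3': "homogeneous ((N - D * a - D * b) - D * e2 t) (M3 t)" if "t \<in> A2" for t
    using h3[of t] e0a[of t] e1b[OF that] that fin1(3) fin2(3) by auto
  have le3: "D * e2 t \<le> N - D * a - D * b" if t: "t \<in> A2" for t
  proof -
    have "t \<in> A1" "t \<in> A" using t fin1(3) fin2(3) by blast+
    then show ?thesis using le[of t] e0a[of t] e1b[OF t] by simp
  qed
  have r3: "(\<Sum>t\<in>A3. const (c t) * M3 t) \<in> q0"
    unfolding A3_def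
    by (rule lowest_coefficient[OF q(2,1) sub(4) hy(3) notmem(3) mem(3) fin2(1,2) h3' le3 r2])
  obtain t where t: "t \<in> A3"
    using Min_fibre_nonempty[OF fin2(1,2), of e2] unfolding A3_def[symmetric] by blast
  \<comment> \<open>The three selections fix all three exponents, and an index is the triple of its
    exponents.\<close>
  have "A3 = {t}"
  proof (intro equalityI subsetI)
    fix s assume s: "s \<in> A3"
    have mem: "s \<in> A2" "t \<in> A2" using s t unfolding A3_def by blast+
    then have "s \<in> A1" "t \<in> A1" using fin2(3) by blast+
    then have "e0 s = e0 t" using e0a by metis
    moreover have "e1 s = e1 t" using e1b mem by metis
    moreover have "e2 s = e2 t" using s t by (simp only: A3_def mem_Collect_eq)
    ultimately show "s \<in> {t}" by (simp add: e_def prod_eq_iff)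
  qed (simp add: t)
  with r3 have "const (c t) * M3 t \<in> q0" by simp
  moreover have "Modules.module.subspace (*) q0" using q(1) by (simp add: homogeneous_prime_def)
  ultimately have "const (inverse (c t)) * (const (c t) * M3 t) \<in> q0" by (rule ideal_mult_left[rotated])
  moreover have "c t \<noteq> 0" using t by (simp add: A3_def A2_def A1_def A0_def)
  then have "const (inverse (c t)) * const (c t) = (1 :: ('v, 'k) mpoly)"
    by (simp add: const_def mult_single)
  then have "const (inverse (c t)) * (const (c t) * M3 t) = M3 t" by (simp flip: mult.assoc)
  ultimately have "y3 ^ (3 * L - e0 t - e1 t - e2 t) \<in> q0" by (simp add: M3_def)
  then show False using homogeneous_prime_power[OF q(1) hy(4)] notmem(4) by blast
qed

text \<open>The growth condition bounds the dimension from above; the cones \<open>X0\<close> and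
  \<open>X1\<close>, in the applications over a point and over a line, supply a chain that bounds it
  from below.\<close>

definition surface_cone :: "('v::finite \<Rightarrow> 'k::field) set \<Rightarrow> bool" where
  "surface_cone X \<longleftrightarrow> linked X \<and> conical X \<and> quadratic_growth X \<and> (\<exists>X0 X1. linked X0 \<and> linked X1 \<and>
     conical X0 \<and> conical X1 \<and> X0 \<subseteq> X1 \<and> X1 \<subseteq> X \<and> (\<exists>x\<in>X0. \<exists>v. x v \<noteq> 0) \<and>
     \<not> Van X0 \<subseteq> Van X1 \<and> \<not> Van X1 \<subseteq> Van X)"

lemma surface_cone_Proj:
  fixes X :: "('v::finite \<Rightarrow> 'k::field_char_0) set"
  shows "surface_cone X \<Longrightarrow> Van X \<in> Proj"
  unfolding surface_cone_def using Van_in_Proj by blast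

text \<open>Intersecting the points in each member of a chain of four irreducible closed sets would
  give four primes above \<open>Van X\<close>, separated by homogeneous elements, against
  \<open>no_long_prime_chain\<close>. The loci of \<open>X0\<close>, \<open>X1\<close>,
  \<open>X\<close> form a chain of length two.\<close>

lemma krull_dim_surface_cone:
  fixes X :: "('v::finite \<Rightarrow> 'k::field_char_0) set"
  assumes X: "surface_cone X"
  shows "krull_dim (subtopology proj_topology (\<V> (Van X))) = enat 2"
proof (rule antisym)
  let ?T = "subtopology proj_topology (\<V> (Van X))"
  show "krull_dim ?T \<le> enat 2"
    unfolding krull_dim_def
  proof (rule Sup_least)
    fix m assume "m \<in> {enat n | n. \<exists>Z. (\<forall>i\<le>n. irreducible_in ?T (Z i) \<and> closedin ?T (Z i)) \<and> (\<forall>i<n. Z i \<subset> Z (Suc i))}"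
    then obtain n Z where m: "m = enat n" and Z: "\<And>i. i \<le> n \<Longrightarrow> irreducible_in ?T (Z i)"
      "\<And>i. i \<le> n \<Longrightarrow> closedin ?T (Z i)" "\<And>i. i < n \<Longrightarrow> Z i \<subset> Z (Suc i)" by blast
    have "n \<le> 2"
    proof (rule ccontr)
      assume "\<not> n \<le> 2"
      then have n: "n \<ge> 3" by simp
      have sub: "Z i \<subseteq> Proj" "Z i \<subseteq> \<V> (Van X)" if "i \<le> n" for i
        using Z(1)[OF that] by (auto simp: irreducible_in_def topspace_proj)
      have step: "\<exists>f m. homogeneous m f \<and> f \<in> \<Inter>(Z i) \<and> f \<notin> \<Inter>(Z (Suc i))" if "i < n" for i
        using that by (intro separating_element[OF Z(2) Z(3)] sub) auto
      obtain x0 n0 where x0: "homogeneous n0 x0" "x0 \<in> \<Inter>(Z 2)" "x0 \<notin> \<Inter>(Z 3)"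
        using step[of 2] n by (auto simp: numeral_2_eq_2 numeral_3_eq_3)
      obtain x1 n1 where x1: "homogeneous n1 x1" "x1 \<in> \<Inter>(Z 1)" "x1 \<notin> \<Inter>(Z 2)"
        using step[of 1] n by (auto simp: numeral_2_eq_2)
      obtain x2 n2 where x2: "homogeneous n2 x2" "x2 \<in> \<Inter>(Z 0)" "x2 \<notin> \<Inter>(Z 1)"
        using step[of 0] n by auto
      obtain p where p: "p \<in> Z 0" using Z(1)[of 0] by (auto simp: irreducible_in_def)
      then obtain v where v: "var v \<notin> p" using sub(1)[of 0] by (auto simp: Proj_def)
      have prime: "homogeneous_prime (\<Inter>(Z i))" if "i \<le> n" for i
        by (rule homogeneous_prime_Inter[OF Z(1)[OF that]])
      have "Z 2 \<subseteq> Z 3" "Z 1 \<subseteq> Z 2" "Z 0 \<subseteq> Z 1" using Z(3)[of 2] Z(3)[of 1] Z(3)[of 0] n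
        by (auto simp: numeral_2_eq_2 numeral_3_eq_3)
      moreover have "Van X \<subseteq> \<Inter>(Z 3)" using sub(2)[of 3] n by (auto simp: vanishing_locus_def)
      moreover have "var v \<notin> \<Inter>(Z 0)" using p v by blast
      moreover have "quadratic_growth X" using X by (simp add: surface_cone_def)
      ultimately show False
        using no_long_prime_chain[of X "\<Inter>(Z 0)" "\<Inter>(Z 1)" "\<Inter>(Z 2)" "\<Inter>(Z 3)" n0 x0 n1 x1 n2 x2 v]
          x0 x1 x2 prime n by (simp add: Inter_anti_mono)
    qed
    then show "m \<le> enat 2" by (simp add: m)
  qed
  from X obtain X0 X1 where X01: "linked X0" "linked X1" "conical X0" "conical X1" "X0 \<subseteq> X1" "X1 \<subseteq> X"
    "\<exists>x\<in>X0. \<exists>v. x v \<noteq> 0" "\<not> Van X0 \<subseteq> Van X1" "\<not> Van X1 \<subseteq> Van X" unfolding surface_cone_def by blast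
  have cX: "linked X" "conical X" using X by (auto simp: surface_cone_def)
  have P: "Van X0 \<in> Proj" "Van X1 \<in> Proj" "Van X \<in> Proj"
    using Van_in_Proj X01 cX by (blast, blast, blast)
  define Z where "Z i = (if i = 0 then \<V> (Van X0) else if i = 1 then \<V> (Van X1) else \<V> (Van X))" for i :: nat
  have sub: "\<V> (Van X0) \<subseteq> \<V> (Van X1)" "\<V> (Van X1) \<subseteq> \<V> (Van X)"
    using Van_antimono[OF X01(5)] Van_antimono[OF X01(6)] by (auto simp: vanishing_locus_def)
  have irr: "irreducible_in ?T (Z i)" for i
    unfolding Z_def using P sub by (auto intro!: irreducible_in_vanishing_locus)
  have cl: "closedin ?T (Z i)" for i
    unfolding Z_def using X01(3,4) cX sub
    by (auto intro!: closedin_vanishing_locus homogeneous_ideal_Van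
        simp: topspace_proj dest: subsetD[OF vanishing_locus_subset])
  have "Van X1 \<in> \<V> (Van X1)" "Van X \<in> \<V> (Van X)" using P by (auto simp: vanishing_locus_def)
  then have strict: "Z i \<subset> Z (Suc i)" if "i < 2" for i
    using that sub X01(8,9) by (auto simp: Z_def vanishing_locus_def less_2_cases_iff)
  show "enat 2 \<le> krull_dim ?T"
    unfolding krull_dim_def
    by (intro Sup_upper CollectI exI[of _ 2] exI[of _ Z] conjI refl allI impI irr cl strict)
qed

section \<open>Reduced unions of surfaces\<close>

text \<open>The assumptions \<open>I_sub\<close> and \<open>sat\<close> say that \<open>I\<close>
  agrees with the intersection of the vanishing ideals up to the irrelevant ideal. All geometric
  conclusions depend on \<open>I\<close> only through this.\<close>

locale surface_union =
  fixes I :: "('v::finite, 'k::field_char_0) mpoly set" and \<X> :: "('v \<Rightarrow> 'k) set set"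
  assumes I_sub: "\<And>X. X \<in> \<X> \<Longrightarrow> I \<subseteq> Van X"
    and I_ideal: "Modules.module.subspace (*) I"
    and sat: "\<And>f v. (\<And>X. X \<in> \<X> \<Longrightarrow> f \<in> Van X) \<Longrightarrow> var v * f \<in> I"
    and fin: "finite \<X>"
    and surf: "\<And>X. X \<in> \<X> \<Longrightarrow> surface_cone X"
    and incomparable: "\<And>X Y. X \<in> \<X> \<Longrightarrow> Y \<in> \<X> \<Longrightarrow> Van X \<subseteq> Van Y \<Longrightarrow> X = Y"
begin

lemma Van_Proj: "X \<in> \<X> \<Longrightarrow> Van X \<in> Proj"
  using surf surface_cone_Proj by blast

lemma Van_prime: "X \<in> \<X> \<Longrightarrow> prime_ideal (Van X)"
  using Van_Proj by (auto simp: Proj_def)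

lemma locus_sub: "X \<in> \<X> \<Longrightarrow> \<V> (Van X) \<subseteq> \<V> I"
  using I_sub by (auto simp: vanishing_locus_def)

text \<open>If \<open>p\<close> contained none of the ideals \<open>Van X\<close>, elements
  \<open>f X\<close> outside \<open>p\<close> could be multiplied together. The product lies in
  every \<open>Van X\<close>, so after multiplication with a variable outside \<open>p\<close> it
  lies in \<open>I\<close> and hence in \<open>p\<close>, against primality.\<close>

lemma locus_eq: "\<V> I = (\<Union>X\<in>\<X>. \<V> (Van X))"
proof
  show "(\<Union>X\<in>\<X>. \<V> (Van X)) \<subseteq> \<V> I" using locus_sub by blast
  show "\<V> I \<subseteq> (\<Union>X\<in>\<X>. \<V> (Van X))"
  proof
    fix p assume p: "p \<in> \<V> I"
    then have prime: "prime_ideal p" and "I \<subseteq> p" "p \<in> Proj" by (auto simp: vanishing_locus_def Proj_def)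
    then obtain v where v: "var v \<notin> p" by (auto simp: Proj_def)
    show "p \<in> (\<Union>X\<in>\<X>. \<V> (Van X))"
    proof (rule ccontr)
      assume "p \<notin> (\<Union>X\<in>\<X>. \<V> (Van X))"
      then have "\<forall>X\<in>\<X>. \<exists>f. f \<in> Van X \<and> f \<notin> p" using \<open>p \<in> Proj\<close> by (auto simp: vanishing_locus_def)
      then obtain f where f: "\<And>X. X \<in> \<X> \<Longrightarrow> f X \<in> Van X" "\<And>X. X \<in> \<X> \<Longrightarrow> f X \<notin> p" by metis
      have "(\<Prod>X\<in>\<X>. f X) \<in> Van X" if "X \<in> \<X>" for X
        using f(1)[OF that] that fin by (simp add: prod.remove[of \<X> X] ideal_mult_right[OF subspace_Van])
      then have "var v * (\<Prod>X\<in>\<X>. f X) \<in> p" using sat[of "\<Prod>X\<in>\<X>. f X" v] \<open>I \<subseteq> p\<close> by blast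
      then have "(\<Prod>X\<in>\<X>. f X) \<in> p" using prime v by (auto simp: prime_ideal_def)
      then show False using prime_ideal_prod[OF prime] f(2) by blast
    qed
  qed
qed

lemma components: "irreducible_components (subscheme_space I) = (\<lambda>X. \<V> (Van X)) ` \<X>"
proof (rule irreducible_components_cover)
  show "finite ((\<lambda>X. \<V> (Van X)) ` \<X>)" using fin by simp
  show "closedin (subscheme_space I) C" if "C \<in> (\<lambda>X. \<V> (Van X)) ` \<X>" for C
    using that surf locus_sub unfolding subscheme_space_def
    by (auto intro!: closedin_vanishing_locus homogeneous_ideal_Van simp: surface_cone_def)
  show "irreducible_in (subscheme_space I) C" if "C \<in> (\<lambda>X. \<V> (Van X)) ` \<X>" for C
    using that locus_sub Van_Proj unfolding subscheme_space_def
    by (auto intro!: irreducible_in_vanishing_locus)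
  show "topspace (subscheme_space I) = \<Union>((\<lambda>X. \<V> (Van X)) ` \<X>)"
    using vanishing_locus_subset[of I] by (simp add: subscheme_space_def topspace_proj locus_eq Int_absorb1)
  show "C = C'" if C: "C \<in> (\<lambda>X. \<V> (Van X)) ` \<X>" "C' \<in> (\<lambda>X. \<V> (Van X)) ` \<X>" "C \<subseteq> C'" for C C'
  proof -
    from C(1,2) obtain X Y where XY: "X \<in> \<X>" "Y \<in> \<X>" "C = \<V> (Van X)" "C' = \<V> (Van Y)" by blast
    have "Van X \<in> \<V> (Van X)" using Van_Proj[OF XY(1)] by (simp add: vanishing_locus_def)
    then have "Van Y \<subseteq> Van X" using C(3) XY by (auto simp: vanishing_locus_def)
    then show ?thesis using incomparable[OF XY(2,1)] XY by simp
  qed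
qed

lemma locus_inj: "inj_on (\<lambda>X. \<V> (Van X)) \<X>"
proof (rule inj_onI)
  fix X Y assume XY: "X \<in> \<X>" "Y \<in> \<X>" "\<V> (Van X) = \<V> (Van Y)"
  have "Van X \<in> \<V> (Van X)" using Van_Proj[OF XY(1)] by (simp add: vanishing_locus_def)
  then have "Van Y \<subseteq> Van X" using XY by (auto simp: vanishing_locus_def)
  then show "X = Y" using incomparable[OF XY(2,1)] by simp
qed

lemma equidim: "equidimensional (subscheme_space I) 2"
  unfolding equidimensional_def components
proof
  fix Z assume "Z \<in> (\<lambda>X. \<V> (Van X)) ` \<X>"
  then obtain X where X: "X \<in> \<X>" "Z = \<V> (Van X)" by blast
  then have "\<V> I \<inter> Z = Z" using locus_sub by blast
  then show "krull_dim (subtopology (subscheme_space I) Z) = enat 2"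
    using krull_dim_surface_cone[OF surf[OF X(1)]]
    by (simp add: subscheme_space_def subtopology_subtopology X(2))
qed

text \<open>If the components through \<open>p\<close> all contain \<open>a\<close>, then multiplying \<open>a\<close> by equations of the other
  components that are units at \<open>p\<close> puts it into all of them.\<close>

lemma reduced: "reduced_subscheme I"
  unfolding reduced_subscheme_def
proof (intro ballI allI impI)
  fix p a s n
  assume p: "p \<in> \<V> I" and a: "homogeneous n a \<and> homogeneous n s \<and> s \<notin> p"
    and nil: "\<exists>k. zero_in_stalk I p (a ^ k)"
  from p have prime: "prime_ideal p" and "I \<subseteq> p" "p \<in> Proj" by (auto simp: vanishing_locus_def Proj_def)
  then obtain v where v: "var v \<notin> p" by (auto simp: Proj_def)
  obtain k t where t: "t \<notin> p" "t * a ^ k \<in> I" using nil by (auto simp: zero_in_stalk_def)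
  have "\<exists>u m. homogeneous m u \<and> u \<notin> p \<and> u * a \<in> Van X" if X: "X \<in> \<X>" for X
  proof (cases "Van X \<subseteq> p")
    case True
    have "t * a ^ k \<in> Van X" using t(2) I_sub[OF X] by blast
    moreover have "t \<notin> Van X" using t(1) True by blast
    ultimately have "a ^ k \<in> Van X" using Van_prime[OF X] by (auto simp: prime_ideal_def)
    then have "a \<in> Van X" by (rule prime_ideal_power[OF Van_prime[OF X]])
    moreover have "1 \<notin> p" using prime by (simp add: prime_ideal_def)
    ultimately show ?thesis using multihomogeneous_one[of std_grading] by (intro exI[of _ 1] exI[of _ 0]) simp
  next
    case False
    have hom: "homogeneous_ideal (Van X)" using surf[OF X] by (auto simp: surface_cone_def intro: homogeneous_ideal_Van)
    have "\<not> {f \<in> Van X. \<exists>n. homogeneous n f} \<subseteq> p"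
    proof
      assume "{f \<in> Van X. \<exists>n. homogeneous n f} \<subseteq> p"
      then have "ideal_gen {f \<in> Van X. \<exists>n. homogeneous n f} \<subseteq> p"
        using prime by (intro ideal_minimal) (auto simp: prime_ideal_def)
      then show False using hom False by (simp add: homogeneous_ideal_def)
    qed
    then obtain u m where "u \<in> Van X" "homogeneous m u" "u \<notin> p" by blast
    then show ?thesis using ideal_mult_right[OF subspace_Van] by blast
  qed
  then obtain u m where u: "\<And>X. X \<in> \<X> \<Longrightarrow> homogeneous (m X) (u X)" "\<And>X. X \<in> \<X> \<Longrightarrow> u X \<notin> p"
    "\<And>X. X \<in> \<X> \<Longrightarrow> u X * a \<in> Van X" by metis
  have "(\<Prod>X\<in>\<X>. u X) * a \<in> Van X" if "X \<in> \<X>" for X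
  proof -
    have "(\<Prod>X\<in>\<X>. u X) * a = (u X * a) * (\<Prod>X\<in>\<X> - {X}. u X)"
      using that fin by (simp add: prod.remove[of \<X> X] mult_ac)
    then show ?thesis using ideal_mult_right[OF subspace_Van u(3)[OF that]] by simp
  qed
  then have "var v * ((\<Prod>X\<in>\<X>. u X) * a) \<in> I" by (rule sat)
  then have "(var v * (\<Prod>X\<in>\<X>. u X)) * a \<in> I" by (simp only: mult.assoc)
  moreover have "homogeneous (1 + (\<Sum>X\<in>\<X>. m X)) (var v * (\<Prod>X\<in>\<X>. u X))"
    by (rule homogeneous_mult[OF homogeneous_var]) (use multihomogeneous_prod[of \<X> std_grading "\<lambda>X _. m X" u] u(1) in auto)
  moreover have "var v * (\<Prod>X\<in>\<X>. u X) \<notin> p"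
    using prime v prime_ideal_prod[OF prime, of u \<X>] u(2) by (auto simp: prime_ideal_def)
  ultimately show "zero_in_stalk I p a" unfolding zero_in_stalk_def by blast
qed

end

section \<open>Parametrised cones\<close>

lemma exhaust_num2: "(x :: 2) = 1 \<or> x = 2"
proof (induct x)
  case (of_int z)
  then have "z = 0 \<or> z = 1" by fastforce
  then show ?case by auto
qed

lemma exhaust_num3: "(x :: 3) = 1 \<or> x = 2 \<or> x = 3"
proof (induct x)
  case (of_int z)
  then have "z = 0 \<or> z = 1 \<or> z = 2" by fastforce
  then show ?case by auto
qed

lemma forall_num2: "(\<forall>i::2. P i) \<longleftrightarrow> P 1 \<and> P 2" by (metis exhaust_num2)
lemma forall_num3: "(\<forall>i::3. P i) \<longleftrightarrow> P 1 \<and> P 2 \<and> P 3" by (metis exhaust_num3)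

lemma range_std_grading: "range std_grading = {()}"
  by auto

lemma eval_homogeneous_std:
  fixes f :: "('v::finite, 'k::field) mpoly"
  assumes "homogeneous n f"
  shows "eval (\<lambda>v. c * x v) f = c ^ n * eval x f"
  using eval_homogeneous[OF assms, where c = "\<lambda>_. c" and x = x] unfolding range_std_grading by simp

lemma lookup_const_mult: "Poly_Mapping.lookup (const c * f) m = c * Poly_Mapping.lookup f m"
proof (induction f rule: poly_mapping_add_induct)
  case (2 n d)
  show ?case by (simp add: const_def mult_single lookup_single when_def)
qed (simp_all add: lookup_add distrib_left)

text \<open>Pulling a form of degree \<open>n\<close> back along \<open>\<pi>\<close> gives a
  polynomial of degree \<open>n\<close> in every block. Its coefficients are the required linear
  forms, and their number is the number of monomials of this multidegree.\<close>

lemma quadratic_growth_param: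
  fixes \<pi> :: "'v::finite \<Rightarrow> ('w::finite, 'k::field_char_0) mpoly" and gr :: "'w \<Rightarrow> 'i"
  assumes \<pi>: "\<And>v. multihomogeneous gr (\<lambda>_. 1) (\<pi> v)"
    and X: "X \<subseteq> range (\<lambda>a v. eval a (\<pi> v))"
    and B: "\<And>n. finite {m :: 'w \<Rightarrow>\<^sub>0 nat. \<forall>i. (\<Sum>w | gr w = i. Poly_Mapping.lookup m w) = n}"
      "\<And>n. card {m :: 'w \<Rightarrow>\<^sub>0 nat. \<forall>i. (\<Sum>w | gr w = i. Poly_Mapping.lookup m w) = n} \<le> (n + 1)\<^sup>2"
  shows "quadratic_growth X"
  unfolding quadratic_growth_def
proof
  fix n
  define M where "M = {m :: 'w \<Rightarrow>\<^sub>0 nat. \<forall>i. (\<Sum>w | gr w = i. Poly_Mapping.lookup m w) = n}"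
  obtain e where e: "bij_betw e {0..<card M} M"
    using ex_bij_betw_nat_finite[OF B(1)[of n]] unfolding M_def by blast
  \<comment> \<open>Indices beyond the number of monomials get the zero form.\<close>
  define l where "l j f = (if j < card M then Poly_Mapping.lookup (subst \<pi> f) (e j) else 0)" for j f
  have "linear_form (l j)" for j
    by (auto simp: linear_form_def l_def subst_simps lookup_add lookup_const_mult)
  moreover have "f \<in> Van X" if f: "homogeneous n f" "\<And>j. j < (n + 1)\<^sup>2 \<Longrightarrow> l j f = 0" for f
  proof -
    have "multihomogeneous gr (\<lambda>i. \<Sum>j\<in>range (std_grading :: 'v \<Rightarrow> unit). n * 1) (subst \<pi> f)"
      by (rule multihomogeneous_subst[OF _ f(1)]) (rule \<pi>)
    then have "multihomogeneous gr (\<lambda>_. n) (subst \<pi> f)" unfolding range_std_grading by simp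
    then have keys: "Poly_Mapping.keys (subst \<pi> f) \<subseteq> M"
      unfolding multihomogeneous_def M_def by blast
    have "Poly_Mapping.lookup (subst \<pi> f) m = 0" for m
    proof (cases "m \<in> M")
      case True
      with e have "m \<in> e ` {0..<card M}" by (simp only: bij_betw_def)
      then obtain j where j: "j < card M" "e j = m" by auto
      then have "j < (n + 1)\<^sup>2" using B(2)[of n] by (simp add: M_def)
      from f(2)[OF this] j show ?thesis by (simp add: l_def)
    next
      case False
      then show ?thesis using keys by (auto simp: in_keys_iff)
    qed
    then have "subst \<pi> f = 0" by (intro poly_mapping_eqI) simp
    then have "eval (\<lambda>v. eval a (\<pi> v)) f = 0" for a by (simp flip: eval_subst)
    then show ?thesis using X by (auto simp: Van_def)
  qed
  ultimately show "\<exists>l. (\<forall>j. linear_form (l j)) \<and> (\<forall>f. homogeneous n f \<and> (\<forall>j<(n + 1)\<^sup>2. l j f = 0) \<longrightarrow> f \<in> Van X)"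
    by (intro exI[of _ l]) simp
qed

text \<open>The image of a coordinate subspace of the parameter space; faces provide the smaller
  cones \<open>X0\<close> and \<open>X1\<close>.\<close>

definition face :: "('v \<Rightarrow> ('w, 'k::field) mpoly) \<Rightarrow> 'w set \<Rightarrow> ('v \<Rightarrow> 'k) set" where
  "face \<pi> S = range (\<lambda>a v. eval (\<lambda>w. if w \<in> S then a w else 0) (\<pi> v))"

lemma linked_face:
  fixes \<pi> :: "'v \<Rightarrow> ('w, 'k::field) mpoly"
  shows "linked (face \<pi> S)"
proof -
  have "(\<lambda>w. if w \<in> S then a w else 0) = (\<lambda>w. eval a (if w \<in> S then var w else 0))" for a :: "'w \<Rightarrow> 'k"
    by auto
  then have "face \<pi> S = range (\<lambda>a v. eval a (subst (\<lambda>w. if w \<in> S then var w else 0) (\<pi> v)))"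
    by (simp only: face_def eval_subst)
  then show ?thesis by (simp only: linked_range)
qed

lemma conical_face:
  fixes gr :: "'w::finite \<Rightarrow> 'i"
  assumes \<pi>: "\<And>v. multihomogeneous gr (\<lambda>_. 1) (\<pi> v)"
  shows "conical (face \<pi> S)"
  unfolding conical_def face_def
proof (intro ballI allI impI)
  fix x c assume "x \<in> range (\<lambda>a v. eval (\<lambda>w. if w \<in> S then a w else 0) (\<pi> v))"
  then obtain a where x: "x = (\<lambda>v. eval (\<lambda>w. if w \<in> S then a w else 0) (\<pi> v))" by blast
  \<comment> \<open>An arbitrary block of the grading. As \<open>\<pi>\<close> has degree one in it,
    scaling this block alone scales the image by \<open>c\<close>.\<close>
  define i where "i = gr undefined"
  have eq: "eval (\<lambda>w. if w \<in> S then (if gr w = i then c else 1) * a w else 0) (\<pi> v) = c * x v" for v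
  proof -
    have "(\<lambda>w. if w \<in> S then (if gr w = i then c else 1) * a w else 0) =
        (\<lambda>w. (\<lambda>j. if j = i then c else 1) (gr w) * (if w \<in> S then a w else 0))" by auto
    then have "eval (\<lambda>w. if w \<in> S then (if gr w = i then c else 1) * a w else 0) (\<pi> v) =
        (\<Prod>j\<in>range gr. (if j = i then c else 1) ^ 1) * x v"
      using eval_homogeneous[OF \<pi>, of "\<lambda>j. if j = i then c else 1" "\<lambda>w. if w \<in> S then a w else 0" v]
      by (simp add: x)
    also have "(\<Prod>j\<in>range gr. (if j = i then c else 1) ^ 1) = c"
      by (simp add: prod.delta i_def)
    finally show ?thesis .
  qed
  then show "(\<lambda>v. c * x v) \<in> range (\<lambda>a v. eval (\<lambda>w. if w \<in> S then a w else 0) (\<pi> v))"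
    by (intro image_eqI[of _ _ "\<lambda>w. (if gr w = i then c else 1) * a w"]) auto
qed

lemma face_mono:
  fixes \<pi> :: "'v \<Rightarrow> ('w, 'k::field) mpoly"
  assumes "S \<subseteq> T"
  shows "face \<pi> S \<subseteq> face \<pi> T"
  unfolding face_def
proof clarify
  fix a :: "'w \<Rightarrow> 'k"
  have "(\<lambda>w. if w \<in> T then (if w \<in> S then a w else 0) else 0) = (\<lambda>w. if w \<in> S then a w else 0)" using assms by (auto simp: fun_eq_iff)
  then show "(\<lambda>v. eval (\<lambda>w. if w \<in> S then a w else 0) (\<pi> v)) \<in> range (\<lambda>a v. eval (\<lambda>w. if w \<in> T then a w else 0) (\<pi> v))"
    by (intro image_eqI[of _ _ "\<lambda>w. if w \<in> S then a w else 0"]) auto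
qed

lemma face_UNIV: "face \<pi> UNIV = range (\<lambda>a v. eval a (\<pi> v))"
  by (simp add: face_def)

lemma surface_cone_param:
  fixes \<pi> :: "'v::finite \<Rightarrow> ('w::finite, 'k::field_char_0) mpoly" and gr :: "'w \<Rightarrow> 'i"
  assumes \<pi>: "\<And>v. multihomogeneous gr (\<lambda>_. 1) (\<pi> v)"
    and X: "X = range (\<lambda>a v. eval a (\<pi> v))"
    and B: "\<And>n. finite {m :: 'w \<Rightarrow>\<^sub>0 nat. \<forall>i. (\<Sum>w | gr w = i. Poly_Mapping.lookup m w) = n}"
      "\<And>n. card {m :: 'w \<Rightarrow>\<^sub>0 nat. \<forall>i. (\<Sum>w | gr w = i. Poly_Mapping.lookup m w) = n} \<le> (n + 1)\<^sup>2"
    and S: "S \<subseteq> T" and x: "x \<in> face \<pi> S" "x v \<noteq> 0"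
    and h1: "h1 \<in> Van (face \<pi> S)" "h1 \<notin> Van (face \<pi> T)" and h2: "h2 \<in> Van (face \<pi> T)" "h2 \<notin> Van X"
  shows "surface_cone X"
  unfolding surface_cone_def
proof (intro conjI exI)
  show "linked X" "conical X" using linked_face[where \<pi> = \<pi> and S = UNIV] conical_face[OF \<pi>, where S = UNIV] by (simp_all add: X face_UNIV)
  show "quadratic_growth X" by (rule quadratic_growth_param[where \<pi> = \<pi> and gr = gr, OF \<pi> _ B]) (simp add: X)
  show "linked (face \<pi> S)" "linked (face \<pi> T)" by (rule linked_face)+
  show "conical (face \<pi> S)" "conical (face \<pi> T)" by (rule conical_face[OF \<pi>])+
  show "face \<pi> S \<subseteq> face \<pi> T" by (rule face_mono[OF S])
  show "face \<pi> T \<subseteq> X" using face_mono[where S = T and T = UNIV and \<pi> = \<pi>, OF subset_UNIV] by (simp add: X face_UNIV)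
  show "\<exists>x\<in>face \<pi> S. \<exists>v. x v \<noteq> 0" using x by blast
  show "\<not> Van (face \<pi> S) \<subseteq> Van (face \<pi> T)" "\<not> Van (face \<pi> T) \<subseteq> Van X" using h1 h2 by blast+
qed

subsection \<open>Planes and quadric surfaces\<close>

text \<open>\<open>X\<close> is a linearly embedded three-dimensional space, and the forms
  \<open>Y\<close> give a linear left inverse of the embedding \<open>L\<close>.\<close>

definition plane_chart ::
  "('v::finite \<Rightarrow> (3, 'k::field) mpoly) \<Rightarrow> (3 \<Rightarrow> ('v, 'k) mpoly) \<Rightarrow> ('v \<Rightarrow> 'k) set \<Rightarrow> bool" where
  "plane_chart L Y X \<longleftrightarrow> (\<forall>v. homogeneous 1 (L v)) \<and> (\<forall>w. homogeneous 1 (Y w)) \<and>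
     X = range (\<lambda>y v. eval y (L v)) \<and> (\<forall>y w. eval (\<lambda>v. eval y (L v)) (Y w) = y w)"

text \<open>The parameter \<open>y\<close> is a 2 by 2 matrix, and \<open>X\<close> corresponds to
  the singular matrices. The identity for \<open>Y\<close> is required for all matrices, so
  \<open>L\<close> embeds the whole four-dimensional space.\<close>

definition quadric_chart ::
  "('v::finite \<Rightarrow> (2 \<times> 2, 'k::field) mpoly) \<Rightarrow> (2 \<times> 2 \<Rightarrow> ('v, 'k) mpoly) \<Rightarrow> ('v \<Rightarrow> 'k) set \<Rightarrow> bool" where
  "quadric_chart L Y X \<longleftrightarrow> (\<forall>v. homogeneous 1 (L v)) \<and> (\<forall>w. homogeneous 1 (Y w)) \<and>
     X = (\<lambda>y v. eval y (L v)) ` {y. y (1, 1) * y (2, 2) = y (1, 2) * y (2, 1)} \<and>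
     (\<forall>y w. eval (\<lambda>v. eval y (L v)) (Y w) = y w)"

definition segre :: "('v::finite \<Rightarrow> (2 \<times> 2, 'k::field) mpoly) \<Rightarrow> 'v \<Rightarrow> (2 \<times> 2, 'k) mpoly" where
  "segre L v = subst (\<lambda>(k, l). var (1, k) * var (2, l)) (L v)"

lemma eval_segre: "eval a (segre L v) = eval (\<lambda>(k, l). a (1, k) * a (2, l)) (L v)"
  by (simp add: segre_def eval_subst case_prod_unfold eval_simps)

text \<open>A singular 2 by 2 matrix is a column times a row, so the Segre map is surjective on
  cones, the zero matrix included.\<close>

lemma rank_one_decomposition:
  fixes y :: "2 \<times> 2 \<Rightarrow> 'k::field"
  assumes "y (1, 1) * y (2, 2) = y (1, 2) * y (2, 1)"
  shows "\<exists>a :: 2 \<times> 2 \<Rightarrow> 'k. y = (\<lambda>(k, l). a (1, k) * a (2, l))"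
proof -
  have "\<exists>p q r s. y (1, 1) = p * r \<and> y (1, 2) = p * s \<and> y (2, 1) = q * r \<and> y (2, 2) = q * s"
  proof (cases "y (1, 1) = 0")
    case False
    then show ?thesis using assms
      by (intro exI[of _ 1] exI[of _ "y (2, 1) / y (1, 1)"] exI[of _ "y (1, 1)"] exI[of _ "y (1, 2)"])
        (simp add: field_simps)
  next
    case True
    show ?thesis
    proof (cases "y (1, 2) = 0")
      case True
      with \<open>y (1, 1) = 0\<close> show ?thesis
        by (intro exI[of _ 0] exI[of _ 1] exI[of _ "y (2, 1)"] exI[of _ "y (2, 2)"]) simp
    next
      case False
      with \<open>y (1, 1) = 0\<close> assms show ?thesis
        by (intro exI[of _ "y (1, 2)"] exI[of _ "y (2, 2)"] exI[of _ 0] exI[of _ 1]) simp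
    qed
  qed
  then obtain p q r s where "y (1, 1) = p * r" "y (1, 2) = p * s" "y (2, 1) = q * r" "y (2, 2) = q * s" by blast
  note y = this
  define a :: "2 \<times> 2 \<Rightarrow> 'k" where
    "a = (\<lambda>(i, j). if i = 1 then (if j = 1 then p else q) else (if j = 1 then r else s))"
  have "y (k, l) = a (1, k) * a (2, l)" for k l
    using exhaust_num2[of k] exhaust_num2[of l] y by (auto simp: a_def)
  then show ?thesis by (intro exI[of _ a] ext) auto
qed

lemma quadric_chart_range:
  fixes X :: "('v::finite \<Rightarrow> 'k::field) set"
  assumes "quadric_chart L Y X"
  shows "X = range (\<lambda>a v. eval a (segre L v))"
proof -
  have "{y :: 2 \<times> 2 \<Rightarrow> 'k. y (1, 1) * y (2, 2) = y (1, 2) * y (2, 1)} =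
      range (\<lambda>a :: 2 \<times> 2 \<Rightarrow> 'k. \<lambda>(k, l). a (1, k) * a (2, l))"
    using rank_one_decomposition by (auto simp: mult_ac)
  then have "X = (\<lambda>y v. eval y (L v)) ` range (\<lambda>a :: 2 \<times> 2 \<Rightarrow> 'k. \<lambda>(k, l). a (1, k) * a (2, l))"
    using assms by (simp add: quadric_chart_def)
  then show ?thesis by (simp add: image_image eval_segre)
qed

lemma multihomogeneous_segre:
  fixes L :: "'v::finite \<Rightarrow> (2 \<times> 2, 'k::field) mpoly"
  assumes "homogeneous 1 (L v)"
  shows "multihomogeneous fst (\<lambda>_. 1) (segre L v)"
proof -
  have "multihomogeneous fst (\<lambda>_. 1) (var (1, k) * var (2, l) :: (2 \<times> 2, 'k) mpoly)" for k l
  proof -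
    have "(\<lambda>i :: 2. (if i = 1 then 1 else 0) + (if i = 2 then 1 else 0 :: nat)) = (\<lambda>_. 1)"
      using exhaust_num2 by fastforce
    then show ?thesis
      using multihomogeneous_mult[OF multihomogeneous_var[of fst "(1 :: 2, k)"] multihomogeneous_var[of fst "(2 :: 2, l)"]]
      by (simp del: One_nat_def)
  qed
  then have "multihomogeneous fst (\<lambda>i. \<Sum>j\<in>range (std_grading :: 2 \<times> 2 \<Rightarrow> unit). 1 * 1) (segre L v)"
    unfolding segre_def by (intro multihomogeneous_subst[OF _ assms]) (auto simp: case_prod_unfold)
  then show ?thesis unfolding range_std_grading by simp
qed

lemma sum_num3: "(\<Sum>w\<in>{1, 2, 3 :: 3}. f w) = f 1 + (f 2 + (f 3 :: nat))"
  by simp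

lemma std_fibre: "{w :: 3. std_grading w = i} = {1, 2, 3}"
  using exhaust_num3 by (auto simp: std_grading_def)

text \<open>Two exponents of a ternary monomial of degree \<open>n\<close> determine the third; this
  crude count already meets the bound.\<close>

lemma std_monomials:
  "finite {m :: 3 \<Rightarrow>\<^sub>0 nat. \<forall>i. (\<Sum>w | std_grading w = i. Poly_Mapping.lookup m w) = n}" (is "finite ?M")
  "card {m :: 3 \<Rightarrow>\<^sub>0 nat. \<forall>i. (\<Sum>w | std_grading w = i. Poly_Mapping.lookup m w) = n} \<le> (n + 1)\<^sup>2"
proof -
  let ?f = "\<lambda>m :: 3 \<Rightarrow>\<^sub>0 nat. (Poly_Mapping.lookup m 1, Poly_Mapping.lookup m 2)"
  have M: "Poly_Mapping.lookup m 1 + (Poly_Mapping.lookup m 2 + Poly_Mapping.lookup m 3) = n" if "m \<in> ?M" for m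
    using that unfolding std_fibre sum_num3 by simp
  have "inj_on ?f ?M"
  proof (rule inj_onI)
    fix m m' assume "m \<in> ?M" "m' \<in> ?M" "?f m = ?f m'"
    with M[of m] M[of m'] have "\<forall>w. Poly_Mapping.lookup m w = Poly_Mapping.lookup m' w"
      unfolding forall_num3 by auto
    then show "m = m'" by (simp add: poly_mapping_eqI)
  qed
  moreover have "?f ` ?M \<subseteq> {..n} \<times> {..n}"
  proof (rule image_subsetI)
    fix m assume "m \<in> ?M"
    then show "?f m \<in> {..n} \<times> {..n}" using M[of m] by simp
  qed
  moreover have "finite ({..n} \<times> {..n})" by simp
  ultimately show "finite ?M" and "card ?M \<le> (n + 1)\<^sup>2"
    using inj_on_finite[of ?f ?M "{..n} \<times> {..n}"] card_inj_on_le[of ?f ?M "{..n} \<times> {..n}"]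
    by (auto simp: card_cartesian_product power2_eq_square)
qed

lemma fst_fibre: "{w :: 2 \<times> 2. fst w = i} = {(i, 1), (i, 2)}"
  using exhaust_num2 by (auto simp: prod_eq_iff)

text \<open>One exponent in each block determines a monomial of bidegree \<open>(n, n)\<close>. This
  count is the origin of the bound \<open>(n + 1)\<^sup>2\<close>.\<close>

lemma fst_monomials:
  "finite {m :: 2 \<times> 2 \<Rightarrow>\<^sub>0 nat. \<forall>i. (\<Sum>w | fst w = i. Poly_Mapping.lookup m w) = n}" (is "finite ?M")
  "card {m :: 2 \<times> 2 \<Rightarrow>\<^sub>0 nat. \<forall>i. (\<Sum>w | fst w = i. Poly_Mapping.lookup m w) = n} \<le> (n + 1)\<^sup>2"
proof -
  let ?f = "\<lambda>m :: 2 \<times> 2 \<Rightarrow>\<^sub>0 nat. (Poly_Mapping.lookup m (1, 1), Poly_Mapping.lookup m (2, 1))"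
  have M: "Poly_Mapping.lookup m (i, 1) + Poly_Mapping.lookup m (i, 2) = n" if "m \<in> ?M" for m i
    using that by (simp add: fst_fibre)
  have "inj_on ?f ?M"
  proof (rule inj_onI)
    fix m m' assume mm: "m \<in> ?M" "m' \<in> ?M" "?f m = ?f m'"
    have "Poly_Mapping.lookup m (i, j) = Poly_Mapping.lookup m' (i, j)" for i j
      using mm(3) M[OF mm(1), of i] M[OF mm(2), of i] exhaust_num2[of i] exhaust_num2[of j] by auto
    then show "m = m'" by (intro poly_mapping_eqI) (metis surj_pair)
  qed
  moreover have "?f ` ?M \<subseteq> {..n} \<times> {..n}"
  proof (rule image_subsetI)
    fix m assume "m \<in> ?M"
    then show "?f m \<in> {..n} \<times> {..n}" using M[of m 1] M[of m 2] by simp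
  qed
  moreover have "finite ({..n} \<times> {..n})" by simp
  ultimately show "finite ?M" and "card ?M \<le> (n + 1)\<^sup>2"
    using inj_on_finite[of ?f ?M "{..n} \<times> {..n}"] card_inj_on_le[of ?f ?M "{..n} \<times> {..n}"]
    by (auto simp: card_cartesian_product power2_eq_square)
qed

lemma homogeneous_one_nonzero:
  assumes "homogeneous 1 f" "eval x f \<noteq> 0"
  shows "\<exists>v. x v \<noteq> 0"
proof (rule ccontr)
  assume "\<not> (\<exists>v. x v \<noteq> 0)"
  then have "x = (\<lambda>v. 0 * x v)" by auto
  then have "eval x f = 0" using eval_homogeneous_std[OF assms(1), of 0 x] by simp
  with assms(2) show False by simp
qed

lemma plane_surface_cone:
  fixes X :: "('v::finite \<Rightarrow> 'k::field_char_0) set"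
  assumes "plane_chart L Y X"
  shows "surface_cone X"
proof -
  have L: "\<And>v. multihomogeneous std_grading (\<lambda>_. 1) (L v)" and X: "X = range (\<lambda>y v. eval y (L v))"
    and Y: "\<And>y w. eval (\<lambda>v. eval y (L v)) (Y w) = y w" "\<And>w. homogeneous 1 (Y w)"
    using assms unfolding plane_chart_def by auto
  define x :: "'v \<Rightarrow> 'k" where "x = (\<lambda>v. eval (\<lambda>w. if w \<in> {1 :: 3} then 1 else 0) (L v))"
  have x: "x \<in> face L {1}" unfolding x_def face_def by (rule range_eqI[of _ _ "\<lambda>_. 1"]) simp
  have "eval x (Y 1) = 1" unfolding x_def Y by simp
  then obtain v where v: "x v \<noteq> 0" using homogeneous_one_nonzero[OF Y(2), of x 1] by auto
  have nv: "Y i \<notin> Van (face L S)" if "i \<in> S" for i S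
    using that unfolding Van_def face_def by (auto simp: Y intro!: exI[of _ "\<lambda>_. 1"])
  have iv: "Y i \<in> Van (face L S)" if "i \<notin> S" for i S
    using that unfolding Van_def face_def by (auto simp: Y)
  \<comment> \<open>The faces \<open>{1}\<close> and \<open>{1, 2}\<close> are a point and a line of
    the plane; \<open>Y 2\<close> and \<open>Y 3\<close> show that the chain is strict.\<close>
  show ?thesis
    by (rule surface_cone_param[OF L X std_monomials _ x v iv[of 2] nv[of 2 "{1, 2}"] iv[of 3] nv[of 3 UNIV, unfolded face_UNIV, folded X]])
      auto
qed

lemma quadric_surface_cone:
  fixes X :: "('v::finite \<Rightarrow> 'k::field_char_0) set"
  assumes "quadric_chart L Y X"
  shows "surface_cone X"
proof -
  have L: "\<And>v. homogeneous 1 (L v)"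
    and Y: "\<And>y w. eval (\<lambda>v. eval y (L v)) (Y w) = y w" "\<And>w. homogeneous 1 (Y w)"
    using assms unfolding quadric_chart_def by auto
  have X: "X = range (\<lambda>a v. eval a (segre L v))" by (rule quadric_chart_range[OF assms])
  have \<pi>: "\<And>v. multihomogeneous fst (\<lambda>_. 1) (segre L v)" by (rule multihomogeneous_segre[OF L])
  have Y': "eval (\<lambda>v. eval a (segre L v)) (Y (k, l)) = a (1, k) * a (2, l)" for a k l
    by (simp add: eval_segre Y)
  \<comment> \<open>\<open>S\<close> keeps the first coordinate of each factor, which is a point;
    \<open>T\<close> frees the second factor, which is a line of one ruling. The forms
    \<open>Y (1, 2)\<close> and \<open>Y (2, 1)\<close> separate the steps.\<close>
  define S T :: "(2 \<times> 2) set" where "S = {(1, 1), (2, 1)}" and "T = {(1, 1), (2, 1), (2, 2)}"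
  define x :: "'v \<Rightarrow> 'k" where "x = (\<lambda>v. eval (\<lambda>w. if w \<in> S then 1 else 0) (segre L v))"
  have x: "x \<in> face (segre L) S" unfolding x_def face_def by (rule range_eqI[of _ _ "\<lambda>_. 1"]) simp
  have "eval x (Y (1, 1)) = 1" unfolding x_def Y' by (simp add: S_def)
  then obtain v where v: "x v \<noteq> 0" using homogeneous_one_nonzero[OF Y(2), of x "(1, 1)"] by auto
  have nv: "Y (k, l) \<notin> Van (face (segre L) R)" if "(1, k) \<in> R" "(2, l) \<in> R" for k l R
    using that unfolding Van_def face_def by (auto simp: Y' intro!: exI[of _ "\<lambda>_. 1"])
  have iv: "Y (k, l) \<in> Van (face (segre L) R)" if "(1, k) \<notin> R \<or> (2, l) \<notin> R" for k l R
    using that unfolding Van_def face_def by (auto simp: Y')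
  show ?thesis
    by (rule surface_cone_param[OF \<pi> X fst_monomials _ x v iv[of 1 S 2] nv[of 1 T 2] iv[of 2 T 1] nv[of 2 UNIV 1, unfolded face_UNIV, folded X]])
      (auto simp: S_def T_def)
qed

section \<open>Morphisms of varieties\<close>

text \<open>The coordinate vectors of one point: each block of \<open>gr\<close> is scaled
  independently. Keeping this apart from \<open>valid\<close> allows orbits of arbitrary
  vectors.\<close>

definition orbit :: "('v \<Rightarrow> 'i) \<Rightarrow> ('v \<Rightarrow> 'k::field) \<Rightarrow> ('v \<Rightarrow> 'k) set" where
  "orbit gr x = {\<lambda>v. c (gr v) * x v | c. \<forall>i. c i \<noteq> 0}"

definition valid :: "('v \<Rightarrow> 'i) \<Rightarrow> ('v \<Rightarrow> 'k::field) \<Rightarrow> bool" where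
  "valid gr x \<longleftrightarrow> (\<forall>i\<in>range gr. \<exists>v. gr v = i \<and> x v \<noteq> 0)"

lemma multiproj_eq: "multiproj gr = orbit gr ` {x. valid gr x}"
  unfolding multiproj_def orbit_def valid_def by blast

lemma orbit_self: "x \<in> orbit gr x"
  unfolding orbit_def by (rule CollectI, rule exI[of _ "\<lambda>_. 1"]) simp

lemma orbit_eq:
  assumes "y \<in> orbit gr x"
  shows "orbit gr y = orbit gr x"
proof -
  have sub: "orbit gr y \<subseteq> orbit gr x" if yx: "y \<in> orbit gr x" for x y
  proof
    fix z assume "z \<in> orbit gr y"
    then obtain d where d: "z = (\<lambda>v. d (gr v) * y v)" "\<forall>i. d i \<noteq> 0" unfolding orbit_def by blast
    obtain c where c: "y = (\<lambda>v. c (gr v) * x v)" "\<forall>i. c i \<noteq> 0" using yx unfolding orbit_def by blast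
    show "z \<in> orbit gr x" unfolding orbit_def
      by (rule CollectI, rule exI[of _ "\<lambda>i. d i * c i"]) (simp add: c d mult.assoc)
  qed
  obtain c where c: "y = (\<lambda>v. c (gr v) * x v)" "\<forall>i. c i \<noteq> 0" using assms unfolding orbit_def by blast
  have "x \<in> orbit gr y" unfolding orbit_def
    by (rule CollectI, rule exI[of _ "\<lambda>i. inverse (c i)"]) (simp add: c fun_eq_iff)
  then show ?thesis using sub assms by blast
qed

lemma valid_orbit: "valid gr x \<Longrightarrow> y \<in> orbit gr x \<Longrightarrow> valid gr y"
  unfolding valid_def orbit_def by fastforce

lemma multiprojE:
  assumes "P \<in> multiproj gr" "x \<in> P"
  shows "P = orbit gr x" "valid gr x"
proof -
  obtain y where y: "P = orbit gr y" "valid gr y" using assms(1) unfolding multiproj_eq by blast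
  show "P = orbit gr x" using orbit_eq[of x gr y] assms(2) y by simp
  show "valid gr x" using valid_orbit y assms(2) by blast
qed

lemma multiproj_nonempty: "P \<in> multiproj gr \<Longrightarrow> \<exists>x. x \<in> P"
  unfolding multiproj_eq using orbit_self by blast

lemma eval_orbit:
  assumes "multihomogeneous gr d f" "y \<in> orbit gr x"
  shows "eval y f = 0 \<longleftrightarrow> eval x f = 0"
proof -
  obtain c where c: "y = (\<lambda>v. c (gr v) * x v)" "\<forall>i. c i \<noteq> 0" using assms(2) unfolding orbit_def by blast
  have e: "eval y f = (\<Prod>i\<in>range gr. c i ^ d i) * eval x f"
    unfolding c(1) by (rule eval_homogeneous[OF assms(1)])
  have nz: "(\<Prod>i\<in>range gr. c i ^ d i) \<noteq> 0" using c(2) by simp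
  show ?thesis by (simp only: e mult_eq_0_iff nz simp_thms)
qed

lemma openin_zariski:
  "openin (zariski gr) S \<longleftrightarrow> (\<exists>F. (\<forall>f\<in>F. \<exists>d. multihomogeneous gr d f) \<and>
     S = {P \<in> (multiproj gr :: ('v::finite, 'k::field) point set). \<exists>f\<in>F. \<forall>x\<in>P. eval x f \<noteq> 0})"
  unfolding zariski_def by (simp add: topology_inverse'[OF istopology_zariski])

definition basic_open :: "('v::finite \<Rightarrow> 'i) \<Rightarrow> ('v, 'k::field) mpoly \<Rightarrow> ('v, 'k) point set" where
  "basic_open gr h = {P \<in> multiproj gr. \<forall>x\<in>P. eval x h \<noteq> 0}"

lemma openin_basic_open: "multihomogeneous gr d h \<Longrightarrow> openin (zariski gr) (basic_open gr h)"
  unfolding openin_zariski basic_open_def by (intro exI[of _ "{h}"]) auto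

lemma basic_open_mem:
  assumes "multihomogeneous gr d h" "P \<in> multiproj gr" "x \<in> P" "eval x h \<noteq> 0"
  shows "P \<in> basic_open gr h"
proof -
  have P: "P = orbit gr x" by (rule multiprojE(1)[OF assms(2,3)])
  have "eval y h \<noteq> 0" if "y \<in> P" for y
    using eval_orbit[OF assms(1), of y x] that assms(4) unfolding P by simp
  then show ?thesis using assms(2) unfolding basic_open_def by blast
qed

lemma topspace_zariski: "topspace (zariski gr) = (multiproj gr :: ('v::finite, 'k::field) point set)"
proof
  show "topspace (zariski gr) \<subseteq> (multiproj gr :: ('v, 'k) point set)"
    using openin_topspace[of "zariski gr :: ('v, 'k) point topology"] unfolding openin_zariski by auto
  have eq: "basic_open gr 1 = (multiproj gr :: ('v, 'k) point set)" by (simp add: basic_open_def)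
  show "(multiproj gr :: ('v, 'k) point set) \<subseteq> topspace (zariski gr)"
    unfolding eq[symmetric] by (rule openin_subset[OF openin_basic_open[OF multihomogeneous_one]])
qed

lemma topspace_variety: "Y \<subseteq> multiproj gr \<Longrightarrow> topspace (variety_space gr Y) = Y"
  by (auto simp: variety_space_def topspace_zariski)

lemma openin_variety: "openin (variety_space gr Y) W \<longleftrightarrow> (\<exists>T. openin (zariski gr) T \<and> W = T \<inter> Y)"
  by (simp add: variety_space_def openin_subtopology)

text \<open>Locally, every coordinate vector of a point must be sent by the polynomials
  \<open>F\<close> to some coordinate vector of the image. Within a block of the target all
  \<open>F w\<close> have the same multidegree \<open>D\<close>, which makes pullbacks
  multihomogeneous.\<close>

definition morphism :: "('v::finite \<Rightarrow> 'i) \<Rightarrow> ('v, 'k::field) point set \<Rightarrow>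
    ('w::finite \<Rightarrow> 'j) \<Rightarrow> ('w, 'k) point set \<Rightarrow> (('v, 'k) point \<Rightarrow> ('w, 'k) point) \<Rightarrow> bool" where
  "morphism gr Y gr' Y' \<phi> \<longleftrightarrow> Y \<subseteq> multiproj gr \<and> Y' \<subseteq> multiproj gr' \<and> (\<forall>P\<in>Y. \<phi> P \<in> Y') \<and>
     (\<forall>P\<in>Y. \<exists>h d F D. multihomogeneous gr d h \<and> (\<forall>w. multihomogeneous gr (D (gr' w)) (F w)) \<and>
        P \<in> basic_open gr h \<and>
        (\<forall>Q\<in>Y \<inter> basic_open gr h. \<forall>x\<in>Q. (\<lambda>w. eval x (F w)) \<in> \<phi> Q))"

lemma morphismD:
  assumes "morphism gr Y gr' Y' \<phi>" "P \<in> Y"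
  shows "\<exists>h d F D. multihomogeneous gr d h \<and> (\<forall>w. multihomogeneous gr (D (gr' w)) (F w)) \<and>
    P \<in> basic_open gr h \<and> (\<forall>Q\<in>Y \<inter> basic_open gr h. \<forall>x\<in>Q. (\<lambda>w. eval x (F w)) \<in> \<phi> Q)"
  using assms unfolding morphism_def by blast

text \<open>Near \<open>P\<close> the preimage contains the set where \<open>h\<close> and the
  pullback of some equation \<open>f\<close> are nonzero.\<close>

lemma morphism_open_preimage:
  assumes m: "morphism gr Y gr' Y' \<phi>" and S: "openin (variety_space gr' Y') S"
  shows "openin (variety_space gr Y) {P \<in> Y. \<phi> P \<in> S}"
proof (subst openin_subopen, intro ballI)
  fix P assume "P \<in> {P \<in> Y. \<phi> P \<in> S}"
  then have P: "P \<in> Y" "\<phi> P \<in> S" by auto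
  have Y: "Y \<subseteq> multiproj gr" "Y' \<subseteq> multiproj gr'" "\<And>P. P \<in> Y \<Longrightarrow> \<phi> P \<in> Y'" using m by (auto simp: morphism_def)
  obtain E where E: "\<And>f. f \<in> E \<Longrightarrow> \<exists>d. multihomogeneous gr' d f"
    "S = {P \<in> multiproj gr'. \<exists>f\<in>E. \<forall>x\<in>P. eval x f \<noteq> 0} \<inter> Y'"
    using S unfolding openin_variety openin_zariski by blast
  then obtain f where f: "f \<in> E" "\<And>x. x \<in> \<phi> P \<Longrightarrow> eval x f \<noteq> 0" using P(2) by blast
  obtain e where e: "multihomogeneous gr' e f" using E(1)[OF f(1)] by blast
  from morphismD[OF m P(1)] obtain h d F D where h: "multihomogeneous gr d h"
    and F': "\<forall>w. multihomogeneous gr (D (gr' w)) (F w)" and Ph: "P \<in> basic_open gr h"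
    and \<phi>': "\<forall>Q\<in>Y \<inter> basic_open gr h. \<forall>x\<in>Q. (\<lambda>w. eval x (F w)) \<in> \<phi> Q"
    by (elim exE conjE)
  from F' have F: "multihomogeneous gr (D (gr' w)) (F w)" for w by (rule spec)
  from \<phi>' have \<phi>: "(\<lambda>w. eval x (F w)) \<in> \<phi> Q" if "Q \<in> Y" "Q \<in> basic_open gr h" "x \<in> Q" for Q x
    using that by (simp only: Int_iff Ball_def simp_thms)
  have sf: "multihomogeneous gr (\<lambda>i. \<Sum>j\<in>range gr'. e j * D j i) (subst F f)"
    by (rule multihomogeneous_subst[of gr D gr' F, OF F e])
  let ?W = "basic_open gr h \<inter> basic_open gr (subst F f) \<inter> Y"
  have "openin (variety_space gr Y) ?W"
    unfolding openin_variety using openin_Int[OF openin_basic_open[OF h] openin_basic_open[OF sf]] by blast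
  moreover have "P \<in> ?W"
    using P Ph \<phi>[OF P(1) Ph] f(2) Y(1) by (auto simp: basic_open_def eval_subst)
  moreover have "?W \<subseteq> {P \<in> Y. \<phi> P \<in> S}"
  proof
    fix Q assume Q: "Q \<in> ?W"
    then have QY: "Q \<in> Y" "Q \<in> basic_open gr h" by auto
    obtain x where x: "x \<in> Q" using multiproj_nonempty QY(1) Y(1) by blast
    let ?z = "\<lambda>w. eval x (F w)"
    have z: "?z \<in> \<phi> Q" by (rule \<phi>[OF QY x])
    have mp: "\<phi> Q \<in> multiproj gr'" using Y QY(1) by blast
    have "eval ?z f \<noteq> 0" using Q x by (auto simp: basic_open_def eval_subst)
    then have "\<phi> Q \<in> basic_open gr' f" by (rule basic_open_mem[OF e mp z])
    then have "\<phi> Q \<in> S" unfolding E(2) using f(1) Y(3)[OF QY(1)] by (auto simp: basic_open_def)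
    then show "Q \<in> {P \<in> Y. \<phi> P \<in> S}" using QY(1) by simp
  qed
  ultimately show "\<exists>T. openin (variety_space gr Y) T \<and> P \<in> T \<and> T \<subseteq> {P \<in> Y. \<phi> P \<in> S}"
    by (intro exI[of _ ?W] conjI)
qed

text \<open>Numerator and denominator of a local fraction are pulled back along the same
  \<open>F\<close> and so again have equal multidegree.\<close>

lemma morphism_regular:
  assumes m: "morphism gr Y gr' Y' \<phi>" and k: "regular_on gr' Y' S k"
  shows "regular_on gr Y {P \<in> Y. \<phi> P \<in> S} (k \<circ> \<phi>)"
  unfolding regular_on_def
proof
  fix P assume "P \<in> {P \<in> Y. \<phi> P \<in> S}"
  then have P: "P \<in> Y" "\<phi> P \<in> S" by auto
  from k[unfolded regular_on_def, THEN bspec, OF P(2)]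
  obtain W a b e where W: "openin (variety_space gr' Y') W" "\<phi> P \<in> W" "W \<subseteq> S"
    and a: "multihomogeneous gr' e a" and b: "multihomogeneous gr' e b"
    and ab: "\<forall>Q\<in>W. \<forall>x\<in>Q. eval x b \<noteq> 0 \<and> k Q = eval x a / eval x b"
    by (elim exE conjE)
  from morphismD[OF m P(1)] obtain h d F D where h: "multihomogeneous gr d h"
    and F': "\<forall>w. multihomogeneous gr (D (gr' w)) (F w)" and Ph: "P \<in> basic_open gr h"
    and \<phi>': "\<forall>Q\<in>Y \<inter> basic_open gr h. \<forall>x\<in>Q. (\<lambda>w. eval x (F w)) \<in> \<phi> Q"
    by (elim exE conjE)
  from F' have F: "multihomogeneous gr (D (gr' w)) (F w)" for w by (rule spec)
  from \<phi>' have \<phi>: "(\<lambda>w. eval x (F w)) \<in> \<phi> Q" if "Q \<in> Y" "Q \<in> basic_open gr h" "x \<in> Q" for Q x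
    using that by (simp only: Int_iff Ball_def simp_thms)
  let ?W = "(basic_open gr h \<inter> Y) \<inter> {P \<in> Y. \<phi> P \<in> W}"
  show "\<exists>W. openin (variety_space gr Y) W \<and> P \<in> W \<and> W \<subseteq> {P \<in> Y. \<phi> P \<in> S} \<and>
     (\<exists>a b d. multihomogeneous gr d a \<and> multihomogeneous gr d b \<and>
       (\<forall>Q\<in>W. \<forall>x\<in>Q. eval x b \<noteq> 0 \<and> (k \<circ> \<phi>) Q = eval x a / eval x b))"
  proof (intro exI conjI)
    have "openin (variety_space gr Y) (basic_open gr h \<inter> Y)"
      unfolding openin_variety using openin_basic_open[OF h] by blast
    then show "openin (variety_space gr Y) ?W" by (rule openin_Int[OF _ morphism_open_preimage[OF m W(1)]])
    show "P \<in> ?W" using P Ph W(2) by blast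
    show "?W \<subseteq> {P \<in> Y. \<phi> P \<in> S}" using W(3) by blast
    show "multihomogeneous gr (\<lambda>i. \<Sum>j\<in>range gr'. e j * D j i) (subst F a)"
      by (rule multihomogeneous_subst[of gr D gr' F, OF F a])
    show "multihomogeneous gr (\<lambda>i. \<Sum>j\<in>range gr'. e j * D j i) (subst F b)"
      by (rule multihomogeneous_subst[of gr D gr' F, OF F b])
    show "\<forall>Q\<in>?W. \<forall>x\<in>Q. eval x (subst F b) \<noteq> 0 \<and> (k \<circ> \<phi>) Q = eval x (subst F a) / eval x (subst F b)"
    proof (intro ballI)
      fix Q x assume Q: "Q \<in> ?W" "x \<in> Q"
      then have "(\<lambda>w. eval x (F w)) \<in> \<phi> Q" "\<phi> Q \<in> W" using \<phi> by auto
      from ab[THEN bspec, OF this(2), THEN bspec, OF this(1)]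
      show "eval x (subst F b) \<noteq> 0 \<and> (k \<circ> \<phi>) Q = eval x (subst F a) / eval x (subst F b)"
        by (simp add: eval_subst)
    qed
  qed
qed

lemma regular_on_cong:
  assumes "\<And>P. P \<in> S \<Longrightarrow> h P = k P" "regular_on gr Y S h"
  shows "regular_on gr Y S k"
  unfolding regular_on_def
proof
  fix P assume "P \<in> S"
  from assms(2)[unfolded regular_on_def, THEN bspec, OF this]
  obtain W a b d where W: "openin (variety_space gr Y) W" "P \<in> W" "W \<subseteq> S"
    and ab: "multihomogeneous gr d a" "multihomogeneous gr d b"
      "\<forall>Q\<in>W. \<forall>x\<in>Q. eval x b \<noteq> 0 \<and> h Q = eval x a / eval x b"
    by (elim exE conjE)
  have "\<forall>Q\<in>W. \<forall>x\<in>Q. eval x b \<noteq> 0 \<and> k Q = eval x a / eval x b"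
  proof (intro ballI)
    fix Q x assume "Q \<in> W" "x \<in> Q"
    then show "eval x b \<noteq> 0 \<and> k Q = eval x a / eval x b" using ab(3) W(3) assms(1)[of Q] by auto
  qed
  with W ab(1,2) show "\<exists>W. openin (variety_space gr Y) W \<and> P \<in> W \<and> W \<subseteq> S \<and>
     (\<exists>a b d. multihomogeneous gr d a \<and> multihomogeneous gr d b \<and>
       (\<forall>Q\<in>W. \<forall>x\<in>Q. eval x b \<noteq> 0 \<and> k Q = eval x a / eval x b))" by (intro exI conjI)
qed

text \<open>That regularity of \<open>h \<circ> \<phi>\<close> implies regularity of
  \<open>h\<close> follows by pulling back along \<open>\<psi>\<close>; the functions
  \<open>h \<circ> \<phi> \<circ> \<psi>\<close> and \<open>h\<close> agree only on
  \<open>Y'\<close>, hence the passage through \<open>regular_on_cong\<close>.\<close>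

lemma isomorphic_varietiesI:
  assumes \<phi>: "morphism gr Y gr' Y' \<phi>" and \<psi>: "morphism gr' Y' gr Y \<psi>"
    and inv: "\<And>P. P \<in> Y \<Longrightarrow> \<psi> (\<phi> P) = P" "\<And>P. P \<in> Y' \<Longrightarrow> \<phi> (\<psi> P) = P"
  shows "isomorphic_varieties gr Y gr' Y'"
  unfolding isomorphic_varieties_def
proof (intro exI conjI allI impI)
  have Y: "Y \<subseteq> multiproj gr" "Y' \<subseteq> multiproj gr'" "\<And>P. P \<in> Y \<Longrightarrow> \<phi> P \<in> Y'" "\<And>P. P \<in> Y' \<Longrightarrow> \<psi> P \<in> Y"
    using \<phi> \<psi> by (auto simp: morphism_def)
  have "continuous_map (variety_space gr Y) (variety_space gr' Y') \<phi>"
    unfolding continuous_map_def topspace_variety[OF Y(1)] topspace_variety[OF Y(2)]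
    using morphism_open_preimage[OF \<phi>] Y(3) by auto
  moreover have "continuous_map (variety_space gr' Y') (variety_space gr Y) \<psi>"
    unfolding continuous_map_def topspace_variety[OF Y(1)] topspace_variety[OF Y(2)]
    using morphism_open_preimage[OF \<psi>] Y(4) by auto
  ultimately have "homeomorphic_maps (variety_space gr Y) (variety_space gr' Y') \<phi> \<psi>"
    unfolding homeomorphic_maps_def topspace_variety[OF Y(1)] topspace_variety[OF Y(2)] using inv by simp
  then show "homeomorphic_map (variety_space gr Y) (variety_space gr' Y') \<phi>" by (rule homeomorphic_maps_imp_map)
  fix S h assume "openin (variety_space gr' Y') S"
  then have SY: "S \<subseteq> Y'" by (auto simp: openin_variety)
  show "regular_on gr' Y' S h = regular_on gr Y {P \<in> Y. \<phi> P \<in> S} (h \<circ> \<phi>)"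
  proof
    assume "regular_on gr' Y' S h"
    then show "regular_on gr Y {P \<in> Y. \<phi> P \<in> S} (h \<circ> \<phi>)" by (rule morphism_regular[OF \<phi>])
  next
    assume "regular_on gr Y {P \<in> Y. \<phi> P \<in> S} (h \<circ> \<phi>)"
    from morphism_regular[OF \<psi> this]
    have "regular_on gr' Y' {Q \<in> Y'. \<psi> Q \<in> {P \<in> Y. \<phi> P \<in> S}} ((h \<circ> \<phi>) \<circ> \<psi>)" .
    moreover have "{Q \<in> Y'. \<psi> Q \<in> {P \<in> Y. \<phi> P \<in> S}} = S" using SY inv(2) Y(4) by auto
    ultimately have "regular_on gr' Y' S ((h \<circ> \<phi>) \<circ> \<psi>)" by simp
    then show "regular_on gr' Y' S h" by (rule regular_on_cong[rotated]) (use SY inv(2) in auto)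
  qed
qed

section \<open>Rational points of the components\<close>

lemma linked_line: "linked (range (\<lambda>c v. c * x v :: 'k::field))"
proof -
  have "range (\<lambda>c v. c * x v) = range (\<lambda>(a :: unit \<Rightarrow> 'k) v. eval a (const (x v) * var ()))"
  proof (intro equalityI subsetI)
    fix y assume "y \<in> range (\<lambda>c v. c * x v)"
    then obtain c where "y = (\<lambda>v. c * x v)" by blast
    then show "y \<in> range (\<lambda>(a :: unit \<Rightarrow> 'k) v. eval a (const (x v) * var ()))"
      by (intro range_eqI[of _ _ "\<lambda>_. c"]) (simp add: eval_simps mult.commute)
  next
    fix y assume "y \<in> range (\<lambda>(a :: unit \<Rightarrow> 'k) v. eval a (const (x v) * var ()))"
    then obtain a :: "unit \<Rightarrow> 'k" where "y = (\<lambda>v. eval a (const (x v) * var ()))" by blast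
    then show "y \<in> range (\<lambda>c v. c * x v)"
      by (intro range_eqI[of _ _ "a ()"]) (simp add: eval_simps mult.commute)
  qed
  then show ?thesis by (simp only: linked_range)
qed

text \<open>The orbit is the line without the origin. Only the full line is covered by
  \<open>linked_line\<close>, which makes the vanishing ideal prime.\<close>

lemma Van_orbit:
  fixes x :: "'v::finite \<Rightarrow> 'k::field_char_0"
  shows "Van (orbit std_grading x) = Van (range (\<lambda>c v. c * x v))"
proof
  have "orbit std_grading x \<subseteq> range (\<lambda>c v. c * x v)" by (auto simp: orbit_def std_grading_def)
  then show "Van (range (\<lambda>c v. c * x v)) \<subseteq> Van (orbit std_grading x)" by (rule Van_antimono)
  show "Van (orbit std_grading x) \<subseteq> Van (range (\<lambda>c v. c * x v))"
  proof
    fix f assume f: "f \<in> Van (orbit std_grading x)"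
    obtain p where p: "\<And>t. poly p t = eval (\<lambda>v. poly [:0, x v:] t) f" using eval_path[of "\<lambda>v. [:0, x v:]"] by blast
    have "eval (\<lambda>v. t * x v) f = 0" if "t \<noteq> 0" for t
      using f that unfolding Van_def orbit_def std_grading_def by (auto intro: exI[of _ "\<lambda>_. t"])
    \<comment> \<open>The factor \<open>t\<close> settles the missing value
      \<open>t = 0\<close>.\<close>
    then have "poly ([:0, 1:] * p) t = 0" for t by (cases "t = 0") (simp_all add: p)
    then have "[:0, 1:] * p = 0" using poly_all_0_iff_0[of "[:0, 1:] * p"] by blast
    then have "p = 0" by simp
    then have "eval (\<lambda>v. t * x v) f = 0" for t using p[of t] by simp
    then show "f \<in> Van (range (\<lambda>c v. c * x v))" by (auto simp: Van_def)
  qed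
qed

lemma point_ideal_orbit:
  fixes x :: "'v::finite \<Rightarrow> 'k::field_char_0"
  shows "point_ideal (orbit std_grading x) = Van (orbit std_grading x)"
proof -
  have "conical (orbit std_grading x)"
    unfolding conical_def
  proof (intro ballI allI impI)
    fix y :: "'v \<Rightarrow> 'k" and c :: 'k
    assume y: "y \<in> orbit std_grading x" and "c \<noteq> 0"
    then have "(\<lambda>v. c * y v) \<in> orbit std_grading y" unfolding orbit_def by (auto intro!: exI[of _ "\<lambda>_. c"])
    then show "(\<lambda>v. c * y v) \<in> orbit std_grading x" using orbit_eq[OF y] by simp
  qed
  then have "Van (orbit std_grading x) = ideal_gen {f \<in> Van (orbit std_grading x). \<exists>n. homogeneous n f}"
    using homogeneous_ideal_Van unfolding homogeneous_ideal_def by blast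
  also have "{f \<in> Van (orbit std_grading x). \<exists>n. homogeneous n f} =
      {f. (\<exists>n. homogeneous n f) \<and> (\<forall>y\<in>orbit std_grading x. eval y f = 0)}" by (auto simp: Van_def)
  finally show ?thesis by (simp only: point_ideal_def)
qed

lemma valid_std: "valid std_grading x \<longleftrightarrow> (\<exists>v. x v \<noteq> 0)"
  unfolding valid_def range_std_grading by (simp add: std_grading_def)

text \<open>The prime of a rational point contains \<open>Van X\<close> exactly if the point lies in
  the Zariski closure of \<open>X\<close>, which is \<open>X\<close> by the second
  assumption.\<close>

lemma variety_of_Van:
  fixes X :: "('v::finite \<Rightarrow> 'k::field_char_0) set"
  assumes con: "conical X" and closed: "\<And>x. x \<notin> X \<Longrightarrow> \<exists>f\<in>Van X. eval x f \<noteq> 0"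
  shows "variety_of (\<V> (Van X)) = orbit std_grading ` {x \<in> X. \<exists>v. x v \<noteq> 0}"
proof -
  have "point_ideal (orbit std_grading x) \<in> \<V> (Van X) \<longleftrightarrow> x \<in> X" if x: "x v \<noteq> 0" for x v
  proof -
    have "conical (range (\<lambda>c v. c * x v))"
      unfolding conical_def by (auto intro!: range_eqI[of _ _ "_ * _"] simp: mult.assoc)
    moreover have "x \<in> range (\<lambda>c v. c * x v)" by (rule range_eqI[of _ _ 1]) simp
    ultimately have "Van (orbit std_grading x) \<in> Proj" unfolding Van_orbit
      using Van_in_Proj[OF linked_line] x by blast
    moreover have "Van X \<subseteq> Van (orbit std_grading x) \<longleftrightarrow> x \<in> X"
    proof
      assume sub: "Van X \<subseteq> Van (orbit std_grading x)"
      show "x \<in> X"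
      proof (rule ccontr)
        assume "x \<notin> X"
        then obtain f where "f \<in> Van X" "eval x f \<noteq> 0" using closed by blast
        then show False using sub orbit_self[of x std_grading] by (auto simp: Van_def)
      qed
    next
      assume "x \<in> X"
      then have "orbit std_grading x \<subseteq> X" using con by (auto simp: conical_def orbit_def)
      then show "Van X \<subseteq> Van (orbit std_grading x)" by (rule Van_antimono)
    qed
    ultimately show ?thesis by (simp add: point_ideal_orbit vanishing_locus_def)
  qed
  then show ?thesis unfolding variety_of_def multiproj_eq valid_std by auto
qed

text \<open>On points the isomorphism is induced by \<open>\<pi>\<close>. The hypotheses supply what
  remains: \<open>nonzero\<close> that images are points, \<open>inj\<close> that fibres are single
  orbits, and \<open>local_inverse\<close> polynomial sections near every point, which need to
  invert \<open>\<pi>\<close> only up to a scalar.\<close>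

lemma isomorphic_param:
  fixes \<pi> :: "'v::finite \<Rightarrow> ('w::finite, 'k::field_char_0) mpoly" and gr :: "'w \<Rightarrow> 'i"
  assumes \<pi>: "\<And>v. multihomogeneous gr (\<lambda>_. 1) (\<pi> v)"
    and X: "X = range (\<lambda>a v. eval a (\<pi> v))"
    and closed: "\<And>x. x \<notin> X \<Longrightarrow> \<exists>f\<in>Van X. eval x f \<noteq> 0"
    and nonzero: "\<And>a. valid gr a \<Longrightarrow> \<exists>v. eval a (\<pi> v) \<noteq> 0"
    and local_inverse: "\<And>x v. x \<in> X \<Longrightarrow> x v \<noteq> 0 \<Longrightarrow> \<exists>h n F e. homogeneous n h \<and> (\<forall>w. homogeneous (e (gr w)) (F w)) \<and>
      eval x h \<noteq> 0 \<and> (\<forall>y\<in>X. eval y h \<noteq> 0 \<longrightarrow> valid gr (\<lambda>w. eval y (F w)) \<and>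
        (\<exists>c. c \<noteq> 0 \<and> (\<forall>v. eval (\<lambda>w. eval y (F w)) (\<pi> v) = c * y v)))"
    and inj: "\<And>a b c. valid gr a \<Longrightarrow> valid gr b \<Longrightarrow> c \<noteq> 0 \<Longrightarrow>
      (\<And>v. eval b (\<pi> v) = c * eval a (\<pi> v)) \<Longrightarrow> b \<in> orbit gr a"
  shows "isomorphic_varieties std_grading (variety_of (\<V> (Van X))) gr (multiproj gr)"
proof -
  define par where "par a = (\<lambda>v. eval a (\<pi> v))" for a
  define Z where "Z = orbit std_grading ` {x \<in> X. \<exists>v. x v \<noteq> 0}"
  have con: "conical X" using conical_face[OF \<pi>, where S = UNIV] by (simp add: X face_UNIV)
  have vZ: "variety_of (\<V> (Van X)) = Z" unfolding Z_def by (rule variety_of_Van[OF con closed])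
  have ZE: "y \<in> X \<and> (\<exists>v. y v \<noteq> 0) \<and> Q = orbit std_grading y" if QZ: "Q \<in> Z" and yQ: "y \<in> Q" for Q y
  proof -
    obtain x where x: "x \<in> X" "\<exists>v. x v \<noteq> 0" "Q = orbit std_grading x" using QZ unfolding Z_def by blast
    then have "valid std_grading y" using yQ valid_orbit[of std_grading x y] by (simp add: valid_std)
    moreover have "y \<in> X" using yQ con x(1) unfolding x(3) by (auto simp: conical_def orbit_def)
    ultimately show ?thesis using orbit_eq[of y std_grading x] yQ x(3) by (simp add: valid_std)
  qed
  have Zsub: "Z \<subseteq> multiproj std_grading" unfolding Z_def multiproj_eq valid_std by blast
  have par_orbit: "orbit std_grading (par b) = orbit std_grading (par a)" if "b \<in> orbit gr a" for a b
  proof -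
    obtain c where c: "b = (\<lambda>w. c (gr w) * a w)" "\<forall>i. c i \<noteq> 0" using \<open>b \<in> orbit gr a\<close> unfolding orbit_def by blast
    have "par b = (\<lambda>v. (\<Prod>i\<in>range gr. c i ^ 1) * par a v)"
      unfolding c(1) par_def by (rule ext, rule eval_homogeneous[OF \<pi>])
    moreover have "(\<Prod>i\<in>range gr. c i ^ 1) \<noteq> 0" using c(2) by simp
    ultimately have "par b \<in> orbit std_grading (par a)"
      unfolding orbit_def by (intro CollectI exI[of _ "\<lambda>_. \<Prod>i\<in>range gr. c i ^ 1"] conjI allI)
    then show ?thesis by (rule orbit_eq)
  qed
  have par_inj: "b \<in> orbit gr a" if "valid gr a" "valid gr b" "orbit std_grading (par b) = orbit std_grading (par a)" for a b
  proof -
    have "par b \<in> orbit std_grading (par a)" using that(3) orbit_self by blast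
    then obtain c where c: "par b = (\<lambda>v. c (std_grading v) * par a v)" "\<forall>i. c i \<noteq> 0" unfolding orbit_def by blast
    show ?thesis
    proof (rule inj[OF that(1,2), of "c ()"])
      show "eval b (\<pi> v) = c () * eval a (\<pi> v)" for v
        using fun_cong[OF c(1), of v] by (simp add: par_def)
    qed (simp add: c(2))
  qed
  \<comment> \<open>Both maps select a representative by choice; \<open>par_orbit\<close> and
    \<open>par_inj\<close> show that the results do not depend on it.\<close>
  define \<psi> where "\<psi> P = orbit std_grading (par (SOME a. a \<in> P))" for P
  define \<phi> where "\<phi> Q = orbit gr (SOME a. valid gr a \<and> orbit std_grading (par a) = Q)" for Q
  have \<psi>: "\<psi> (orbit gr a) = orbit std_grading (par a)" for a
  proof -
    have "(SOME b. b \<in> orbit gr a) \<in> orbit gr a" by (rule someI[of _ a]) (rule orbit_self)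
    then show ?thesis unfolding \<psi>_def by (rule par_orbit)
  qed
  have \<phi>: "\<phi> (orbit std_grading (par b)) = orbit gr b" if b: "valid gr b" for b
  proof -
    let ?a = "SOME a. valid gr a \<and> orbit std_grading (par a) = orbit std_grading (par b)"
    have a: "valid gr ?a \<and> orbit std_grading (par ?a) = orbit std_grading (par b)"
      by (rule someI[of _ b]) (simp add: b)
    then have "?a \<in> orbit gr b" by (intro par_inj b) auto
    then show ?thesis unfolding \<phi>_def by (rule orbit_eq)
  qed
  have sec: "\<exists>h n F e. homogeneous n h \<and> (\<forall>w. homogeneous (e (gr w)) (F w)) \<and> eval x h \<noteq> 0 \<and>
      (\<forall>y\<in>X. eval y h \<noteq> 0 \<longrightarrow> valid gr (\<lambda>w. eval y (F w)) \<and>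
        orbit std_grading (par (\<lambda>w. eval y (F w))) = orbit std_grading y)" if x: "x \<in> X" "\<exists>v. x v \<noteq> 0" for x
  proof -
    obtain v where "x v \<noteq> 0" using x(2) by blast
    from local_inverse[OF x(1) this] obtain h n F e where
      hF: "homogeneous n h" "\<forall>w. homogeneous (e (gr w)) (F w)" "eval x h \<noteq> 0"
      "\<forall>y\<in>X. eval y h \<noteq> 0 \<longrightarrow> valid gr (\<lambda>w. eval y (F w)) \<and>
        (\<exists>c. c \<noteq> 0 \<and> (\<forall>v. eval (\<lambda>w. eval y (F w)) (\<pi> v) = c * y v))" by (elim exE conjE)
    have "\<forall>y\<in>X. eval y h \<noteq> 0 \<longrightarrow> valid gr (\<lambda>w. eval y (F w)) \<and>
        orbit std_grading (par (\<lambda>w. eval y (F w))) = orbit std_grading y"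
    proof (intro ballI impI conjI)
      fix y assume y: "y \<in> X" "eval y h \<noteq> 0"
      from hF(4)[rule_format, OF y] obtain c where c: "valid gr (\<lambda>w. eval y (F w))" "c \<noteq> 0"
        "\<And>v. eval (\<lambda>w. eval y (F w)) (\<pi> v) = c * y v" by blast
      show "valid gr (\<lambda>w. eval y (F w))" by (rule c(1))
      have "par (\<lambda>w. eval y (F w)) \<in> orbit std_grading y"
        unfolding par_def orbit_def by (intro CollectI exI[of _ "\<lambda>_. c"] conjI allI c(2) ext c(3))
      then show "orbit std_grading (par (\<lambda>w. eval y (F w))) = orbit std_grading y" by (rule orbit_eq)
    qed
    with hF(1-3) show ?thesis by (intro exI conjI)
  qed
  have \<psi>Z: "\<psi> P \<in> Z" if "P \<in> multiproj gr" for P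
  proof -
    obtain a where a: "P = orbit gr a" "valid gr a" using \<open>P \<in> multiproj gr\<close> unfolding multiproj_eq by blast
    show ?thesis unfolding a(1) \<psi> Z_def using nonzero[OF a(2)] by (auto simp: X par_def)
  qed
  have pre: "\<exists>b. valid gr b \<and> Q = orbit std_grading (par b)" if Q: "Q \<in> Z" for Q
  proof -
    obtain x where x: "x \<in> X" "\<exists>v. x v \<noteq> 0" "Q = orbit std_grading x" using Q unfolding Z_def by blast
    from sec[OF x(1,2)] show ?thesis using x(1,3) by metis
  qed
  have inv1: "\<psi> (\<phi> Q) = Q" if "Q \<in> Z" for Q
    using pre[OF that] \<phi> \<psi> by auto
  have inv2: "\<phi> (\<psi> P) = P" if "P \<in> multiproj gr" for P
  proof -
    obtain a where a: "P = orbit gr a" "valid gr a" using \<open>P \<in> multiproj gr\<close> unfolding multiproj_eq by blast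
    show ?thesis unfolding a(1) \<psi> by (rule \<phi>[OF a(2)])
  qed
  have \<phi>m: "\<phi> Q \<in> multiproj gr" if "Q \<in> Z" for Q
    using pre[OF that] \<phi> unfolding multiproj_eq by auto
  have mor\<psi>: "morphism gr (multiproj gr) std_grading Z \<psi>"
    unfolding morphism_def
  proof (intro conjI ballI \<psi>Z Zsub subset_refl)
    fix P :: "('w, 'k) point" assume P: "P \<in> multiproj gr"
    show "\<exists>h d F D. multihomogeneous gr d h \<and>
        (\<forall>v. multihomogeneous gr (D (std_grading v)) (F v)) \<and> P \<in> basic_open gr h \<and>
        (\<forall>Q\<in>multiproj gr \<inter> basic_open gr h. \<forall>x\<in>Q. (\<lambda>v. eval x (F v)) \<in> \<psi> Q)"
    proof (rule exI[of _ 1], rule exI[of _ "\<lambda>_. 0"], rule exI[of _ \<pi>], rule exI[of _ "\<lambda>_ _. 1"], intro conjI allI ballI)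
      show "multihomogeneous gr (\<lambda>_. 0) (1 :: ('w, 'k) mpoly)" by (rule multihomogeneous_one)
      show "multihomogeneous gr (\<lambda>_. 1) (\<pi> v)" for v by (rule \<pi>)
      show "P \<in> basic_open gr 1" using P by (simp add: basic_open_def)
      fix Q and a :: "'w \<Rightarrow> 'k" assume "Q \<in> multiproj gr \<inter> basic_open gr 1" "a \<in> Q"
      then have "Q = orbit gr a" using multiprojE(1)[of Q gr a] by simp
      then show "(\<lambda>v. eval a (\<pi> v)) \<in> \<psi> Q" using \<psi>[of a] orbit_self[of "par a"] by (simp add: par_def)
    qed
  qed
  have mor\<phi>: "morphism std_grading Z gr (multiproj gr) \<phi>"
    unfolding morphism_def
  proof (intro conjI ballI \<phi>m Zsub subset_refl)
    fix P assume P: "P \<in> Z"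
    then obtain x where x: "x \<in> P" using multiproj_nonempty Zsub by blast
    from ZE[OF P x] have "x \<in> X" "\<exists>v. x v \<noteq> 0" by auto
    from sec[OF this] obtain h n F e where
      hF: "homogeneous n h" "\<forall>w. homogeneous (e (gr w)) (F w)" "eval x h \<noteq> 0"
      "\<forall>y\<in>X. eval y h \<noteq> 0 \<longrightarrow> valid gr (\<lambda>w. eval y (F w)) \<and>
        orbit std_grading (par (\<lambda>w. eval y (F w))) = orbit std_grading y" by (elim exE conjE)
    show "\<exists>h d F D. multihomogeneous std_grading d h \<and>
        (\<forall>w. multihomogeneous std_grading (D (gr w)) (F w)) \<and> P \<in> basic_open std_grading h \<and>
        (\<forall>Q\<in>Z \<inter> basic_open std_grading h. \<forall>x\<in>Q. (\<lambda>w. eval x (F w)) \<in> \<phi> Q)"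
    proof (intro exI[of _ h] exI[of _ "\<lambda>_. n"] exI[of _ F] exI[of _ "\<lambda>i _. e i"] conjI allI ballI)
      show "homogeneous n h" by (rule hF(1))
      show "homogeneous (e (gr w)) (F w)" for w using hF(2) by blast
      show "P \<in> basic_open std_grading h"
        using P Zsub by (intro basic_open_mem[OF hF(1) _ x hF(3)]) auto
      fix Q and y :: "'v \<Rightarrow> 'k" assume Q: "Q \<in> Z \<inter> basic_open std_grading h" and y: "y \<in> Q"
      have yX: "y \<in> X" "Q = orbit std_grading y" using ZE[of Q y] Q y by auto
      have "eval y h \<noteq> 0" using Q y by (simp add: basic_open_def)
      from hF(4)[rule_format, OF yX(1) this]
      have "valid gr (\<lambda>w. eval y (F w))" "Q = orbit std_grading (par (\<lambda>w. eval y (F w)))" using yX(2) by auto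
      then show "(\<lambda>w. eval y (F w)) \<in> \<phi> Q" using \<phi> orbit_self by metis
    qed
  qed
  show ?thesis unfolding vZ by (rule isomorphic_varietiesI[OF mor\<phi> mor\<psi> inv1 inv2])
qed

lemma plane_isomorphic_to_P2:
  fixes X :: "('v::finite \<Rightarrow> 'k::field_char_0) set"
  assumes ch: "plane_chart L Y X" and closed: "\<And>x. x \<notin> X \<Longrightarrow> \<exists>f\<in>Van X. eval x f \<noteq> 0"
  shows "isomorphic_to_P2 (\<V> (Van X))"
proof -
  have L: "\<And>v. multihomogeneous std_grading (\<lambda>_. 1) (L v)" and X: "X = range (\<lambda>y v. eval y (L v))"
    and Y: "\<And>y w. eval (\<lambda>v. eval y (L v)) (Y w) = y w" "\<And>w. homogeneous 1 (Y w)"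
    using ch unfolding plane_chart_def by auto
  show ?thesis unfolding isomorphic_to_P2_def
  proof (rule isomorphic_param[OF L X closed])
    fix a :: "3 \<Rightarrow> 'k" assume "valid std_grading a"
    then obtain w where "a w \<noteq> 0" by (auto simp: valid_std)
    then have "eval (\<lambda>v. eval a (L v)) (Y w) \<noteq> 0" by (simp add: Y)
    then show "\<exists>v. eval a (L v) \<noteq> 0" by (rule homogeneous_one_nonzero[OF Y(2)])
  next
    fix x v assume x: "x \<in> X" "x v \<noteq> 0"
    then obtain y where y: "x = (\<lambda>v. eval y (L v))" unfolding X by blast
    with x(2) obtain w where w: "y w \<noteq> 0" using homogeneous_one_nonzero[OF L] by blast
    show "\<exists>h n F e. homogeneous n h \<and> (\<forall>w :: 3. homogeneous (e (std_grading w)) (F w)) \<and>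
      eval x h \<noteq> 0 \<and> (\<forall>y\<in>X. eval y h \<noteq> 0 \<longrightarrow> valid std_grading (\<lambda>w. eval y (F w)) \<and>
        (\<exists>c. c \<noteq> 0 \<and> (\<forall>v. eval (\<lambda>w. eval y (F w)) (L v) = c * y v)))"
    proof (intro exI[of _ "Y w"] exI[of _ 1] exI[of _ Y] exI[of _ "\<lambda>_. 1"] conjI allI ballI impI Y(2))
      show "eval x (Y w) \<noteq> 0" using w by (simp add: y Y)
      fix z assume "z \<in> X" "eval z (Y w) \<noteq> 0"
      then show "valid std_grading (\<lambda>w. eval z (Y w))" by (auto simp: valid_std)
      show "eval (\<lambda>w. eval z (Y w)) (L v) = 1 * z v" for v using \<open>z \<in> X\<close> by (auto simp: X Y)
    qed simp
  next
    fix a b :: "3 \<Rightarrow> 'k" and c assume "c \<noteq> 0" and eq: "\<And>v. eval b (L v) = c * eval a (L v)"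
    have "b w = c * a w" for w
    proof -
      have "b w = eval (\<lambda>v. c * eval a (L v)) (Y w)" using Y(1)[of b w] by (simp add: eq)
      also have "\<dots> = c * a w" by (simp add: eval_homogeneous_std[OF Y(2)] Y(1))
      finally show ?thesis .
    qed
    then show "b \<in> orbit std_grading a" using \<open>c \<noteq> 0\<close>
      unfolding orbit_def by (intro CollectI exI[of _ "\<lambda>_. c"]) auto
  qed
qed

lemma valid_fst: "valid (fst :: 2 \<times> 2 \<Rightarrow> 2) a \<longleftrightarrow> (\<exists>k. a (1, k) \<noteq> 0) \<and> (\<exists>l. a (2, l) \<noteq> 0)"
proof -
  have "range (fst :: 2 \<times> 2 \<Rightarrow> 2) = UNIV" by auto
  then show ?thesis by (simp add: valid_def forall_num2)
qed

lemma quadric_isomorphic_to_P1_P1: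
  fixes X :: "('v::finite \<Rightarrow> 'k::field_char_0) set"
  assumes ch: "quadric_chart L Y X" and closed: "\<And>x. x \<notin> X \<Longrightarrow> \<exists>f\<in>Van X. eval x f \<noteq> 0"
  shows "isomorphic_to_P1_P1 (\<V> (Van X))"
proof -
  have L: "\<And>v. homogeneous 1 (L v)"
    and Y: "\<And>y w. eval (\<lambda>v. eval y (L v)) (Y w) = y w" "\<And>w. homogeneous 1 (Y w)"
    using ch unfolding quadric_chart_def by auto
  have X: "X = range (\<lambda>a v. eval a (segre L v))" by (rule quadric_chart_range[OF ch])
  have \<pi>: "\<And>v. multihomogeneous fst (\<lambda>_. 1) (segre L v)" by (rule multihomogeneous_segre[OF L])
  have Y': "eval (\<lambda>v. eval a (segre L v)) (Y (k, l)) = a (1, k) * a (2, l)" for a k l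
    by (simp add: eval_segre Y)
  show ?thesis unfolding isomorphic_to_P1_P1_def
  proof (rule isomorphic_param[OF \<pi> X closed])
    fix a :: "2 \<times> 2 \<Rightarrow> 'k" assume "valid fst a"
    then obtain k l where "a (1, k) \<noteq> 0" "a (2, l) \<noteq> 0" by (auto simp: valid_fst)
    then have "eval (\<lambda>v. eval a (segre L v)) (Y (k, l)) \<noteq> 0" by (simp add: Y')
    then show "\<exists>v. eval a (segre L v) \<noteq> 0" by (rule homogeneous_one_nonzero[OF Y(2)])
  next
    fix x v assume x: "x \<in> X" "x v \<noteq> 0"
    then obtain y where y: "x = (\<lambda>v. eval y (segre L v))" unfolding X by blast
    then have "eval (\<lambda>(k, l). y (1, k) * y (2, l)) (L v) \<noteq> 0" using x(2) by (simp add: eval_segre)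
    then obtain k l where kl: "y (1, k) * y (2, l) \<noteq> 0" using homogeneous_one_nonzero[OF L] by fastforce
    \<comment> \<open>In a rank-one matrix column \<open>l\<close> is proportional to the first
      factor and row \<open>k\<close> to the second. They recover both factors where the entry
      \<open>Y (k, l)\<close> is nonzero, and multiplying them back gives the matrix times this
      entry.\<close>
    define F where "F = (\<lambda>(i :: 2, j). if i = 1 then Y (j, l) else Y (k, j))"
    have F: "homogeneous 1 (F w)" for w
      using Y(2)[of "(snd w, l)"] Y(2)[of "(k, snd w)"] by (simp add: F_def case_prod_unfold)
    show "\<exists>h n F e. homogeneous n h \<and> (\<forall>w :: 2 \<times> 2. homogeneous (e (fst w)) (F w)) \<and>
      eval x h \<noteq> 0 \<and> (\<forall>y\<in>X. eval y h \<noteq> 0 \<longrightarrow> valid fst (\<lambda>w. eval y (F w)) \<and>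
        (\<exists>c. c \<noteq> 0 \<and> (\<forall>v. eval (\<lambda>w. eval y (F w)) (segre L v) = c * y v)))"
    proof (rule exI[of _ "Y (k, l)"], rule exI[of _ 1], rule exI[of _ F], rule exI[of _ "\<lambda>_. 1"],
        intro conjI allI ballI impI Y(2) F)
      show "eval x (Y (k, l)) \<noteq> 0" using kl by (simp add: y Y')
      fix z assume "z \<in> X" and z: "eval z (Y (k, l)) \<noteq> 0"
      then obtain p where p: "z = (\<lambda>v. eval p (segre L v))" unfolding X by blast
      have F1: "eval z (F (1, j)) = p (1, j) * p (2, l)" and F2: "eval z (F (2, j)) = p (1, k) * p (2, j)" for j
        by (simp_all add: F_def p Y')
      have nz: "p (1, k) * p (2, l) \<noteq> 0" using z by (simp add: p Y')
      then show "valid fst (\<lambda>w. eval z (F w))" by (auto simp: valid_fst F1 F2)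
      have "\<forall>v. eval (\<lambda>w. eval z (F w)) (segre L v) = (p (1, k) * p (2, l)) * z v"
      proof
        fix v
        have "(\<lambda>(i, j). eval z (F (1, i)) * eval z (F (2, j))) =
            (\<lambda>w. (p (1, k) * p (2, l)) * (\<lambda>(i, j). p (1, i) * p (2, j)) w)"
          by (simp add: F1 F2 fun_eq_iff)
        then show "eval (\<lambda>w. eval z (F w)) (segre L v) = (p (1, k) * p (2, l)) * z v"
          using eval_homogeneous_std[OF L[of v], of "p (1, k) * p (2, l)" "\<lambda>(i, j). p (1, i) * p (2, j)"]
          by (simp add: eval_segre p)
      qed
      with nz show "\<exists>c. c \<noteq> 0 \<and> (\<forall>v. eval (\<lambda>w. eval z (F w)) (segre L v) = c * z v)" by (intro exI conjI)
    qed
  next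
    fix a b :: "2 \<times> 2 \<Rightarrow> 'k" and c
    assume ab: "valid fst a" "valid fst b" and "c \<noteq> 0" and eq: "\<And>v. eval b (segre L v) = c * eval a (segre L v)"
    have ten: "b (1, k) * b (2, l) = c * (a (1, k) * a (2, l))" for k l
    proof -
      have "b (1, k) * b (2, l) = eval (\<lambda>v. c * eval a (segre L v)) (Y (k, l))" using Y'[of b k l] by (simp add: eq)
      also have "\<dots> = c * (a (1, k) * a (2, l))" by (simp add: eval_homogeneous_std[OF Y(2)] Y')
      finally show ?thesis .
    qed
    obtain k l where kl: "a (1, k) \<noteq> 0" "a (2, l) \<noteq> 0" using ab(1) by (auto simp: valid_fst)
    have bkl: "b (1, k) \<noteq> 0" "b (2, l) \<noteq> 0" using ten[of k l] kl \<open>c \<noteq> 0\<close> by auto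
    \<comment> \<open>The scaling factors of the two blocks, read off from the nonzero entries at
      \<open>k\<close> and \<open>l\<close>.\<close>
    define d where "d i = (if i = 1 then c * a (2, l) / b (2, l) else c * a (1, k) / b (1, k))" for i :: 2
    have b1: "b (1, j) = d 1 * a (1, j)" and b2: "b (2, j) = d 2 * a (2, j)" for j
      using ten[of j l] ten[of k j] bkl by (simp_all add: d_def field_simps)
    have "b w = d (fst w) * a w" for w
      using b1[of "snd w"] b2[of "snd w"] exhaust_num2[of "fst w"] by (cases w) auto
    moreover have "\<forall>i. d i \<noteq> 0" using kl bkl \<open>c \<noteq> 0\<close> by (simp add: d_def)
    ultimately show "b \<in> orbit fst a" unfolding orbit_def by (intro CollectI exI[of _ d] conjI ext)
  qed
qed

section \<open>The seven surfaces\<close>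

definition zeros :: "('v, 'k::field) mpoly set \<Rightarrow> ('v \<Rightarrow> 'k) set" where
  "zeros G = {x. \<forall>g\<in>G. eval x g = 0}"

lemma generators_in_Van: "G \<subseteq> Van (zeros G)"
  by (auto simp: zeros_def Van_def)

lemma zeros_closed: "x \<notin> zeros G \<Longrightarrow> \<exists>f\<in>Van (zeros G). eval x f \<noteq> 0"
  using generators_in_Van[of G] by (auto simp: zeros_def)

lemma ideal_gen_subset_Van: "ideal_gen G \<subseteq> Van (zeros G)"
  by (rule ideal_minimal[OF generators_in_Van subspace_Van])

lemma ideal_base_uminus: "- a \<in> S \<Longrightarrow> a \<in> ideal_gen S"
  using ideal_neg[OF ideal_base, of "- a" S] by simp

text \<open>\<open>\<sigma>\<close> solves the linear equations and maps the whole space into their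
  zero set. A polynomial vanishing there becomes zero under \<open>\<sigma>\<close>, and it is
  congruent to its image modulo the equations.\<close>

lemma Van_linear:
  fixes G :: "('v, 'k::field_char_0) mpoly set"
  assumes \<sigma>: "\<And>v. var v - \<sigma> v \<in> ideal_gen G" and z: "\<And>x. (\<lambda>v. eval x (\<sigma> v)) \<in> zeros G"
  shows "Van (zeros G) = ideal_gen G"
proof
  show "Van (zeros G) \<subseteq> ideal_gen G"
  proof
    fix f assume f: "f \<in> Van (zeros G)"
    have "subst \<sigma> f = 0" using f z by (intro poly_zeroI) (simp add: eval_subst Van_def)
    then show "f \<in> ideal_gen G" using subst_diff_in_ideal[of \<sigma> G f, OF \<sigma>] by simp
  qed
qed (rule ideal_gen_subset_Van)

text \<open>After \<open>\<sigma>\<close> has eliminated the linear equations, a single equation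
  \<open>x a * x b = D\<close> remains. The factor \<open>c\<close> is a sign.\<close>

lemma Van_quadric:
  fixes G :: "('v, 'k::field_char_0) mpoly set"
  assumes \<sigma>: "\<And>v. var v - \<sigma> v \<in> ideal_gen G" and ab: "a \<noteq> b" "free_of a D" "free_of b D"
    and z: "\<And>x. x a * x b = eval x D \<Longrightarrow> (\<lambda>v. eval x (\<sigma> v)) \<in> zeros G"
    and P: "P \<in> G" "subst \<sigma> P = c * (var a * var b - D)" "c * c = 1"
  shows "Van (zeros G) = ideal_gen G"
proof
  have "c * (P - (P - subst \<sigma> P)) \<in> ideal_gen G"
    by (intro ideal_scale ideal_diff ideal_base[OF P(1)] subst_diff_in_ideal \<sigma>)
  then have "c * (c * (var a * var b - D)) \<in> ideal_gen G" by (simp add: P(2))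
  then have Q: "var a * var b - D \<in> ideal_gen G" by (simp add: P(3) flip: mult.assoc)
  show "Van (zeros G) \<subseteq> ideal_gen G"
  proof
    fix f assume f: "f \<in> Van (zeros G)"
    have "subst \<sigma> f \<in> ideal_gen {var a * var b - D}"
      by (rule vanishing_on_quadric[OF ab]) (use f z in \<open>simp add: eval_subst Van_def\<close>)
    also have "\<dots> \<subseteq> ideal_gen G" using Q by (intro ideal_minimal ideal_subspace) simp
    finally have "(f - subst \<sigma> f) + subst \<sigma> f \<in> ideal_gen G"
      by (intro ideal_add subst_diff_in_ideal \<sigma>)
    then show "f \<in> ideal_gen G" by simp
  qed
qed (rule ideal_gen_subset_Van)

definition G1 :: "(plucker, 'k::field) mpoly set" where
  "G1 = {var M12, var M13 - var M23, var M14 - var M24}"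

definition G2 :: "(plucker, 'k::field) mpoly set" where
  "G2 = {var M12, var M13 + var M23, var M14 + var M24}"

definition G3 :: "(plucker, 'k::field) mpoly set" where
  "G3 = {var M34, var M13 - var M14, var M23 - var M24}"

definition G4 :: "(plucker, 'k::field) mpoly set" where
  "G4 = {var M34, var M13 + var M14, var M23 + var M24}"

definition G5 :: "(plucker, 'k::field) mpoly set" where
  "G5 = {var M12, var M34, plucker_poly}"

definition G6 :: "(plucker, 'k::field) mpoly set" where
  "G6 = {var M14 - var M23, var M13 - var M24, plucker_poly}"

definition G7 :: "(plucker, 'k::field) mpoly set" where
  "G7 = {var M14 + var M23, var M13 + var M24, plucker_poly}"

lemmas G_defs = G1_def G2_def G3_def G4_def G5_def G6_def G7_def

lemma eval_plucker: "eval x plucker_poly = x M12 * x M34 - x M13 * x M24 + x M14 * x M23"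
  by (simp add: plucker_poly_def eval_simps)

lemma zeros_G:
  "zeros G1 = {x. x M12 = 0 \<and> x M23 = x M13 \<and> x M24 = x M14}"
  "zeros G2 = {x. x M12 = 0 \<and> x M23 = - x M13 \<and> x M24 = - x M14}"
  "zeros G3 = {x. x M34 = 0 \<and> x M14 = x M13 \<and> x M24 = x M23}"
  "zeros G4 = {x. x M34 = 0 \<and> x M14 = - x M13 \<and> x M24 = - x M23}"
  "zeros G5 = {x. x M12 = 0 \<and> x M34 = 0 \<and> x M13 * x M24 = x M14 * x M23}"
  "zeros G6 = {x. x M23 = x M14 \<and> x M24 = x M13 \<and> x M12 * x M34 = x M13 * x M13 - x M14 * x M14}"
  "zeros G7 = {x. x M23 = - x M14 \<and> x M24 = - x M13 \<and> x M12 * x M34 = x M14 * x M14 - x M13 * x M13}"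
  by (auto simp: zeros_def G_defs eval_simps eval_plucker add_eq_0_iff algebra_simps)

lemma all_plucker: "(\<forall>v. Q v) \<longleftrightarrow> Q M12 \<and> Q M13 \<and> Q M14 \<and> Q M23 \<and> Q M24 \<and> Q M34"
  by (metis plucker.exhaust)

definition plucker_fun :: "'a \<Rightarrow> 'a \<Rightarrow> 'a \<Rightarrow> 'a \<Rightarrow> 'a \<Rightarrow> 'a \<Rightarrow> plucker \<Rightarrow> 'a" where
  "plucker_fun a b c d e f v = (case v of M12 \<Rightarrow> a | M13 \<Rightarrow> b | M14 \<Rightarrow> c | M23 \<Rightarrow> d | M24 \<Rightarrow> e | M34 \<Rightarrow> f)"

lemma plucker_fun_simps [simp]:
  "plucker_fun a b c d e f M12 = a" "plucker_fun a b c d e f M13 = b" "plucker_fun a b c d e f M14 = c"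
  "plucker_fun a b c d e f M23 = d" "plucker_fun a b c d e f M24 = e" "plucker_fun a b c d e f M34 = f"
  by (simp_all add: plucker_fun_def)

definition fun3 :: "'a \<Rightarrow> 'a \<Rightarrow> 'a \<Rightarrow> 3 \<Rightarrow> 'a" where
  "fun3 a b c w = (if w = 1 then a else if w = 2 then b else c)"

lemma fun3_simps [simp]: "fun3 a b c 1 = a" "fun3 a b c 2 = b" "fun3 a b c 3 = c"
  by (simp_all add: fun3_def)

definition fun22 :: "'a \<Rightarrow> 'a \<Rightarrow> 'a \<Rightarrow> 'a \<Rightarrow> 2 \<times> 2 \<Rightarrow> 'a" where
  "fun22 a b c d w = (if fst w = 1 then (if snd w = 1 then a else b) else (if snd w = 1 then c else d))"

lemma fun22_simps [simp]: "fun22 a b c d (1, 1) = a" "fun22 a b c d (1, 2) = b"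
  "fun22 a b c d (2, 1) = c" "fun22 a b c d (2, 2) = d"
  by (simp_all add: fun22_def)

lemma plane_chartI:
  assumes "\<forall>v. homogeneous 1 (L v)" "\<forall>w. homogeneous 1 (Y w)"
    "\<And>y. (\<lambda>v. eval y (L v)) \<in> X" "\<And>x. x \<in> X \<Longrightarrow> \<forall>v. x v = eval (\<lambda>w. eval x (Y w)) (L v)"
    "\<And>y. \<forall>w. eval (\<lambda>v. eval y (L v)) (Y w) = y w"
  shows "plane_chart L Y X"
proof -
  have "x \<in> range (\<lambda>y v. eval y (L v))" if "x \<in> X" for x
    using assms(4)[OF that] by (intro range_eqI[of _ _ "\<lambda>w. eval x (Y w)"]) auto
  then show ?thesis using assms(1,2,3,5) unfolding plane_chart_def by blast
qed

lemma quadric_chartI: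
  fixes X :: "('v::finite \<Rightarrow> 'k::field) set"
  assumes "\<forall>v. homogeneous 1 (L v)" "\<forall>w. homogeneous 1 (Y w)"
    "\<And>y. y (1, 1) * y (2, 2) = y (1, 2) * y (2, 1) \<Longrightarrow> (\<lambda>v. eval y (L v)) \<in> X"
    "\<And>x. x \<in> X \<Longrightarrow> \<forall>v. x v = eval (\<lambda>w. eval x (Y w)) (L v)"
    "\<And>x. x \<in> X \<Longrightarrow> eval x (Y (1, 1)) * eval x (Y (2, 2)) = eval x (Y (1, 2)) * eval x (Y (2, 1))"
    "\<And>y. \<forall>w. eval (\<lambda>v. eval y (L v)) (Y w) = y w"
  shows "quadric_chart L Y X"
proof -
  have "X = (\<lambda>y v. eval y (L v)) ` {y. y (1, 1) * y (2, 2) = y (1, 2) * y (2, 1)}"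
  proof (intro equalityI subsetI)
    fix x assume x: "x \<in> X"
    show "x \<in> (\<lambda>y v. eval y (L v)) ` {y. y (1, 1) * y (2, 2) = y (1, 2) * y (2, 1)}"
      using assms(4,5)[OF x] by (intro image_eqI[of _ _ "\<lambda>w. eval x (Y w)"]) auto
  qed (use assms(3) in auto)
  then show ?thesis using assms(1,2,6) unfolding quadric_chart_def by blast
qed

lemmas hom_intros = homogeneous_var[unfolded One_nat_def] multihomogeneous_zero multihomogeneous_uminus multihomogeneous_add
  multihomogeneous_diff multihomogeneous_smult

lemma charts:
  "plane_chart (plucker_fun 0 (var 1) (var 2) (var 1) (var 2) (var 3)) (fun3 (var M13) (var M14) (var M34)) (zeros G1)"
  "plane_chart (plucker_fun 0 (var 1) (var 2) (- var 1) (- var 2) (var 3)) (fun3 (var M13) (var M14) (var M34)) (zeros G2)"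
  "plane_chart (plucker_fun (var 3) (var 1) (var 1) (var 2) (var 2) 0) (fun3 (var M13) (var M23) (var M12)) (zeros G3)"
  "plane_chart (plucker_fun (var 3) (var 1) (- var 1) (var 2) (- var 2) 0) (fun3 (var M13) (var M23) (var M12)) (zeros G4)"
  "quadric_chart (plucker_fun 0 (var (1, 1)) (var (1, 2)) (var (2, 1)) (var (2, 2)) 0)
    (fun22 (var M13) (var M14) (var M23) (var M24)) (zeros G5)"
  by (rule plane_chartI quadric_chartI;
    auto simp: all_plucker forall_num3 forall_num2 zeros_G eval_simps intro!: hom_intros)+

text \<open>On \<open>G6\<close> the Pluecker equation reads
  \<open>M12 * M34 = (M13 - M14) * (M13 + M14)\<close>, a vanishing 2 by 2 determinant; on
  \<open>G7\<close> the roles of \<open>M13\<close> and \<open>M14\<close> are exchanged. Recovering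
  the coordinates from sum and difference introduces the halves.\<close>

lemma charts':
  "quadric_chart (plucker_fun (var (1, 1)) (const (1/2) * (var (1, 2) + var (2, 1))) (const (1/2) * (var (2, 1) - var (1, 2)))
      (const (1/2) * (var (2, 1) - var (1, 2))) (const (1/2) * (var (1, 2) + var (2, 1))) (var (2, 2)))
    (fun22 (var M12) (var M13 - var M14) (var M13 + var M14) (var M34)) (zeros (G6 :: (plucker, 'k::field_char_0) mpoly set))"
  "quadric_chart (plucker_fun (var (1, 1)) (const (1/2) * (var (2, 1) - var (1, 2))) (const (1/2) * (var (1, 2) + var (2, 1)))
      (- (const (1/2) * (var (1, 2) + var (2, 1)))) (- (const (1/2) * (var (2, 1) - var (1, 2)))) (var (2, 2)))
    (fun22 (var M12) (var M14 - var M13) (var M14 + var M13) (var M34)) (zeros (G7 :: (plucker, 'k) mpoly set))"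
  by (rule quadric_chartI;
    auto simp: all_plucker forall_num2 zeros_G eval_simps field_simps intro!: hom_intros)+

lemma Van_G:
  "Van (zeros G1) = ideal_gen (G1 :: (plucker, 'k::field_char_0) mpoly set)"
  "Van (zeros G2) = ideal_gen (G2 :: (plucker, 'k) mpoly set)"
  "Van (zeros G3) = ideal_gen (G3 :: (plucker, 'k) mpoly set)"
  "Van (zeros G4) = ideal_gen (G4 :: (plucker, 'k) mpoly set)"
proof -
  have all: "P v" if "P M12" "P M13" "P M14" "P M23" "P M24" "P M34" for P and v :: plucker
    using that by (cases v) auto
  show "Van (zeros G1) = ideal_gen (G1 :: (plucker, 'k) mpoly set)"
    by (rule Van_linear[where \<sigma> = "plucker_fun 0 (var M13) (var M14) (var M13) (var M14) (var M34)"], rule all)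
      (auto simp: zeros_def G_defs eval_simps intro: ideal_zero ideal_base ideal_base_uminus)
  show "Van (zeros G2) = ideal_gen (G2 :: (plucker, 'k) mpoly set)"
    by (rule Van_linear[where \<sigma> = "plucker_fun 0 (var M13) (var M14) (- var M13) (- var M14) (var M34)"], rule all)
      (auto simp: zeros_def G_defs eval_simps add.commute intro: ideal_zero ideal_base ideal_base_uminus)
  show "Van (zeros G3) = ideal_gen (G3 :: (plucker, 'k) mpoly set)"
    by (rule Van_linear[where \<sigma> = "plucker_fun (var M12) (var M13) (var M13) (var M23) (var M23) 0"], rule all)
      (auto simp: zeros_def G_defs eval_simps intro: ideal_zero ideal_base ideal_base_uminus)
  show "Van (zeros G4) = ideal_gen (G4 :: (plucker, 'k) mpoly set)"
    by (rule Van_linear[where \<sigma> = "plucker_fun (var M12) (var M13) (- var M13) (var M23) (- var M23) 0"], rule all)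
      (auto simp: zeros_def G_defs eval_simps add.commute intro: ideal_zero ideal_base ideal_base_uminus)
qed

lemma Van_G':
  "Van (zeros G5) = ideal_gen (G5 :: (plucker, 'k::field_char_0) mpoly set)"
  "Van (zeros G6) = ideal_gen (G6 :: (plucker, 'k) mpoly set)"
  "Van (zeros G7) = ideal_gen (G7 :: (plucker, 'k) mpoly set)"
proof -
  have all: "P v" if "P M12" "P M13" "P M14" "P M23" "P M24" "P M34" for P and v :: plucker
    using that by (cases v) auto
  show "Van (zeros G5) = ideal_gen (G5 :: (plucker, 'k) mpoly set)"
  \<comment> \<open>With \<open>M12\<close> and \<open>M34\<close> set to zero, \<open>P\<close>
    becomes minus the equation of the quadric, hence \<open>c = -1\<close>.\<close>
  proof (rule Van_quadric[where \<sigma> = "plucker_fun 0 (var M13) (var M14) (var M23) (var M24) 0" and a = M13 and b = M24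
        and D = "var M14 * var M23" and P = plucker_poly and c = "-1"])
    show "var v - plucker_fun 0 (var M13) (var M14) (var M23) (var M24) 0 v \<in> ideal_gen G5" for v
      by (rule all[where v = v]) (auto simp: G_defs intro: ideal_zero ideal_base ideal_base_uminus)
  qed (auto simp: zeros_def G_defs eval_plucker eval_simps plucker_poly_def subst_simps intro!: free_of_mult free_of_var)
  show "Van (zeros G6) = ideal_gen (G6 :: (plucker, 'k) mpoly set)"
  proof (rule Van_quadric[where \<sigma> = "plucker_fun (var M12) (var M13) (var M14) (var M14) (var M13) (var M34)" and a = M12 and b = M34
        and D = "var M13 * var M13 - var M14 * var M14" and P = plucker_poly and c = 1])
    show "var v - plucker_fun (var M12) (var M13) (var M14) (var M14) (var M13) (var M34) v \<in> ideal_gen G6" for v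
      by (rule all[where v = v]) (auto simp: G_defs intro: ideal_zero ideal_base ideal_base_uminus)
  qed (auto simp: zeros_def G_defs eval_plucker eval_simps plucker_poly_def subst_simps intro!: free_of_mult free_of_var free_of_diff)
  show "Van (zeros G7) = ideal_gen (G7 :: (plucker, 'k) mpoly set)"
  proof (rule Van_quadric[where \<sigma> = "plucker_fun (var M12) (var M13) (var M14) (- var M14) (- var M13) (var M34)" and a = M12 and b = M34
        and D = "var M14 * var M14 - var M13 * var M13" and P = plucker_poly and c = 1])
    show "var v - plucker_fun (var M12) (var M13) (var M14) (- var M14) (- var M13) (var M34) v \<in> ideal_gen G7" for v
      by (rule all[where v = v]) (auto simp: G_defs add.commute intro: ideal_zero ideal_base ideal_base_uminus)
  qed (auto simp: zeros_def G_defs eval_plucker eval_simps plucker_poly_def subst_simps intro!: free_of_mult free_of_var free_of_diff)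
qed

section \<open>The intersection of the seven ideals\<close>

definition hits :: "'v set \<Rightarrow> ('v \<Rightarrow>\<^sub>0 nat) \<Rightarrow> bool" where
  "hits A m \<longleftrightarrow> (\<exists>v\<in>A. Poly_Mapping.lookup m v \<noteq> 0)"

definition coord :: "'v set \<Rightarrow> ('v \<Rightarrow> 'k::zero) set" where
  "coord A = {x. \<forall>v\<in>A. x v = 0}"

text \<open>Setting the variables in \<open>A\<close> to zero kills exactly the monomials that meet
  \<open>A\<close> and leaves the others, which are independent, unchanged.\<close>

lemma Van_coord:
  fixes f :: "('v, 'k::field_char_0) mpoly"
  shows "f \<in> Van (coord A) \<longleftrightarrow> (\<forall>m\<in>Poly_Mapping.keys f. hits A m)"
proof -
  let ?z = "\<lambda>x v. if v \<in> A then 0 else x v"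
  have z: "mono_eval (?z x) m = (if hits A m then 0 else mono_eval x m)" for x :: "'v \<Rightarrow> 'k" and m
  proof (cases "hits A m")
    case True
    then obtain v where "v \<in> A" "v \<in> Poly_Mapping.keys m" "Poly_Mapping.lookup m v \<noteq> 0"
      by (auto simp: hits_def in_keys_iff)
    then show ?thesis using True by (auto intro!: prod_zero bexI[of _ v])
  next
    case False
    then show ?thesis by (auto intro!: prod.cong simp: hits_def in_keys_iff)
  qed
  have ev: "eval (?z x) f = (\<Sum>m | m \<in> Poly_Mapping.keys f \<and> \<not> hits A m. Poly_Mapping.lookup f m * mono_eval x m)" for x
    unfolding eval_def z by (rule sum.mono_neutral_cong_right) auto
  show ?thesis
  proof
    assume f: "f \<in> Van (coord A)"
    have "eval (?z x) f = 0" for x using f by (simp add: Van_def coord_def)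
    then have "Poly_Mapping.lookup f m = 0" if "m \<in> Poly_Mapping.keys f" "\<not> hits A m" for m
      using that
      by (intro mono_eval_independent[of "{m. m \<in> Poly_Mapping.keys f \<and> \<not> hits A m}" "Poly_Mapping.lookup f" m])
        (auto simp: ev)
    then show "\<forall>m\<in>Poly_Mapping.keys f. hits A m" by (auto simp: in_keys_iff)
  next
    assume h: "\<forall>m\<in>Poly_Mapping.keys f. hits A m"
    have "eval x f = 0" if "x \<in> coord A" for x
    proof -
      have z: "?z x = x" using that by (auto simp: coord_def)
      have "eval (?z x) f = 0" unfolding ev by (rule sum.neutral) (use h in auto)
      then show ?thesis by (simp only: z)
    qed
    then show "f \<in> Van (coord A)" by (simp add: Van_def)
  qed
qed

lemma prime_Van_coord: "prime_ideal (Van (coord A :: ('v \<Rightarrow> 'k::field_char_0) set))"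
proof -
  have "coord A = range (\<lambda>(a :: 'v \<Rightarrow> 'k) v. eval a (if v \<in> A then 0 else var v))"
  proof (intro equalityI subsetI)
    fix x :: "'v \<Rightarrow> 'k" assume "x \<in> coord A"
    then show "x \<in> range (\<lambda>a v. eval a (if v \<in> A then 0 else var v))"
      by (intro range_eqI[of _ _ x]) (auto simp: coord_def)
  qed (auto simp: coord_def)
  then show ?thesis by (intro prime_ideal_Van) (simp only: linked_range)
qed

lemma Van_coord_antimono: "A \<subseteq> B \<Longrightarrow> Van (coord A) \<subseteq> Van (coord B)"
  by (rule Van_antimono) (auto simp: coord_def)

lemma split_poly:
  fixes f :: "('v, 'k::field_char_0) mpoly"
  obtains g h where "f = g + h" "\<And>m. m \<in> Poly_Mapping.keys g \<Longrightarrow> m \<in> Poly_Mapping.keys f \<and> \<not> Q m"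
    "\<And>m. m \<in> Poly_Mapping.keys h \<Longrightarrow> m \<in> Poly_Mapping.keys f \<and> Q m"
proof -
  define g where "g = (\<Sum>m | m \<in> Poly_Mapping.keys f \<and> \<not> Q m. Poly_Mapping.single m (Poly_Mapping.lookup f m))"
  define h where "h = (\<Sum>m | m \<in> Poly_Mapping.keys f \<and> Q m. Poly_Mapping.single m (Poly_Mapping.lookup f m))"
  have g: "Poly_Mapping.lookup g m = (if \<not> Q m then Poly_Mapping.lookup f m else 0)" for m
    unfolding g_def by (simp add: lookup_sum lookup_single when_def in_keys_iff)
  have h: "Poly_Mapping.lookup h m = (if Q m then Poly_Mapping.lookup f m else 0)" for m
    unfolding h_def by (simp add: lookup_sum lookup_single when_def in_keys_iff)
  show thesis
  proof (rule that[of g h])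
    show "f = g + h" by (rule poly_mapping_eqI) (simp add: lookup_add g h)
  qed (auto simp: in_keys_iff g h split: if_splits)
qed

text \<open>The right-hand side is an ideal containing the three generators. It separates a
  monomial-ideal part from a multiple of \<open>P\<close>.\<close>

lemma ideal_gen_plucker_subset:
  "ideal_gen {var u, var w, plucker_poly} \<subseteq>
    {g + c * plucker_poly | g c. g \<in> Van (coord {u, w} :: (plucker \<Rightarrow> 'k::field_char_0) set)}"
proof (rule ideal_minimal)
  let ?S = "{g + c * plucker_poly | g c. g \<in> Van (coord {u, w :: plucker})} :: (plucker, 'k) mpoly set"
  have memI: "g + c * plucker_poly \<in> ?S" if "g \<in> Van (coord {u, w})" for g c using that by blast
  have gens: "var u \<in> Van (coord {u, w})" "var w \<in> Van (coord {u, w})" "0 \<in> Van (coord {u, w})"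
    by (simp_all add: Van_def coord_def)
  show "{var u, var w, plucker_poly} \<subseteq> ?S"
    using memI[OF gens(1), of 0] memI[OF gens(2), of 0] memI[OF gens(3), of 1] by simp
  show "Modules.module.subspace (*) ?S"
    unfolding subspace_iff
  proof (intro conjI ballI allI)
    show "0 \<in> ?S" using memI[OF gens(3), of 0] by simp
    fix x assume "x \<in> ?S"
    then obtain g c where x: "x = g + c * plucker_poly" "g \<in> Van (coord {u, w})" by blast
    show "d * x \<in> ?S" for d
      using memI[OF ideal_mult_left[OF subspace_Van x(2)], of d "d * c"] by (simp add: x(1) algebra_simps)
    fix y assume "y \<in> ?S"
    then obtain h d where y: "y = h + d * plucker_poly" "h \<in> Van (coord {u, w})" by blast
    have "g + h \<in> Van (coord {u, w})" using x(2) y(2) by (simp add: Van_def eval_simps)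
    from memI[OF this, of "c + d"] show "x + y \<in> ?S" by (simp add: x(1) y(1) algebra_simps)
  qed
qed

text \<open>The pairs are the products occurring in \<open>P\<close>. Setting one pair to zero
  leaves, up to sign, an equation of the kind \<open>x a * x b = D\<close>, so the vanishing ideal
  is generated by the pair and \<open>P\<close>.\<close>

lemma plucker_decomp:
  fixes f :: "(plucker, 'k::field_char_0) mpoly"
  assumes "(u, w) \<in> {(M12, M34), (M14, M23), (M13, M24)}" "\<And>x. x u = 0 \<Longrightarrow> x w = 0 \<Longrightarrow> eval x plucker_poly = 0 \<Longrightarrow> eval x f = 0"
  shows "\<exists>g c. f = g + c * plucker_poly \<and> g \<in> Van (coord {u, w})"
proof -
  have all: "P v" if "P M12" "P M13" "P M14" "P M23" "P M24" "P M34" for P and v :: plucker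
    using that by (cases v) auto
  have "Van (zeros {var M12, var M34, plucker_poly}) = ideal_gen {var M12, var M34, plucker_poly :: (plucker, 'k) mpoly}"
    using Van_G'(1) by (simp add: G5_def)
  moreover have "Van (zeros {var M14, var M23, plucker_poly}) = ideal_gen {var M14, var M23, plucker_poly :: (plucker, 'k) mpoly}"
  proof (rule Van_quadric[where \<sigma> = "plucker_fun (var M12) (var M13) 0 0 (var M24) (var M34)" and a = M12 and b = M34
        and D = "var M13 * var M24" and P = plucker_poly and c = 1])
    show "var v - plucker_fun (var M12) (var M13) 0 0 (var M24) (var M34) v \<in> ideal_gen {var M14, var M23, plucker_poly :: (plucker, 'k) mpoly}" for v
      by (rule all[where v = v]) (auto intro: ideal_zero ideal_base)
  qed (auto simp: zeros_def eval_plucker eval_simps plucker_poly_def subst_simps intro!: free_of_mult free_of_var)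
  moreover have "Van (zeros {var M13, var M24, plucker_poly}) = ideal_gen {var M13, var M24, plucker_poly :: (plucker, 'k) mpoly}"
  proof (rule Van_quadric[where \<sigma> = "plucker_fun (var M12) 0 (var M14) (var M23) 0 (var M34)" and a = M12 and b = M34
        and D = "- (var M14 * var M23)" and P = plucker_poly and c = 1])
    show "var v - plucker_fun (var M12) 0 (var M14) (var M23) 0 (var M34) v \<in> ideal_gen {var M13, var M24, plucker_poly :: (plucker, 'k) mpoly}" for v
      by (rule all[where v = v]) (auto intro: ideal_zero ideal_base)
  qed (auto simp: zeros_def eval_plucker eval_simps plucker_poly_def subst_simps intro!: free_of_mult free_of_var free_of_uminus)
  ultimately have "Van (zeros {var u, var w, plucker_poly}) = ideal_gen {var u, var w, plucker_poly :: (plucker, 'k) mpoly}"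
    using assms(1) by auto
  moreover have "f \<in> Van (zeros {var u, var w, plucker_poly})"
    using assms(2) by (simp add: Van_def zeros_def)
  ultimately show ?thesis using ideal_gen_plucker_subset[of u w] by blast
qed

lemma single_in_ideal:
  fixes c :: "'k::field_char_0"
  assumes "Poly_Mapping.lookup m u \<noteq> 0" "Poly_Mapping.lookup m v \<noteq> 0" "Poly_Mapping.lookup m w \<noteq> 0"
    "u \<noteq> v" "u \<noteq> w" "v \<noteq> w" "var u * var v * var w \<in> S"
  shows "Poly_Mapping.single m c \<in> ideal_gen S"
proof -
  define m' where "m' = m - Poly_Mapping.single u 1 - Poly_Mapping.single v 1 - Poly_Mapping.single w 1"
  have m: "m = m' + (Poly_Mapping.single u 1 + Poly_Mapping.single v 1 + Poly_Mapping.single w 1)"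
    unfolding m'_def using assms
    by (intro poly_mapping_eqI) (auto simp: lookup_add lookup_minus lookup_single when_def)
  have "Poly_Mapping.single m c = Poly_Mapping.single m' c * (var u * var v * var w)"
    unfolding m by (simp add: var_def mult_single)
  then show ?thesis using assms(7) by (auto intro: ideal_scale ideal_base)
qed

text \<open>Opposite vertices of the octahedron are the pairs multiplied in \<open>P\<close>, and a
  face takes one vertex from each pair. Any two of these four faces share exactly one
  vertex.\<close>

definition octahedron :: "(plucker, 'k::field) mpoly set" where
  "octahedron = {var M12 * var M13 * var M14, var M12 * var M23 * var M24,
     var M34 * var M14 * var M24, var M34 * var M13 * var M23}"

text \<open>The three quadric surfaces are treated one after the other: whenever a multiple \<open>b P\<close> lies
  in the sum of two of the monomial ideals, so does \<open>b\<close>, and the parts of \<open>b\<close> are used to correct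
  \<open>f\<close> by multiples of \<open>P\<close>. In the end \<open>f\<close> lies in an intersection of seven monomial primes, which
  are the minimal vertex covers of four alternating faces of an octahedron.\<close>

lemma octahedron_ideal:
  fixes f :: "(plucker, 'k::field_char_0) mpoly"
  assumes pl: "\<And>A. A \<in> {{M12, M23, M24}, {M12, M13, M14}, {M34, M14, M24}, {M34, M13, M23}} \<Longrightarrow> f \<in> Van (coord A)"
    and qu: "\<And>u w x. (u, w) \<in> {(M12, M34), (M14, M23), (M13, M24)} \<Longrightarrow> x u = 0 \<Longrightarrow> x w = 0 \<Longrightarrow>
      eval x plucker_poly = 0 \<Longrightarrow> eval x f = 0"
  shows "f \<in> ideal_gen (insert plucker_poly octahedron)"
proof -
  let ?P = "plucker_poly :: (plucker, 'k) mpoly"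
  have sub: "h - k \<in> Van Z" if "h \<in> Van Z" "k \<in> Van Z" for h k :: "(plucker, 'k) mpoly" and Z
    using that by (simp add: Van_def eval_simps)
  have mono: "h \<in> Van (coord B)" if "h \<in> Van (coord A)" "A \<subseteq> B" for h :: "(plucker, 'k) mpoly" and A B
    using that Van_coord_antimono by blast
  have cancel: "b \<in> Van (coord A)" if "b * ?P \<in> Van (coord A)" "x \<in> coord A" "eval x ?P \<noteq> 0" for b A x
    using prime_Van_coord[of A] that by (auto simp: prime_ideal_def Van_def)
  \<comment> \<open>Points with two opposite pairs equal to zero and \<open>P\<close> nonzero. They
    show that \<open>P\<close> is outside the corresponding monomial primes, so it can be
    cancelled.\<close>
  define x1 x2 x3 :: "plucker \<Rightarrow> 'k" where "x1 = plucker_fun 0 1 0 0 1 0"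
    and "x2 = plucker_fun 0 0 1 1 0 0" and "x3 = plucker_fun 1 0 0 0 0 1"
  have x: "eval x1 ?P \<noteq> 0" "eval x2 ?P \<noteq> 0" "eval x3 ?P \<noteq> 0" by (simp_all add: eval_plucker x1_def x2_def x3_def)
  obtain g5 a where g5: "f = g5 + a * ?P" "g5 \<in> Van (coord {M12, M34})"
    using plucker_decomp[of M12 M34 f] qu[of M12 M34] by auto
  have q1: "eval x g5 = 0" if "(u, w) \<in> {(M12, M34), (M14, M23), (M13, M24)}" "x u = 0" "x w = 0" "eval x ?P = 0" for u w x
    using qu[OF that] that(4) by (simp add: g5(1) eval_simps)
  obtain g6 b where g6: "g5 = g6 + b * ?P" "g6 \<in> Van (coord {M14, M23})"
    using plucker_decomp[of M14 M23 g5] q1[of M14 M23] by auto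
  have "b * ?P = g5 - g6" by (simp add: g6(1))
  also have "\<dots> \<in> Van (coord {M12, M34, M14, M23})"
    by (intro sub mono[OF g5(2)] mono[OF g6(2)]) auto
  finally have b: "b \<in> Van (coord {M12, M34, M14, M23})" by (rule cancel[OF _ _ x(1)]) (simp add: coord_def x1_def)
  \<comment> \<open>Every monomial of \<open>b\<close> meets one of the pairs
    \<open>{M12, M34}\<close> and \<open>{M14, M23}\<close>; \<open>b2\<close> collects those
    meeting the second, and the rest must meet the first.\<close>
  obtain b1 b2 where b12: "b = b1 + b2" "\<And>m. m \<in> Poly_Mapping.keys b1 \<Longrightarrow> m \<in> Poly_Mapping.keys b \<and> \<not> hits {M14, M23} m"
    "\<And>m. m \<in> Poly_Mapping.keys b2 \<Longrightarrow> m \<in> Poly_Mapping.keys b \<and> hits {M14, M23} m"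
    by (rule split_poly[of b "hits {M14, M23}"]) blast
  have b1: "b1 \<in> Van (coord {M12, M34})" and b2: "b2 \<in> Van (coord {M14, M23})"
    using b12(2,3) b unfolding Van_coord by (auto simp: hits_def)
  define f2 where "f2 = g5 - b1 * ?P"
  have f2: "f2 \<in> Van (coord {M12, M34})"
    unfolding f2_def by (intro sub g5(2) ideal_mult_right[OF subspace_Van b1])
  have "f2 = g6 + b2 * ?P" by (simp add: f2_def g6(1) b12(1) algebra_simps)
  then have f2': "f2 \<in> Van (coord {M14, M23})"
    using sub[OF g6(2), of "- b2 * ?P"] ideal_mult_right[OF subspace_Van b2, of "- ?P"] by simp
  have q2: "eval x f2 = 0" if "x M13 = 0" "x M24 = 0" "eval x ?P = 0" for x
    using q1[of M13 M24 x] that by (simp add: f2_def eval_simps)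
  obtain g7 c where g7: "f2 = g7 + c * ?P" "g7 \<in> Van (coord {M13, M24})"
    using plucker_decomp[of M13 M24 f2] q2 by auto
  have cP: "c * ?P = f2 - g7" by (simp add: g7(1))
  have "c * ?P \<in> Van (coord {M12, M34, M13, M24})"
    unfolding cP by (intro sub mono[OF f2] mono[OF g7(2)]) auto
  then have c: "c \<in> Van (coord {M12, M34, M13, M24})" by (rule cancel[OF _ _ x(2)]) (simp add: coord_def x2_def)
  have "c * ?P \<in> Van (coord {M14, M23, M13, M24})"
    unfolding cP by (intro sub mono[OF f2'] mono[OF g7(2)]) auto
  then have c': "c \<in> Van (coord {M14, M23, M13, M24})" by (rule cancel[OF _ _ x(3)]) (simp add: coord_def x3_def)
  obtain c1 c2 where c12: "c = c1 + c2" "\<And>m. m \<in> Poly_Mapping.keys c1 \<Longrightarrow> m \<in> Poly_Mapping.keys c \<and> \<not> hits {M13, M24} m"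
    "\<And>m. m \<in> Poly_Mapping.keys c2 \<Longrightarrow> m \<in> Poly_Mapping.keys c \<and> hits {M13, M24} m"
    by (rule split_poly[of c "hits {M13, M24}"]) blast
  have c1: "c1 \<in> Van (coord {M12, M34})" "c1 \<in> Van (coord {M14, M23})" and c2: "c2 \<in> Van (coord {M13, M24})"
    using c12(2,3) c c' unfolding Van_coord by (auto simp: hits_def)
  define f3 where "f3 = f2 - c1 * ?P"
  have f3: "f3 \<in> Van (coord {M12, M34})" "f3 \<in> Van (coord {M14, M23})"
    unfolding f3_def by (intro sub f2 f2' ideal_mult_right[OF subspace_Van] c1)+
  have "f3 = g7 + c2 * ?P" by (simp add: f3_def g7(1) c12(1) algebra_simps)
  then have f3': "f3 \<in> Van (coord {M13, M24})"
    using sub[OF g7(2), of "- c2 * ?P"] ideal_mult_right[OF subspace_Van c2, of "- ?P"] by simp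
  have f_eq: "f = f3 + (a + b1 + c1) * ?P" by (simp add: g5(1) f3_def f2_def algebra_simps)
  have f3'': "f3 \<in> Van (coord A)" if A: "A \<in> {{M12, M23, M24}, {M12, M13, M14}, {M34, M14, M24}, {M34, M13, M23}}" for A
  proof -
    have "?P \<in> Van (coord A)" using A by (auto simp: Van_def coord_def eval_plucker)
    then have "(a + b1 + c1) * ?P \<in> Van (coord A)" by (rule ideal_mult_left[OF subspace_Van])
    with pl[OF A] sub have "f - (a + b1 + c1) * ?P \<in> Van (coord A)" by blast
    then show ?thesis by (simp add: f_eq)
  qed
  have "Poly_Mapping.single m k \<in> ideal_gen octahedron" if m: "m \<in> Poly_Mapping.keys f3" for m and k :: 'k
  proof -
    have "hits {M12, M34} m" "hits {M14, M23} m" "hits {M13, M24} m" "hits {M12, M23, M24} m" "hits {M12, M13, M14} m"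
      "hits {M34, M14, M24} m" "hits {M34, M13, M23} m"
      using f3 f3' f3'' m unfolding Van_coord by auto
    \<comment> \<open>Duality between faces and vertex covers: a set of variables that meets all
      seven covers contains one of the four faces.\<close>
    then consider "Poly_Mapping.lookup m M12 \<noteq> 0" "Poly_Mapping.lookup m M13 \<noteq> 0" "Poly_Mapping.lookup m M14 \<noteq> 0"
      | "Poly_Mapping.lookup m M12 \<noteq> 0" "Poly_Mapping.lookup m M23 \<noteq> 0" "Poly_Mapping.lookup m M24 \<noteq> 0"
      | "Poly_Mapping.lookup m M34 \<noteq> 0" "Poly_Mapping.lookup m M14 \<noteq> 0" "Poly_Mapping.lookup m M24 \<noteq> 0"
      | "Poly_Mapping.lookup m M34 \<noteq> 0" "Poly_Mapping.lookup m M13 \<noteq> 0" "Poly_Mapping.lookup m M23 \<noteq> 0"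
      unfolding hits_def by blast
    then show ?thesis
      by cases (rule single_in_ideal[of m M12 M13 M14] single_in_ideal[of m M12 M23 M24]
        single_in_ideal[of m M34 M14 M24] single_in_ideal[of m M34 M13 M23]; simp add: octahedron_def)+
  qed
  then have "(\<Sum>m\<in>Poly_Mapping.keys f3. Poly_Mapping.single m (Poly_Mapping.lookup f3 m)) \<in> ideal_gen octahedron"
    by (intro ideal_sum)
  also have "(\<Sum>m\<in>Poly_Mapping.keys f3. Poly_Mapping.single m (Poly_Mapping.lookup f3 m)) = f3"
    by (rule poly_mapping_eqI) (simp add: lookup_sum lookup_single when_def in_keys_iff)
  finally have "f3 \<in> ideal_gen (insert ?P octahedron)" using ideal_mono[of octahedron "insert ?P octahedron"] by blast
  moreover have "(a + b1 + c1) * ?P \<in> ideal_gen (insert ?P octahedron)" by (intro ideal_scale ideal_base) simp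
  ultimately show ?thesis unfolding f_eq by (rule ideal_add)
qed

section \<open>Back to the original coordinates\<close>

lemma subst_ideal:
  fixes S :: "('v, 'k::field_char_0) mpoly set"
  assumes "f \<in> ideal_gen S" "\<And>s. s \<in> S \<Longrightarrow> subst \<sigma> s \<in> ideal_gen T"
  shows "subst \<sigma> f \<in> ideal_gen T"
proof -
  have "ideal_gen S \<subseteq> {f. subst \<sigma> f \<in> ideal_gen T}"
    by (rule ideal_minimal) (auto simp: subspace_iff subst_simps assms(2) intro: ideal_zero ideal_add ideal_scale)
  then show ?thesis using assms(1) by blast
qed

text \<open>On \<open>M13\<close>, \<open>M14\<close>, \<open>M23\<close>, \<open>M24\<close> this
  is half a symmetric 4 by 4 Hadamard matrix, hence an involution. It fixes \<open>P\<close> and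
  turns the linear equations of each surface into the vanishing of variables.\<close>

definition hadamard :: "plucker \<Rightarrow> (plucker, 'k::field) mpoly" where
  "hadamard = plucker_fun (var M12)
     (const (1/2) * (var M13 + var M14 + var M23 + var M24)) (const (1/2) * (var M13 - var M14 + var M23 - var M24))
     (const (1/2) * (var M13 + var M14 - var M23 - var M24)) (const (1/2) * (var M13 - var M14 - var M23 + var M24))
     (var M34)"

text \<open>Called \<open>t1\<close> to \<open>t4\<close>, these satisfy that
  \<open>hadamard\<close> sends the octahedron monomials to quarters of \<open>t2 + 2 * t1\<close>,
  \<open>t2 - 2 * t1\<close>, \<open>t4 - 2 * t3\<close> and \<open>t4 + 2 * t3\<close>.\<close>

definition T_gens :: "(plucker, 'k::field) mpoly set" where
  "T_gens = {var M12 * (var M13 * var M23 - var M14 * var M24),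
     var M12 * (var M13 * var M13 + var M23 * var M23 - var M14 * var M14 - var M24 * var M24),
     var M34 * (var M13 * var M14 - var M23 * var M24),
     var M34 * (var M13 * var M13 + var M14 * var M14 - var M23 * var M23 - var M24 * var M24)}"

definition surfaces :: "(plucker \<Rightarrow> 'k::field) set set" where
  "surfaces = {zeros G1, zeros G2, zeros G3, zeros G4, zeros G5, zeros G6, zeros G7}"

lemma hadamard_octahedron:
  assumes s: "s \<in> insert plucker_poly (octahedron :: (plucker, 'k::field_char_0) mpoly set)"
  shows "subst hadamard s \<in> ideal_gen (insert plucker_poly T_gens)"
proof -
  let ?J = "ideal_gen (insert plucker_poly T_gens :: (plucker, 'k) mpoly set)"
  define t1 t2 t3 t4 :: "(plucker, 'k) mpoly"
    where "t1 = var M12 * (var M13 * var M23 - var M14 * var M24)"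
      and "t2 = var M12 * (var M13 * var M13 + var M23 * var M23 - var M14 * var M14 - var M24 * var M24)"
      and "t3 = var M34 * (var M13 * var M14 - var M23 * var M24)"
      and "t4 = var M34 * (var M13 * var M13 + var M14 * var M14 - var M23 * var M23 - var M24 * var M24)"
  have mem: "t1 \<in> ?J" "t2 \<in> ?J" "t3 \<in> ?J" "t4 \<in> ?J" "plucker_poly \<in> ?J"
    unfolding t1_def t2_def t3_def t4_def by (intro ideal_base; simp add: T_gens_def)+
  have e: "subst hadamard plucker_poly = (plucker_poly :: (plucker, 'k) mpoly)"
    "subst hadamard (var M12 * var M13 * var M14) = const (1/4) * (t2 + const 2 * t1)"
    "subst hadamard (var M12 * var M23 * var M24) = const (1/4) * (t2 - const 2 * t1)"
    "subst hadamard (var M34 * var M14 * var M24) = const (1/4) * (t4 - const 2 * t3)"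
    "subst hadamard (var M34 * var M13 * var M23) = const (1/4) * (t4 + const 2 * t3)"
    by (rule poly_eqI; simp add: eval_subst eval_simps eval_plucker hadamard_def t1_def t2_def t3_def t4_def field_simps)+
  consider "s = plucker_poly" | "s = var M12 * var M13 * var M14" | "s = var M12 * var M23 * var M24"
    | "s = var M34 * var M14 * var M24" | "s = var M34 * var M13 * var M23"
    using s unfolding octahedron_def by blast
  then show ?thesis
    by cases (simp_all only: e, (intro mem ideal_scale ideal_add ideal_diff)+)
qed

text \<open>In the new coordinates the hypotheses are those of \<open>octahedron_ideal\<close>;
  applying the involution once more brings the result back to \<open>f\<close>.\<close>

lemma intersection_of_surfaces:
  fixes f :: "(plucker, 'k::field_char_0) mpoly"
  assumes f: "\<And>X. X \<in> surfaces \<Longrightarrow> f \<in> Van X"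
  shows "f \<in> ideal_gen (insert plucker_poly T_gens)"
proof -
  let ?h = "subst hadamard f"
  have fX: "eval (\<lambda>v. eval x (hadamard v)) f = 0" if "(\<lambda>v. eval x (hadamard v)) \<in> X" "X \<in> surfaces" for x X
    using f[OF that(2)] that(1) by (simp add: Van_def)
  have "?h \<in> ideal_gen (insert plucker_poly octahedron)"
  proof (rule octahedron_ideal)
    fix A :: "plucker set" assume "A \<in> {{M12, M23, M24}, {M12, M13, M14}, {M34, M14, M24}, {M34, M13, M23}}"
    then consider "A = {M12, M23, M24}" | "A = {M12, M13, M14}" | "A = {M34, M14, M24}" | "A = {M34, M13, M23}" by blast
    then show "?h \<in> Van (coord A)"
    proof cases
      case 1
      show ?thesis unfolding Van_def by (auto simp: eval_subst 1 coord_def intro!: fX[of _ "zeros G1"])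
        (simp_all add: zeros_G hadamard_def eval_simps surfaces_def field_simps)
    next
      case 2
      show ?thesis unfolding Van_def by (auto simp: eval_subst 2 coord_def intro!: fX[of _ "zeros G2"])
        (simp_all add: zeros_G hadamard_def eval_simps surfaces_def field_simps)
    next
      case 3
      show ?thesis unfolding Van_def by (auto simp: eval_subst 3 coord_def intro!: fX[of _ "zeros G3"])
        (simp_all add: zeros_G hadamard_def eval_simps surfaces_def field_simps)
    next
      case 4
      show ?thesis unfolding Van_def by (auto simp: eval_subst 4 coord_def intro!: fX[of _ "zeros G4"])
        (simp_all add: zeros_G hadamard_def eval_simps surfaces_def field_simps)
    qed
  next
    fix u w and x :: "plucker \<Rightarrow> 'k"
    assume uw: "(u, w) \<in> {(M12, M34), (M14, M23), (M13, M24)}" and x: "x u = 0" "x w = 0" "eval x plucker_poly = 0"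
    have x0: "x M12 * x M34 - x M13 * x M24 + x M14 * x M23 = 0" using x(3) by (simp add: eval_plucker)
    consider "u = M12 \<and> w = M34" | "u = M14 \<and> w = M23" | "u = M13 \<and> w = M24" using uw by blast
    then show "eval x ?h = 0"
    proof cases
      case 1
      show ?thesis unfolding eval_subst
        by (rule fX[of _ "zeros G5"]) (use 1 x x0 in \<open>simp_all add: zeros_G hadamard_def eval_simps surfaces_def field_simps\<close>)
    next
      case 2
      show ?thesis unfolding eval_subst
        by (rule fX[of _ "zeros G6"]) (use 2 x x0 in \<open>simp_all add: zeros_G hadamard_def eval_simps surfaces_def field_simps\<close>)
    next
      case 3
      have s: "x M12 * x M34 + x M14 * x M23 = 0" using x0 3 x by simp
      \<comment> \<open>The shape that the equation of the seventh quadric takes after its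
        denominators have been cleared.\<close>
      have "x M12 * (x M34 * 16) + x M14 * (x M23 * 16) = 16 * (x M12 * x M34 + x M14 * x M23)"
        by (simp add: algebra_simps)
      also have "\<dots> = 0" by (simp only: s mult_zero_right)
      finally have "x M12 * (x M34 * 16) + x M14 * (x M23 * 16) = 0" .
      then show ?thesis unfolding eval_subst
        by (intro fX[of _ "zeros G7"]) (use 3 x x0 in \<open>simp_all add: zeros_G hadamard_def eval_simps surfaces_def field_simps\<close>)
    qed
  qed
  then have "subst hadamard ?h \<in> ideal_gen (insert plucker_poly T_gens)"
    by (rule subst_ideal) (rule hadamard_octahedron)
  also have "subst hadamard ?h = f"
  proof (rule poly_eqI)
    fix x :: "plucker \<Rightarrow> 'k"
    have "\<forall>v. eval (\<lambda>v. eval x (hadamard v)) (hadamard v) = x v"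
      unfolding all_plucker by (simp add: hadamard_def eval_simps field_simps)
    then show "eval x (subst hadamard ?h) = eval x f" by (simp add: eval_subst)
  qed
  finally show ?thesis .
qed

section \<open>The quadratic dual\<close>

definition word2 :: "nat \<Rightarrow> nat \<Rightarrow> (nat, 'k::field) free_alg" where
  "word2 i j = Poly_Mapping.single (Word [i, j]) 1"

lemma lookup_word2: "Poly_Mapping.lookup (word2 i j) (Word [k, l]) = (if i = k \<and> j = l then 1 else 0)"
  by (auto simp: word2_def lookup_single when_def)

lemma gen_mult_gen: "gen i * gen j = word2 i j"
  by (simp add: gen_def word2_def mult_single)

lemma sum_1_4: "(\<Sum>i = 1..4. h i) = h 1 + (h 2 + (h 3 + h (4 :: nat)))"
proof -
  have "{1..4 :: nat} = {1, 2, 3, 4}" by auto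
  then show ?thesis by simp
qed

lemma pairing_word2:
  assumes "i \<in> {1..4}" "j \<in> {1..4}"
  shows "pairing f (word2 i j) = Poly_Mapping.lookup f (Word [i, j])"
proof -
  have "pairing f (word2 i j) = (\<Sum>k = 1..4. \<Sum>l = 1..4. if l = j then (if k = i then Poly_Mapping.lookup f (Word [k, l]) else 0) else 0)"
    unfolding pairing_def lookup_word2 by (intro sum.cong) auto
  then show ?thesis using assms by simp
qed

lemma pairing_add: "pairing f (r + s) = pairing f r + pairing f s"
  and pairing_diff: "pairing f (r - s) = pairing f r - pairing f s"
  by (simp_all add: pairing_def lookup_add lookup_minus algebra_simps sum.distrib sum_subtractf)

lemma dual_relations_R:
  "f \<in> dual_relations R_relations \<longleftrightarrow> quadratic f \<and>
    Poly_Mapping.lookup f (Word [2, 1]) = - Poly_Mapping.lookup f (Word [1, 2]) \<and>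
    Poly_Mapping.lookup f (Word [4, 2]) = - Poly_Mapping.lookup f (Word [1, 3]) \<and>
    Poly_Mapping.lookup f (Word [3, 2]) = Poly_Mapping.lookup f (Word [1, 4]) \<and>
    Poly_Mapping.lookup f (Word [4, 1]) = Poly_Mapping.lookup f (Word [2, 3]) \<and>
    Poly_Mapping.lookup f (Word [3, 1]) = - Poly_Mapping.lookup f (Word [2, 4]) \<and>
    Poly_Mapping.lookup f (Word [4, 3]) = - Poly_Mapping.lookup f (Word [3, 4])"
  unfolding dual_relations_def R_relations_def gen_mult_gen
  by (auto simp: pairing_add pairing_diff pairing_word2 add_eq_0_iff)

text \<open>The six relations of the algebra involve disjoint pairs of words and no squares. The
  dual relations are therefore the four squares and, for each pair, the orthogonal
  combination.\<close>

definition rels :: "(nat, 'k::field) free_alg list" where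
  "rels = [word2 1 1, word2 2 2, word2 3 3, word2 4 4, word2 1 2 - word2 2 1, word2 1 3 - word2 4 2,
     word2 1 4 + word2 3 2, word2 2 3 + word2 4 1, word2 2 4 - word2 3 1, word2 3 4 - word2 4 3]"

lemma length_rels [simp]: "length rels = 10"
  by (simp add: rels_def)

lemma rels_nth:
  "rels ! 0 = word2 1 1" "rels ! Suc 0 = word2 2 2" "rels ! 2 = word2 3 3" "rels ! 3 = word2 4 4"
  "rels ! 4 = word2 1 2 - word2 2 1" "rels ! 5 = word2 1 3 - word2 4 2" "rels ! 6 = word2 1 4 + word2 3 2"
  "rels ! 7 = word2 2 3 + word2 4 1" "rels ! 8 = word2 2 4 - word2 3 1" "rels ! 9 = word2 3 4 - word2 4 3"
  by (simp_all add: rels_def)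

lemma quadratic_word2: "i \<in> {1..4} \<Longrightarrow> j \<in> {1..4} \<Longrightarrow> quadratic (word2 i j)"
  by (simp add: quadratic_def word2_def)

lemma quadratic_add: "quadratic f \<Longrightarrow> quadratic g \<Longrightarrow> quadratic (f + g)"
  using Poly_Mapping.keys_add[of f g] unfolding quadratic_def by blast

lemma quadratic_diff: "quadratic f \<Longrightarrow> quadratic g \<Longrightarrow> quadratic (f - g)"
  using quadratic_add[of f "- g"] by (simp add: quadratic_def)

lemma rels_dual: "set rels \<subseteq> dual_relations R_relations"
  unfolding rels_def
  by (auto simp: dual_relations_R lookup_add lookup_minus lookup_word2
      intro!: quadratic_add quadratic_diff quadratic_word2)

section \<open>The matrices over the ground field\<close>

definition lin :: "(nat, 'k::field) free_alg \<Rightarrow> (nat \<Rightarrow> 'k) \<Rightarrow> nat \<Rightarrow> 'k" where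
  "lin f w j = (\<Sum>k = 1..4. Poly_Mapping.lookup f (Word [k, j]) * w k)"

definition entry :: "(nat \<Rightarrow> 'k) \<Rightarrow> (nat \<Rightarrow> 'k) \<Rightarrow> (nat, 'k::field) free_alg \<Rightarrow> nat \<Rightarrow> 'k" where
  "entry u v f j = (if j < 4 then lin f u (j + 1) else lin f v (j - 3))"

text \<open>The rows are arbitrary elements of the free algebra, not entries of a fixed list, so
  that they can be varied linearly when the basis is changed.\<close>

definition row_matrix :: "(nat \<Rightarrow> 'k) \<Rightarrow> (nat \<Rightarrow> 'k) \<Rightarrow> (nat \<Rightarrow> (nat, 'k::field) free_alg) \<Rightarrow> 'k mat" where
  "row_matrix u v r = mat 8 8 (\<lambda>(i, j). entry u v (r i) j)"

lemma row_matrix_carrier: "row_matrix u v r \<in> carrier_mat 8 8"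
  by (simp add: row_matrix_def)

lemma row_matrix_cong: "(\<And>i. i < 8 \<Longrightarrow> r i = s i) \<Longrightarrow> row_matrix u v r = row_matrix u v s"
  unfolding row_matrix_def by (rule cong_mat) auto

lemma comm_ring_hom_eval: "comm_ring_hom (eval x)"
  by unfold_locales (simp_all add: eval_simps)

lemma minor_rowsD:
  assumes "S \<in> minor_rows"
  shows "finite S" "length (sorted_list_of_set S) = 8" "\<And>i. i < 8 \<Longrightarrow> sorted_list_of_set S ! i \<in> S"
    "\<And>i. i < 8 \<Longrightarrow> sorted_list_of_set S ! i < 10"
proof -
  show fin: "finite S" using assms by (auto simp: minor_rows_def intro: finite_subset)
  show len: "length (sorted_list_of_set S) = 8" using assms by (simp add: minor_rows_def)
  show mem: "sorted_list_of_set S ! i \<in> S" if "i < 8" for i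
    using nth_mem[of i "sorted_list_of_set S"] fin len that by simp
  show "sorted_list_of_set S ! i < 10" if "i < 8" for i
    using mem[OF that] assms by (auto simp: minor_rows_def)
qed

lemma eval_minor8:
  assumes "S \<in> minor_rows"
  shows "eval (case_uv u v) (minor8 fs S) =
    Determinant.det (row_matrix u v (\<lambda>i. fs ! (sorted_list_of_set S ! i)))"
proof -
  interpret h: comm_ring_hom "eval (case_uv u v)" by (rule comm_ring_hom_eval)
  have "eval (case_uv u v) (minor8 fs S) = Determinant.det (map_mat (eval (case_uv u v))
      (mat 8 8 (\<lambda>(i, j). uv_matrix fs $$ (sorted_list_of_set S ! i, j))))"
    unfolding minor8_def by simp
  also have "map_mat (eval (case_uv u v)) (mat 8 8 (\<lambda>(i, j). uv_matrix fs $$ (sorted_list_of_set S ! i, j))) =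
      row_matrix u v (\<lambda>i. fs ! (sorted_list_of_set S ! i))"
    by (rule eq_matI) (auto simp: row_matrix_def entry_def lin_def uv_matrix_def hat_M_def eval_simps minor_rowsD(4)[OF assms])
  finally show ?thesis .
qed

text \<open>The Pluecker coordinates of the pair \<open>u\<close>, \<open>v\<close>, as values of
  the forms \<open>N_form\<close>.\<close>

definition npt :: "(nat \<Rightarrow> 'k::field) \<Rightarrow> (nat \<Rightarrow> 'k) \<Rightarrow> plucker \<Rightarrow> 'k" where
  "npt u v q = eval (case_uv u v) (N_form q)"

lemma npt_simps [simp]:
  "npt u v M12 = u 1 * v 2 - u 2 * v 1" "npt u v M13 = u 1 * v 3 - u 3 * v 1" "npt u v M14 = u 1 * v 4 - u 4 * v 1"
  "npt u v M23 = u 2 * v 3 - u 3 * v 2" "npt u v M24 = u 2 * v 4 - u 4 * v 2" "npt u v M34 = u 3 * v 4 - u 4 * v 3"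
  by (simp_all add: npt_def N_uv_def eval_simps)

lemma eval_npt: "eval (npt u v) f = eval (case_uv u v) (subst N_form f)"
  by (simp add: eval_subst npt_def[abs_def])

text \<open>The rows of the matrices kill the vector \<open>(a, b)\<close> if and only if the tensor \<open>u \<otimes> a + v \<otimes> b\<close> is
  a relation of the algebra.\<close>

lemma det_row_matrix_zero:
  fixes u v a b :: "nat \<Rightarrow> 'k::field"
  assumes r: "\<And>i. i < 8 \<Longrightarrow> r i \<in> dual_relations R_relations"
    and t: "\<And>k j. t k j = u k * a j + v k * b j"
    and R: "t 1 1 = 0" "t 2 2 = 0" "t 3 3 = 0" "t 4 4 = 0" "t 2 1 = t 1 2" "t 4 2 = t 1 3" "t 3 2 = - t 1 4"
      "t 4 1 = - t 2 3" "t 3 1 = t 2 4" "t 4 3 = t 3 4"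
    and nz: "\<exists>j\<in>{1..4}. a j \<noteq> 0"
  shows "Determinant.det (row_matrix u v r) = 0"
proof -
  define w where "w = vec 8 (\<lambda>j. if j < 4 then a (j + 1) else b (j - 3))"
  have w: "w \<in> carrier_vec 8" by (simp add: w_def)
  obtain j where j: "j \<in> {1..4}" "a j \<noteq> 0" using nz by blast
  obtain k where k: "j = k + 1" "k < 4" using j(1) by (intro that[of "j - 1"]) auto
  then have "w $ k \<noteq> 0" using j(2) by (simp add: w_def)
  then have "w \<noteq> 0\<^sub>v 8" using k by auto
  moreover have "row_matrix u v r *\<^sub>v w = 0\<^sub>v 8"
  proof (rule eq_vecI)
    fix i assume "i < dim_vec (0\<^sub>v 8 :: 'k vec)"
    then have i: "i < 8" by simp
    define F where "F k j = Poly_Mapping.lookup (r i) (Word [k, j])" for k j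
    have F: "F 2 1 = - F 1 2" "F 4 2 = - F 1 3" "F 3 2 = F 1 4" "F 4 1 = F 2 3" "F 3 1 = - F 2 4" "F 4 3 = - F 3 4"
      using r[OF i] by (simp_all add: dual_relations_R F_def)
    have idx: "{0..<8 :: nat} = {0, 1, 2, 3, 4, 5, 6, 7}" by auto
    have "(row_matrix u v r *\<^sub>v w) $ i = (\<Sum>j = 0..<8. entry u v (r i) j * w $ j)"
      using i by (simp add: row_matrix_def scalar_prod_def w_def)
    also have "\<dots> = (\<Sum>j = 1..4. lin (r i) u j * a j + lin (r i) v j * b j)"
      unfolding sum_1_4 idx by (simp add: entry_def w_def eval_nat_numeral)
    also have "\<dots> = F 1 1 * t 1 1 + F 1 2 * t 1 2 + F 1 3 * t 1 3 + F 1 4 * t 1 4 +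
        F 2 1 * t 2 1 + F 2 2 * t 2 2 + F 2 3 * t 2 3 + F 2 4 * t 2 4 +
        F 3 1 * t 3 1 + F 3 2 * t 3 2 + F 3 3 * t 3 3 + F 3 4 * t 3 4 +
        F 4 1 * t 4 1 + F 4 2 * t 4 2 + F 4 3 * t 4 3 + F 4 4 * t 4 4"
      unfolding lin_def sum_1_4 t F_def[symmetric] by (simp add: algebra_simps)
    also have "\<dots> = 0" unfolding R F by simp
    finally show "(row_matrix u v r *\<^sub>v w) $ i = 0\<^sub>v 8 $ i" using i by simp
  qed (simp add: row_matrix_def)
  ultimately show ?thesis using det_0_iff_vec_prod_zero[OF row_matrix_carrier] w by blast
qed

definition vec4 :: "'k \<Rightarrow> 'k \<Rightarrow> 'k \<Rightarrow> 'k \<Rightarrow> nat \<Rightarrow> 'k" where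
  "vec4 a b c d k = (if k = 1 then a else if k = 2 then b else if k = 3 then c else d)"

lemma vec4_simps [simp]: "vec4 a b c d 1 = a" "vec4 a b c d (Suc 0) = a" "vec4 a b c d 2 = b" "vec4 a b c d 3 = c" "vec4 a b c d 4 = d"
  by (simp_all add: vec4_def)

text \<open>The dual Pluecker coordinates: the values of the coordinates \<open>M\<close> on the
  line through \<open>u\<close> and \<open>v\<close> after the substitution \<open>M_of_N\<close>,
  which is an involution.\<close>

definition mpt :: "(nat \<Rightarrow> 'k::field) \<Rightarrow> (nat \<Rightarrow> 'k) \<Rightarrow> plucker \<Rightarrow> 'k" where
  "mpt u v = plucker_fun (npt u v M34) (- npt u v M24) (npt u v M23) (npt u v M14) (- npt u v M13) (npt u v M12)"

lemma eval_M_of_N: "eval (npt u v) (M_of_N q) = mpt u v q"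
  by (cases q) (simp_all add: mpt_def eval_simps)

lemma M_of_N_mpt: "(\<lambda>q. eval (mpt u v) (M_of_N q)) = npt u v"
proof
  fix q
  show "eval (mpt u v) (M_of_N q) = npt u v q" by (cases q) (simp_all add: mpt_def eval_simps)
qed

lemma M_of_N_plucker: "subst M_of_N plucker_poly = (plucker_poly :: (plucker, 'k::field_char_0) mpoly)"
  by (simp add: plucker_poly_def subst_simps algebra_simps)

lemma M_of_N_M_of_N: "subst M_of_N (subst M_of_N f) = (f :: (plucker, 'k::field_char_0) mpoly)"
proof -
  have "subst M_of_N (M_of_N q) = (var q :: (plucker, 'k) mpoly)" for q
    by (cases q) (simp_all add: subst_simps)
  then show ?thesis by (simp add: subst_subst subst_var_id)
qed

lemma surface_cone_linked: "surface_cone X \<Longrightarrow> linked X"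
  by (simp add: surface_cone_def)

text \<open>On every surface a dense set of lines comes with an explicit relation of rank two.\<close>

lemma surface_vanishing:
  fixes f :: "(plucker, 'k::field_char_0) mpoly"
  assumes X: "X \<in> surfaces"
    and f: "\<And>(u :: nat \<Rightarrow> 'k) v (a :: nat \<Rightarrow> 'k) b t. (\<And>k j. t k j = u k * a j + v k * b j) \<Longrightarrow>
      t 1 1 = 0 \<Longrightarrow> t 2 2 = 0 \<Longrightarrow> t 3 3 = 0 \<Longrightarrow> t 4 4 = 0 \<Longrightarrow> t 2 1 = t 1 2 \<Longrightarrow> t 4 2 = t 1 3 \<Longrightarrow> t 3 2 = - t 1 4 \<Longrightarrow>
      t 4 1 = - t 2 3 \<Longrightarrow> t 3 1 = t 2 4 \<Longrightarrow> t 4 3 = t 3 4 \<Longrightarrow> \<exists>j\<in>{1..4}. a j \<noteq> 0 \<Longrightarrow> eval (mpt u v) f = (0 :: 'k)"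
  shows "f \<in> Van X"
proof -
  define T :: "(nat \<Rightarrow> 'k) \<Rightarrow> (nat \<Rightarrow> 'k) \<Rightarrow> (nat \<Rightarrow> 'k) \<Rightarrow> (nat \<Rightarrow> 'k) \<Rightarrow> bool" where
    "T u v a b \<longleftrightarrow> (\<forall>k\<in>{1, 2, 3, 4}. u k * a k + v k * b k = 0) \<and>
      u 2 * a 1 + v 2 * b 1 = u 1 * a 2 + v 1 * b 2 \<and> u 4 * a 2 + v 4 * b 2 = u 1 * a 3 + v 1 * b 3 \<and>
      u 3 * a 2 + v 3 * b 2 = - (u 1 * a 4 + v 1 * b 4) \<and> u 4 * a 1 + v 4 * b 1 = - (u 2 * a 3 + v 2 * b 3) \<and>
      u 3 * a 1 + v 3 * b 1 = u 2 * a 4 + v 2 * b 4 \<and> u 4 * a 3 + v 4 * b 3 = u 3 * a 4 + v 3 * b 4 \<and>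
      (a 1 \<noteq> 0 \<or> a 2 \<noteq> 0 \<or> a 3 \<noteq> 0 \<or> a 4 \<noteq> 0)" for u v a b
  have line: "eval x f = 0" if x: "\<forall>q. x q = mpt u v q" and t: "T u v a b" for x u v a b
  proof -
    have "\<exists>j\<in>{1..4}. a j \<noteq> 0" using t by (auto simp: T_def)
    then have "eval (mpt u v) f = 0"
      using t by (intro f[of "\<lambda>k j. u k * a j + v k * b j" u a v b]) (simp_all add: T_def)
    moreover have "x = mpt u v" using x by auto
    ultimately show ?thesis by simp
  qed
  \<comment> \<open>It is enough to treat points off the hyperplane where coordinate
    \<open>q\<close> vanishes: \<open>Van\<close> is prime and does not contain
    \<open>var q\<close>.\<close>
  have dense: "f \<in> Van (zeros G)" if G: "linked (zeros G)" "y \<in> zeros G" "y q \<noteq> 0"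
    and fx: "\<And>x. x \<in> zeros G \<Longrightarrow> x q \<noteq> 0 \<Longrightarrow> eval x f = 0" for G :: "(plucker, 'k) mpoly set" and y q
  proof -
    have "eval x (var q * f) = 0" if "x \<in> zeros G" for x
      using fx[OF that] by (cases "x q = 0") (simp_all add: eval_simps)
    then have "var q * f \<in> Van (zeros G)" by (simp add: Van_def)
    moreover have "var q \<notin> Van (zeros G)" using G by (auto simp: Van_def)
    ultimately show ?thesis using prime_ideal_Van[OF G(1)] by (auto simp: prime_ideal_def)
  qed
  have linked: "linked (zeros G5 :: (plucker \<Rightarrow> 'k) set)" "linked (zeros G6 :: (plucker \<Rightarrow> 'k) set)" "linked (zeros G7 :: (plucker \<Rightarrow> 'k) set)"
    by (rule surface_cone_linked, rule quadric_surface_cone, rule charts charts')+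
  \<comment> \<open>On each of the four planes all lines pass through a fixed point, the vector
    \<open>v\<close>, so a second point and the relation can be given for every \<open>x\<close>
    without denominators.\<close>
  have "f \<in> Van (zeros G1)"
    unfolding Van_def
  proof (intro CollectI ballI)
    fix x :: "plucker \<Rightarrow> 'k" assume "x \<in> zeros G1"
    then show "eval x f = 0"
      by (intro line[of x "vec4 (- x M34) 0 (x M14) (- x M13)" "vec4 1 (- 1) 0 0" "vec4 1 1 0 0"
          "vec4 (x M34) 0 (- x M13) (- x M14)"])
        (auto simp: all_plucker mpt_def zeros_G T_def)
  qed
  moreover have "f \<in> Van (zeros G2)"
    unfolding Van_def
  proof (intro CollectI ballI)
    fix x :: "plucker \<Rightarrow> 'k" assume "x \<in> zeros G2"
    then show "eval x f = 0"
      by (intro line[of x "vec4 (x M34) 0 (- x M14) (x M13)" "vec4 1 1 0 0" "vec4 1 (- 1) 0 0"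
          "vec4 (- x M34) 0 (- x M13) (- x M14)"])
        (auto simp: all_plucker mpt_def zeros_G T_def)
  qed
  moreover have "f \<in> Van (zeros G3)"
    unfolding Van_def
  proof (intro CollectI ballI)
    fix x :: "plucker \<Rightarrow> 'k" assume "x \<in> zeros G3"
    then show "eval x f = 0"
      by (intro line[of x "vec4 (- x M23) (x M13) (- x M12) 0" "vec4 0 0 1 (- 1)" "vec4 0 0 1 1"
          "vec4 (x M13) (x M23) (x M12) 0"])
        (auto simp: all_plucker mpt_def zeros_G T_def)
  qed
  moreover have "f \<in> Van (zeros G4)"
    unfolding Van_def
  proof (intro CollectI ballI)
    fix x :: "plucker \<Rightarrow> 'k" assume "x \<in> zeros G4"
    then show "eval x f = 0"
      by (intro line[of x "vec4 (x M23) (- x M13) (x M12) 0" "vec4 0 0 1 1" "vec4 0 0 1 (- 1)"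
          "vec4 (x M13) (x M23) (- x M12) 0"])
        (auto simp: all_plucker mpt_def zeros_G T_def)
  qed
  \<comment> \<open>These lines join a point with last two coordinates zero to a point with first
    two coordinates zero; \<open>M24\<close> serves to normalise the first one.\<close>
  moreover have "f \<in> Van (zeros G5)"
  proof (rule dense[OF linked(1), of "plucker_fun 0 0 0 0 1 0" M24])
    fix x :: "plucker \<Rightarrow> 'k" assume "x \<in> zeros G5" "x M24 \<noteq> 0"
    then show "eval x f = 0"
      by (intro line[of x "vec4 1 (- x M14 / x M24) 0 0" "vec4 0 0 (- x M24) (x M23)" "vec4 0 0 (x M23) (x M24)"
          "vec4 (x M14 / x M24) 1 0 0"])
        (auto simp: all_plucker mpt_def zeros_G T_def field_simps)
  qed (auto simp: zeros_G)
  \<comment> \<open>As \<open>M34\<close> is \<open>N12\<close>, its being nonzero allows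
    \<open>u\<close> and \<open>v\<close> to be reduced to diagonal form in their first two
    coordinates; the same is done for \<open>G7\<close>.\<close>
  moreover have "f \<in> Van (zeros G6)"
  proof (rule dense[OF linked(2), of "plucker_fun 0 0 0 0 0 1" M34])
    fix x :: "plucker \<Rightarrow> 'k" assume "x \<in> zeros G6" "x M34 \<noteq> 0"
    then show "eval x f = 0"
      by (intro line[of x "vec4 1 0 (- x M14 / x M34) (x M13 / x M34)" "vec4 0 (x M34) (- x M13) (x M14)"
          "vec4 0 (x M34) (x M13) (x M14)" "vec4 1 0 (- x M14 / x M34) (- x M13 / x M34)"])
        (auto simp: all_plucker mpt_def zeros_G T_def field_simps)
  qed (auto simp: zeros_G)
  moreover have "f \<in> Van (zeros G7)"
  proof (rule dense[OF linked(3), of "plucker_fun 0 0 0 0 0 1" M34])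
    fix x :: "plucker \<Rightarrow> 'k" assume "x \<in> zeros G7" "x M34 \<noteq> 0"
    then show "eval x f = 0"
      by (intro line[of x "vec4 1 0 (- x M14 / x M34) (x M13 / x M34)" "vec4 0 (x M34) (x M13) (- x M14)"
          "vec4 0 (x M34) (x M13) (x M14)" "vec4 1 0 (x M14 / x M34) (x M13 / x M34)"])
        (auto simp: all_plucker mpt_def zeros_G T_def field_simps)
  qed (auto simp: zeros_G)
  ultimately show ?thesis using X unfolding surfaces_def by blast
qed

section \<open>Sparse determinants\<close>

fun delete_at :: "nat \<Rightarrow> 'a list \<Rightarrow> 'a list" where
  "delete_at j [] = []"
| "delete_at 0 (x # xs) = xs"
| "delete_at (Suc j) (x # xs) = x # delete_at j xs"

lemma delete_at_numeral: "delete_at (numeral k) (x # xs) = x # delete_at (pred_numeral k) xs"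
  by (simp add: numeral_eq_Suc)

lemma length_delete_at: "j < length xs \<Longrightarrow> length (delete_at j xs) = length xs - 1"
  by (induction j xs rule: delete_at.induct) auto

lemma nth_delete_at: "i < length xs - 1 \<Longrightarrow> j < length xs \<Longrightarrow> delete_at j xs ! i = xs ! (if i < j then i else Suc i)"
proof (induction j xs arbitrary: i rule: delete_at.induct)
  case (3 j x xs)
  then show ?case by (cases i) (auto split: if_splits)
qed auto

definition entry_val :: "'a::zero option \<Rightarrow> 'a" where
  "entry_val x = (case x of None \<Rightarrow> 0 | Some a \<Rightarrow> a)"

text \<open>Laplace expansion along the first row of a matrix whose zero entries are written \<open>None\<close>, so
  that the simplifier skips them without evaluating the cofactor.\<close>

function sparse_det :: "'a::comm_ring_1 option list list \<Rightarrow> 'a" where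
  "sparse_det [] = 1"
| "sparse_det (r # rs) = (\<Sum>(j, x)\<leftarrow>List.enumerate 0 r.
     case x of None \<Rightarrow> 0 | Some a \<Rightarrow> (- 1) ^ j * a * sparse_det (map (delete_at j) rs))"
  by pat_completeness auto
termination by (relation "measure length") auto

definition expand_row :: "'a::comm_ring_1 option list \<Rightarrow> nat \<Rightarrow> 'a option list list \<Rightarrow> 'a" where
  "expand_row r j rs = (\<Sum>(j, x)\<leftarrow>List.enumerate j r.
     case x of None \<Rightarrow> 0 | Some a \<Rightarrow> (- 1) ^ j * a * sparse_det (map (delete_at j) rs))"

lemma sparse_det_Cons: "sparse_det (r # rs) = expand_row r 0 rs"
  by (simp only: expand_row_def sparse_det.simps)

lemma expand_row_simps:
  "expand_row [] j rs = 0"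
  "expand_row (None # r) j rs = expand_row r (Suc j) rs"
  "expand_row (Some a # r) j rs = (- 1) ^ j * a * sparse_det (map (delete_at j) rs) + expand_row r (Suc j) rs"
  by (simp_all only: expand_row_def enumerate_simps list.map sum_list.Nil sum_list.Cons prod.case option.case add_0_left)

lemma sparse_det_correct:
  "length rs = n \<Longrightarrow> (\<forall>r\<in>set rs. length r = n) \<Longrightarrow>
    sparse_det rs = Determinant.det (mat n n (\<lambda>(i, j). entry_val (rs ! i ! j)))"
proof (induction n arbitrary: rs)
  case 0
  then show ?case by (simp add: det_dim_zero)
next
  case (Suc n)
  then obtain r rs' where rs: "rs = r # rs'" by (cases rs) auto
  have len: "length rs' = n" "length r = Suc n" "\<And>i. i < n \<Longrightarrow> length (rs' ! i) = Suc n"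
    using Suc.prems by (auto simp: rs)
  let ?A = "mat (Suc n) (Suc n) (\<lambda>(i, j). entry_val (rs ! i ! j))"
  have cof: "cofactor ?A 0 j = (- 1) ^ j * sparse_det (map (delete_at j) rs')" if "j < Suc n" for j
  proof -
    have "mat_delete ?A 0 j = mat n n (\<lambda>(i, k). entry_val (map (delete_at j) rs' ! i ! k))"
      unfolding mat_delete_def
      by (rule eq_matI) (use that len in \<open>auto simp: rs nth_delete_at\<close>)
    moreover have "sparse_det (map (delete_at j) rs') =
        Determinant.det (mat n n (\<lambda>(i, k). entry_val (map (delete_at j) rs' ! i ! k)))"
      using Suc.prems that by (intro Suc.IH) (auto simp: rs length_delete_at)
    ultimately show ?thesis by (simp add: cofactor_def)
  qed
  have "Determinant.det ?A = (\<Sum>j<Suc n. ?A $$ (0, j) * cofactor ?A 0 j)"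
    by (rule laplace_expansion_row) auto
  also have "\<dots> = (\<Sum>j<Suc n. entry_val (r ! j) * ((- 1) ^ j * sparse_det (map (delete_at j) rs')))"
    by (rule sum.cong) (use cof in \<open>auto simp: rs\<close>)
  also have "\<dots> = (\<Sum>j<Suc n. case r ! j of None \<Rightarrow> 0 | Some a \<Rightarrow> (- 1) ^ j * a * sparse_det (map (delete_at j) rs'))"
    by (rule sum.cong) (auto simp: entry_val_def mult_ac split: option.split)
  also have "\<dots> = sparse_det rs"
    unfolding rs sparse_det.simps sum_list_sum_nth
    by (intro sum.cong) (auto simp: len nth_enumerate_eq lessThan_atLeast0)
  finally show ?case by simp
qed

definition sparse_row :: "(nat \<Rightarrow> 'k) \<Rightarrow> (nat \<Rightarrow> 'k) \<Rightarrow> nat \<Rightarrow> 'k::field option list" where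
  "sparse_row u v a = [
    [Some (u 1), None, None, None, Some (v 1), None, None, None],
    [None, Some (u 2), None, None, None, Some (v 2), None, None],
    [None, None, Some (u 3), None, None, None, Some (v 3), None],
    [None, None, None, Some (u 4), None, None, None, Some (v 4)],
    [Some (- u 2), Some (u 1), None, None, Some (- v 2), Some (v 1), None, None],
    [None, Some (- u 4), Some (u 1), None, None, Some (- v 4), Some (v 1), None],
    [None, Some (u 3), None, Some (u 1), None, Some (v 3), None, Some (v 1)],
    [Some (u 4), None, Some (u 2), None, Some (v 4), None, Some (v 2), None],
    [Some (- u 3), None, None, Some (u 2), Some (- v 3), None, None, Some (v 2)],
    [None, None, Some (- u 4), Some (u 3), None, None, Some (- v 4), Some (v 3)]] ! a"

lemma nat_less_10: "a < 10 \<Longrightarrow> a \<in> {0, 1, 2, 3, 4, 5, 6, 7, 8, 9 :: nat}"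
  by auto

lemma entry_rels:
  assumes "a < 10" "j < 8"
  shows "entry u v (rels ! a) j = entry_val (sparse_row u v a ! j)"
proof -
  have j: "j \<in> {0, 1, 2, 3, 4, 5, 6, 7}" using assms(2) by auto
  have lin: "lin (rels ! a) w 1 = [w 1, 0, 0, 0, - w 2, 0, 0, w 4, - w 3, 0] ! a \<and>
      lin (rels ! a) w 2 = [0, w 2, 0, 0, w 1, - w 4, w 3, 0, 0, 0] ! a \<and>
      lin (rels ! a) w 3 = [0, 0, w 3, 0, 0, w 1, 0, w 2, 0, - w 4] ! a \<and>
      lin (rels ! a) w 4 = [0, 0, 0, w 4, 0, 0, w 1, 0, w 2, w 3] ! a" for w
    using nat_less_10[OF assms(1)] unfolding lin_def sum_1_4
    by (elim insertE emptyE; simp add: rels_nth lookup_word2 lookup_add lookup_minus)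
  show ?thesis
    using nat_less_10[OF assms(1)] j lin[of u] lin[of v]
    by (elim insertE emptyE; simp add: entry_def sparse_row_def entry_val_def eval_nat_numeral)
qed

lemma length_sparse_row:
  assumes "a < 10"
  shows "length (sparse_row u v a) = 8"
  using nat_less_10[OF assms] by (elim insertE emptyE; simp add: sparse_row_def)

lemma det_rels:
  assumes "length l = 8" "\<forall>a\<in>set l. a < 10"
  shows "Determinant.det (row_matrix u v (\<lambda>i. rels ! (l ! i))) = sparse_det (map (sparse_row u v) l)"
proof -
  have "row_matrix u v (\<lambda>i. rels ! (l ! i)) = mat 8 8 (\<lambda>(i, j). entry_val (map (sparse_row u v) l ! i ! j))"
    unfolding row_matrix_def by (rule eq_matI) (use assms in \<open>auto simp: entry_rels\<close>)
  moreover have "sparse_det (map (sparse_row u v) l) =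
      Determinant.det (mat 8 8 (\<lambda>(i, j). entry_val (map (sparse_row u v) l ! i ! j)))"
    by (rule sparse_det_correct) (use assms in \<open>auto simp: length_sparse_row\<close>)
  ultimately show ?thesis by simp
qed

lemma sparse_row_simps:
  "sparse_row u v 0 = [Some (u 1), None, None, None, Some (v 1), None, None, None]"
  "sparse_row u v (Suc 0) = [None, Some (u 2), None, None, None, Some (v 2), None, None]"
  "sparse_row u v 2 = [None, None, Some (u 3), None, None, None, Some (v 3), None]"
  "sparse_row u v 3 = [None, None, None, Some (u 4), None, None, None, Some (v 4)]"
  "sparse_row u v 4 = [Some (- u 2), Some (u 1), None, None, Some (- v 2), Some (v 1), None, None]"
  "sparse_row u v 5 = [None, Some (- u 4), Some (u 1), None, None, Some (- v 4), Some (v 1), None]"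
  "sparse_row u v 6 = [None, Some (u 3), None, Some (u 1), None, Some (v 3), None, Some (v 1)]"
  "sparse_row u v 7 = [Some (u 4), None, Some (u 2), None, Some (v 4), None, Some (v 2), None]"
  "sparse_row u v 8 = [Some (- u 3), None, None, Some (u 2), Some (- v 3), None, None, Some (v 2)]"
  "sparse_row u v 9 = [None, None, Some (- u 4), Some (u 3), None, None, Some (- v 4), Some (v 3)]"
  by (simp_all add: sparse_row_def)

lemmas sparse_eval = sparse_row_simps sparse_det.simps(1) sparse_det_Cons expand_row_simps
  delete_at.simps delete_at_numeral list.map

definition rels_det :: "(nat \<Rightarrow> 'k) \<Rightarrow> (nat \<Rightarrow> 'k) \<Rightarrow> nat list \<Rightarrow> 'k::field" where
  "rels_det u v l = sparse_det (map (sparse_row u v) l)"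

text \<open>Certificates for the first cubic times each of the six variables; the lists name the
  rows of a minor. The identities are checked in the coordinates of \<open>u\<close> and
  \<open>v\<close>, where \<open>P\<close> vanishes, so correction terms that are multiples of
  \<open>P\<close> need not be written down.\<close>

lemma T_gens_dets_1:
  "eval (mpt u v) (var M12 * (var M13 * var M23 - var M14 * var M24) * var M12) =
    rels_det u v [1, 2, 3, 5, 6, 7, 8, 9]"
  "eval (mpt u v) (var M12 * (var M13 * var M23 - var M14 * var M24) * var M13) =
    rels_det u v [1, 2, 3, 4, 5, 6, 7, 9]"
  "eval (mpt u v) (var M12 * (var M13 * var M23 - var M14 * var M24) * var M14) =
    rels_det u v [1, 2, 3, 4, 5, 6, 8, 9]"
  "eval (mpt u v) (var M12 * (var M13 * var M23 - var M14 * var M24) * var M23) =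
    rels_det u v [0, 2, 3, 4, 5, 7, 8, 9]"
  "eval (mpt u v) (var M12 * (var M13 * var M23 - var M14 * var M24) * var M24) =
    rels_det u v [0, 2, 3, 4, 6, 7, 8, 9]"
  "eval (mpt u v) (var M12 * (var M13 * var M23 - var M14 * var M24) * var M34) =
    - rels_det u v [0, 1, 3, 5, 6, 7, 8, 9]"
  by ((simp add: rels_det_def sparse_eval mpt_def eval_simps del: sparse_det.simps(2); simp add: algebra_simps)+)

lemma T_gens_dets_2:
  "eval (mpt u v) (var M12 * (var M13 * var M13 + var M23 * var M23 - var M14 * var M14 - var M24 * var M24) * var M12) =
    - rels_det u v [2, 3, 4, 5, 6, 7, 8, 9]"
  "eval (mpt u v) (var M12 * (var M13 * var M13 + var M23 * var M23 - var M14 * var M14 - var M24 * var M24) * var M13) =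
    rels_det u v [1, 2, 3, 4, 5, 7, 8, 9] + rels_det u v [0, 2, 3, 4, 5, 7, 8, 9]"
  "eval (mpt u v) (var M12 * (var M13 * var M13 + var M23 * var M23 - var M14 * var M14 - var M24 * var M24) * var M14) =
    rels_det u v [1, 2, 3, 4, 6, 7, 8, 9] + rels_det u v [0, 2, 3, 4, 6, 7, 8, 9]"
  "eval (mpt u v) (var M12 * (var M13 * var M13 + var M23 * var M23 - var M14 * var M14 - var M24 * var M24) * var M23) =
    rels_det u v [1, 2, 3, 4, 5, 6, 7, 9] + rels_det u v [0, 2, 3, 4, 5, 6, 7, 9]"
  "eval (mpt u v) (var M12 * (var M13 * var M13 + var M23 * var M23 - var M14 * var M14 - var M24 * var M24) * var M24) =
    rels_det u v [1, 2, 3, 4, 5, 6, 8, 9] + rels_det u v [0, 2, 3, 4, 5, 6, 8, 9]"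
  "eval (mpt u v) (var M12 * (var M13 * var M13 + var M23 * var M23 - var M14 * var M14 - var M24 * var M24) * var M34) =
    - rels_det u v [1, 3, 4, 5, 6, 7, 8, 9] + rels_det u v [1, 2, 4, 5, 6, 7, 8, 9]"
  by ((simp add: rels_det_def sparse_eval mpt_def eval_simps del: sparse_det.simps(2); simp add: algebra_simps)+)

lemma T_gens_dets_3:
  "eval (mpt u v) (var M34 * (var M13 * var M14 - var M23 * var M24) * var M12) =
    rels_det u v [1, 2, 3, 4, 5, 6, 7, 8]"
  "eval (mpt u v) (var M34 * (var M13 * var M14 - var M23 * var M24) * var M13) =
    - rels_det u v [0, 1, 3, 4, 6, 7, 8, 9]"
  "eval (mpt u v) (var M34 * (var M13 * var M14 - var M23 * var M24) * var M14) =
    - rels_det u v [0, 1, 2, 4, 5, 7, 8, 9]"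
  "eval (mpt u v) (var M34 * (var M13 * var M14 - var M23 * var M24) * var M23) =
    - rels_det u v [0, 1, 3, 4, 5, 6, 8, 9]"
  "eval (mpt u v) (var M34 * (var M13 * var M14 - var M23 * var M24) * var M24) =
    - rels_det u v [0, 1, 2, 4, 5, 6, 7, 9]"
  "eval (mpt u v) (var M34 * (var M13 * var M14 - var M23 * var M24) * var M34) =
    - rels_det u v [0, 1, 3, 4, 5, 6, 7, 8]"
  by ((simp add: rels_det_def sparse_eval mpt_def eval_simps del: sparse_det.simps(2); simp add: algebra_simps)+)

lemma T_gens_dets_4:
  "eval (mpt u v) (var M34 * (var M13 * var M13 + var M14 * var M14 - var M23 * var M23 - var M24 * var M24) * var M12) =
    rels_det u v [1, 3, 4, 5, 6, 7, 8, 9] + rels_det u v [1, 2, 4, 5, 6, 7, 8, 9]"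
  "eval (mpt u v) (var M34 * (var M13 * var M13 + var M14 * var M14 - var M23 * var M23 - var M24 * var M24) * var M13) =
    - rels_det u v [0, 1, 3, 4, 5, 7, 8, 9] - rels_det u v [0, 1, 2, 4, 5, 7, 8, 9]"
  "eval (mpt u v) (var M34 * (var M13 * var M13 + var M14 * var M14 - var M23 * var M23 - var M24 * var M24) * var M14) =
    - rels_det u v [0, 1, 3, 4, 6, 7, 8, 9] - rels_det u v [0, 1, 2, 4, 6, 7, 8, 9]"
  "eval (mpt u v) (var M34 * (var M13 * var M13 + var M14 * var M14 - var M23 * var M23 - var M24 * var M24) * var M23) =
    - rels_det u v [0, 1, 3, 4, 5, 6, 7, 9] - rels_det u v [0, 1, 2, 4, 5, 6, 7, 9]"
  "eval (mpt u v) (var M34 * (var M13 * var M13 + var M14 * var M14 - var M23 * var M23 - var M24 * var M24) * var M24) =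
    - rels_det u v [0, 1, 3, 4, 5, 6, 8, 9] - rels_det u v [0, 1, 2, 4, 5, 6, 8, 9]"
  "eval (mpt u v) (var M34 * (var M13 * var M13 + var M14 * var M14 - var M23 * var M23 - var M24 * var M24) * var M34) =
    - rels_det u v [0, 1, 4, 5, 6, 7, 8, 9]"
  by ((simp add: rels_det_def sparse_eval mpt_def eval_simps del: sparse_det.simps(2); simp add: algebra_simps)+)

section \<open>Change of basis of the dual relations\<close>

lemma module_scale: "Modules.module (scale :: 'k::field \<Rightarrow> (nat, 'k) free_alg \<Rightarrow> (nat, 'k) free_alg)"
  by unfold_locales
    (simp_all add: const_def algebra_simps single_add mult_single flip: mult.assoc)

lemma entry_add: "entry u v (f + g) j = entry u v f j + entry u v g j"
  by (simp add: entry_def lin_def lookup_add distrib_right sum.distrib)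

lemma entry_scale: "entry u v (scale c f) j = c * entry u v f j"
  by (simp add: entry_def lin_def lookup_const_mult sum_distrib_left mult.assoc)

lemma entry_zero: "entry u v 0 j = 0"
  by (simp add: entry_def lin_def)

text \<open>The Leibniz expansion with the factor of row \<open>k\<close> isolated, from which
  linearity in this row can be read off.\<close>

lemma det_row_matrix_update:
  assumes "k < 8"
  shows "Determinant.det (row_matrix u v (r(k := f))) = (\<Sum>p | p permutes {0..<8}.
    signof p * (entry u v f (p k) * (\<Prod>i\<in>{0..<8} - {k}. entry u v (r i) (p i))))"
  unfolding det_def'[OF row_matrix_carrier]
proof (rule sum.cong[OF refl])
  fix p assume "p \<in> {p. p permutes {0..<8 :: nat}}"
  then have p: "p i < 8" if "i < 8" for i using permutes_in_image[of p "{0..<8}" i] that by simp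
  have "(\<Prod>i = 0..<8. row_matrix u v (r(k := f)) $$ (i, p i)) = (\<Prod>i = 0..<8. entry u v ((r(k := f)) i) (p i))"
    by (rule prod.cong) (simp_all add: row_matrix_def p)
  also have "\<dots> = entry u v f (p k) * (\<Prod>i\<in>{0..<8} - {k}. entry u v ((r(k := f)) i) (p i))"
    using assms by (subst prod.remove[of _ k]) auto
  also have "(\<Prod>i\<in>{0..<8} - {k}. entry u v ((r(k := f)) i) (p i)) = (\<Prod>i\<in>{0..<8} - {k}. entry u v (r i) (p i))"
    by (rule prod.cong) auto
  finally show "signof p * (\<Prod>i = 0..<8. row_matrix u v (r(k := f)) $$ (i, p i)) =
      signof p * (entry u v f (p k) * (\<Prod>i\<in>{0..<8} - {k}. entry u v (r i) (p i)))" by (simp only:)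
qed

text \<open>Formulated for functions of \<open>u\<close> and \<open>v\<close> because a polynomial
  in the \<open>N\<close> variables representing such a function is determined only up to multiples
  of \<open>P\<close>.\<close>

definition minor_combination ::
  "(nat set \<Rightarrow> (plucker, 'k::field) mpoly) \<Rightarrow> ((nat \<Rightarrow> 'k) \<Rightarrow> (nat \<Rightarrow> 'k) \<Rightarrow> 'k) \<Rightarrow> bool" where
  "minor_combination G h \<longleftrightarrow> (\<exists>q\<in>ideal_gen (G ` minor_rows). \<forall>u v. eval (npt u v) q = h u v)"

lemma minor_combination_add:
  assumes "minor_combination G h" "minor_combination G k"
  shows "minor_combination G (\<lambda>u v. h u v + k u v)"
proof -
  obtain q where q: "q \<in> ideal_gen (G ` minor_rows)" "\<forall>u v. eval (npt u v) q = h u v"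
    using assms(1) unfolding minor_combination_def by (elim bexE)
  obtain q' where q': "q' \<in> ideal_gen (G ` minor_rows)" "\<forall>u v. eval (npt u v) q' = k u v"
    using assms(2) unfolding minor_combination_def by (elim bexE)
  show ?thesis unfolding minor_combination_def
    by (rule bexI[of _ "q + q'"]) (simp_all add: eval_simps q q' ideal_add)
qed

lemma minor_combination_scale:
  assumes "minor_combination G h"
  shows "minor_combination G (\<lambda>u v. c * h u v)"
proof -
  obtain q where q: "q \<in> ideal_gen (G ` minor_rows)" "\<forall>u v. eval (npt u v) q = h u v"
    using assms unfolding minor_combination_def by (elim bexE)
  show ?thesis unfolding minor_combination_def
    by (rule bexI[of _ "const c * q"]) (simp_all add: eval_simps q ideal_scale)
qed

lemma minor_combination_uminus: "minor_combination G h \<Longrightarrow> minor_combination G (\<lambda>u v. - h u v)"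
  using minor_combination_scale[of G h "- 1"] by simp

lemma minor_combination_diff:
  "minor_combination G h \<Longrightarrow> minor_combination G k \<Longrightarrow> minor_combination G (\<lambda>u v. h u v - k u v)"
  using minor_combination_add[of G h, OF _ minor_combination_uminus, of k] by simp

lemma minor_combination_zero: "minor_combination G (\<lambda>u v. 0)"
  unfolding minor_combination_def by (rule bexI[of _ 0]) (simp_all add: ideal_zero)

lemma minor_combination_minor:
  assumes "S \<in> minor_rows" "subst N_form (G S) = minor8 fs S"
  shows "minor_combination G (\<lambda>u v. Determinant.det (row_matrix u v (\<lambda>i. fs ! (sorted_list_of_set S ! i))))"
  unfolding minor_combination_def
  by (rule bexI[of _ "G S"]) (use assms in \<open>simp_all add: eval_npt eval_minor8 ideal_base\<close>)

text \<open>A repeated index makes the determinant zero. Otherwise the rows are a permutation of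
  those of a minor with increasing row indices, and only the sign changes.\<close>

lemma minor_combination_indices:
  fixes G :: "nat set \<Rightarrow> (plucker, 'k::field) mpoly"
  assumes G: "\<And>S. S \<in> minor_rows \<Longrightarrow> subst N_form (G S) = minor8 fs S"
    and \<rho>: "\<And>i. i < 8 \<Longrightarrow> \<rho> i < 10"
  shows "minor_combination G (\<lambda>u v. Determinant.det (row_matrix u v (\<lambda>i. fs ! \<rho> i)))"
proof (cases "inj_on \<rho> {0..<8}")
  case False
  then obtain i j where ij: "i < 8" "j < 8" "i \<noteq> j" "\<rho> i = \<rho> j" by (auto simp: inj_on_def)
  have "Determinant.det (row_matrix u v (\<lambda>i. fs ! \<rho> i)) = 0" for u v
    by (rule det_identical_rows[OF row_matrix_carrier ij(3,1,2)])
      (use ij in \<open>auto simp: row_matrix_def intro!: eq_vecI\<close>)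
  then show ?thesis by (simp add: minor_combination_zero)
next
  case True
  define S where "S = \<rho> ` {0..<8}"
  define l where "l = sorted_list_of_set S"
  have S: "S \<in> minor_rows" using True \<rho> by (auto simp: S_def minor_rows_def card_image)
  have len: "length l = 8" using minor_rowsD(2)[OF S] by (simp add: l_def)
  have "bij_betw ((!) l) {..<length l} (set l)"
    by (rule bij_betw_nth) (simp_all add: l_def)
  then have bl: "bij_betw ((!) l) {0..<8} S"
    using len minor_rowsD(1)[OF S] by (simp add: l_def lessThan_atLeast0)
  have b\<rho>: "bij_betw \<rho> {0..<8} S" using True by (simp add: S_def bij_betw_def)
  define p where "p i = (if i \<in> {0..<8} then inv_into {0..<8} ((!) l) (\<rho> i) else i)" for i
  have "bij_betw (inv_into {0..<8} ((!) l) \<circ> \<rho>) {0..<8} {0..<8}"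
    by (rule bij_betw_trans[OF b\<rho> bij_betw_inv_into[OF bl]])
  then have "bij_betw p {0..<8} {0..<8}"
    by (rule bij_betw_cong[THEN iffD1, rotated]) (simp add: p_def)
  then have p: "p permutes {0..<8}" by (rule bij_imp_permutes) (auto simp: p_def)
  have lp: "l ! p i = \<rho> i" if "i < 8" for i
  proof -
    have "\<rho> i \<in> S" using that by (simp add: S_def)
    then show ?thesis using bij_betw_inv_into_right[OF bl, of "\<rho> i"] that by (simp add: p_def)
  qed
  have p8: "p i < 8" if "i < 8" for i using permutes_in_image[OF p, of i] that by simp
  have "row_matrix u v (\<lambda>i. fs ! \<rho> i) = mat 8 8 (\<lambda>(i, j). row_matrix u v (\<lambda>i. fs ! (l ! i)) $$ (p i, j))" for u v
    by (rule eq_matI) (auto simp: row_matrix_def p8 lp)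
  then have "Determinant.det (row_matrix u v (\<lambda>i. fs ! \<rho> i)) =
      signof p * Determinant.det (row_matrix u v (\<lambda>i. fs ! (l ! i)))" for u v
    using det_permute_rows[OF row_matrix_carrier p] by simp
  then show ?thesis
    using minor_combination_scale[OF minor_combination_minor[where G = G and S = S and fs = fs, OF S G[OF S]], of "signof p"] by (simp add: l_def)
qed

text \<open>The determinant is linear in every row, so the rows may be replaced one after the other by
  arbitrary elements of the span.\<close>

lemma minor_combination_rows:
  fixes G :: "nat set \<Rightarrow> (plucker, 'k::field) mpoly"
  assumes G: "\<And>S. S \<in> minor_rows \<Longrightarrow> subst N_form (G S) = minor8 fs S"
    and fs: "length fs = 10" "Modules.module.span scale (set fs) = D"
    and r: "\<And>i. i < 8 \<Longrightarrow> r i \<in> D"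
  shows "minor_combination G (\<lambda>u v. Determinant.det (row_matrix u v r))"
proof -
  have fsD: "set fs \<subseteq> D" unfolding fs(2)[symmetric] by (rule Modules.module.span_superset[OF module_scale])
  \<comment> \<open>The first \<open>k\<close> rows are already arbitrary elements of
    \<open>D\<close>, the others still come from \<open>fs\<close>.\<close>
  have "\<forall>r. (\<forall>i<8. r i \<in> D) \<longrightarrow> (\<forall>i<8. k \<le> i \<longrightarrow> r i \<in> set fs) \<longrightarrow>
      minor_combination G (\<lambda>u v. Determinant.det (row_matrix u v r))" if "k \<le> 8" for k
    using that
  proof (induction k)
    case 0
    show ?case
    proof (intro allI impI)
      fix r :: "nat \<Rightarrow> (nat, 'k) free_alg" assume "\<forall>i<8. 0 \<le> i \<longrightarrow> r i \<in> set fs"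
      then have "\<forall>i. \<exists>j. i < 8 \<longrightarrow> j < 10 \<and> r i = fs ! j" using fs(1) by (metis in_set_conv_nth le0)
      then obtain \<rho> where \<rho>: "\<forall>i. i < 8 \<longrightarrow> \<rho> i < 10 \<and> r i = fs ! \<rho> i" by (rule choice[THEN exE])
      then have "row_matrix u v r = row_matrix u v (\<lambda>i. fs ! \<rho> i)" for u v by (intro row_matrix_cong) simp
      then show "minor_combination G (\<lambda>u v. Determinant.det (row_matrix u v r))"
        using minor_combination_indices[of G fs \<rho>, OF G] \<rho> by simp
    qed
  next
    case (Suc k)
    then have k: "k < 8" by simp
    show ?case
    proof (intro allI impI)
      fix r :: "nat \<Rightarrow> (nat, 'k) free_alg"
      assume r: "\<forall>i<8. r i \<in> D" "\<forall>i<8. Suc k \<le> i \<longrightarrow> r i \<in> set fs"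
      \<comment> \<open>The admissible choices for row \<open>k\<close> form a subspace containing
        \<open>fs\<close>, hence contain its span \<open>D\<close>.\<close>
      define W where "W = {f. minor_combination G (\<lambda>u v. Determinant.det (row_matrix u v (r(k := f))))}"
      have "set fs \<subseteq> W"
      proof
        fix f assume f: "f \<in> set fs"
        have "\<forall>i<8. (r(k := f)) i \<in> D" using r(1) f fsD by auto
        moreover have "\<forall>i<8. k \<le> i \<longrightarrow> (r(k := f)) i \<in> set fs" using r(2) f by auto
        ultimately show "f \<in> W" using Suc k unfolding W_def by simp
      qed
      moreover have "Modules.module.subspace scale W"
        unfolding Modules.module.subspace_def[OF module_scale]
      proof (intro conjI ballI allI)
        show "0 \<in> W" by (simp add: W_def det_row_matrix_update[OF k] entry_zero minor_combination_zero)
        show "f + g \<in> W" if "f \<in> W" "g \<in> W" for f g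
        proof -
          have "Determinant.det (row_matrix u v (r(k := f + g))) =
              Determinant.det (row_matrix u v (r(k := f))) + Determinant.det (row_matrix u v (r(k := g)))" for u v
            unfolding det_row_matrix_update[OF k] entry_add sum.distrib[symmetric]
            by (rule sum.cong[OF refl]) (simp add: algebra_simps)
          then show ?thesis using that minor_combination_add[of G] by (simp add: W_def)
        qed
        show "scale c f \<in> W" if "f \<in> W" for c f
        proof -
          have "Determinant.det (row_matrix u v (r(k := scale c f))) =
              c * Determinant.det (row_matrix u v (r(k := f)))" for u v
            unfolding det_row_matrix_update[OF k] entry_scale sum_distrib_left
            by (rule sum.cong[OF refl]) (simp add: algebra_simps)
          then show ?thesis using that minor_combination_scale[of G] by (simp add: W_def)
        qed
      qed
      ultimately have "D \<subseteq> W"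
        unfolding fs(2)[symmetric] by (rule Modules.module.span_minimal[OF module_scale])
      then have "r k \<in> W" using r(1) k by blast
      then show "minor_combination G (\<lambda>u v. Determinant.det (row_matrix u v r))" by (simp add: W_def)
    qed
  qed
  from this[of 8] show ?thesis using r by simp
qed

section \<open>The ideal of the line scheme\<close>

text \<open>A point of the Pluecker quadric comes from a line: any nonzero coordinate serves as
  pivot for an explicit pair of vectors, and the zero vector comes from zero vectors.\<close>

lemma decomposable:
  fixes x :: "plucker \<Rightarrow> 'k::field"
  assumes "eval x plucker_poly = 0"
  shows "\<exists>u v. x = npt u v"
proof -
  have P: "x M12 * x M34 = x M13 * x M24 - x M14 * x M23" using assms by (simp add: eval_plucker algebra_simps)
  have I: ?thesis if "\<forall>q. x q = npt u v q" for u v using that by (intro exI[of _ u] exI[of _ v] ext) simp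
  consider "x M12 \<noteq> 0" | "x M13 \<noteq> 0" | "x M14 \<noteq> 0" | "x M23 \<noteq> 0" | "x M24 \<noteq> 0" | "x M34 \<noteq> 0" | "\<forall>q. x q = 0"
    by (auto simp: all_plucker)
  then show ?thesis
  proof cases
    case 1
    then show ?thesis
      by (intro I[of "vec4 1 0 (- x M23 / x M12) (- x M24 / x M12)" "vec4 0 (x M12) (x M13) (x M14)"])
        (use P in \<open>simp add: all_plucker field_simps\<close>)
  next
    case 2
    then show ?thesis
      by (intro I[of "vec4 1 (x M23 / x M13) 0 (- x M34 / x M13)" "vec4 0 (x M12) (x M13) (x M14)"])
        (use P in \<open>simp add: all_plucker field_simps\<close>)
  next
    case 3
    then show ?thesis
      by (intro I[of "vec4 1 (x M24 / x M14) (x M34 / x M14) 0" "vec4 0 (x M12) (x M13) (x M14)"])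
        (use P in \<open>simp add: all_plucker field_simps\<close>)
  next
    case 4
    then show ?thesis
      by (intro I[of "vec4 (x M13 / x M23) 1 0 (- x M34 / x M23)" "vec4 (- x M12) 0 (x M23) (x M24)"])
        (use P in \<open>simp add: all_plucker field_simps\<close>)
  next
    case 5
    then show ?thesis
      by (intro I[of "vec4 (x M14 / x M24) 1 (x M34 / x M24) 0" "vec4 (- x M12) 0 (x M23) (x M24)"])
        (use P in \<open>simp add: all_plucker field_simps\<close>)
  next
    case 6
    then show ?thesis
      by (intro I[of "vec4 (x M14 / x M34) (x M24 / x M34) 1 0" "vec4 (- x M13) (- x M23) 0 (x M34)"])
        (use P in \<open>simp add: all_plucker field_simps\<close>)
  next
    case 7
    then show ?thesis by (intro I[of "\<lambda>_. 0" "\<lambda>_. 0"]) (simp add: all_plucker)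
  qed
qed

text \<open>This is why the choice of the quartics is harmless: two expressions of the same minor
  differ by a multiple of \<open>P\<close>.\<close>

lemma kernel_N_form:
  fixes f :: "(plucker, 'k::field_char_0) mpoly"
  assumes "\<And>u v. eval (npt u v) f = 0"
  shows "f \<in> ideal_gen {plucker_poly}"
proof -
  have "var M12 * var M34 - (var M13 * var M24 - var M14 * var M23) = (plucker_poly :: (plucker, 'k) mpoly)"
    by (simp add: plucker_poly_def)
  moreover have "f \<in> ideal_gen {var M12 * var M34 - (var M13 * var M24 - var M14 * var M23)}"
  proof (rule vanishing_on_quadric)
    fix x :: "plucker \<Rightarrow> 'k" assume "x M12 * x M34 = eval x (var M13 * var M24 - var M14 * var M23)"
    then have "eval x plucker_poly = 0" by (simp add: eval_plucker eval_simps)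
    then obtain u v where "x = npt u v" using decomposable by blast
    then show "eval x f = 0" using assms by simp
  qed (auto intro!: free_of_diff free_of_mult free_of_var)
  ultimately show ?thesis by simp
qed

context
  fixes fs :: "(nat, 'k::field_char_0) free_alg list" and g :: "nat set \<Rightarrow> (plucker, 'k) mpoly" and I
  assumes fs: "dual_basis R_relations fs"
    and g: "\<And>S. S \<in> minor_rows \<Longrightarrow> subst N_form (g S) = minor8 fs S"
    and I: "I = ideal_gen (insert plucker_poly ((\<lambda>S. subst M_of_N (g S)) ` minor_rows))"
begin

text \<open>At the dual coordinates of a line, the substituted quartic takes the value of the minor
  itself, which is zero as soon as the line carries a relation of rank two.\<close>

lemma line_ideal_sub:
  assumes X: "X \<in> surfaces"
  shows "I \<subseteq> Van X"
  unfolding I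
proof (rule ideal_minimal[OF _ subspace_Van])
  have "set fs \<subseteq> Modules.module.span scale (set fs)" by (rule Modules.module.span_superset[OF module_scale])
  then have fsD: "set fs \<subseteq> dual_relations R_relations" and len: "length fs = 10"
    using fs by (simp_all add: dual_basis_def)
  have "subst M_of_N (g S) \<in> Van X" if S: "S \<in> minor_rows" for S
  proof (rule surface_vanishing[OF X])
    fix u v a b :: "nat \<Rightarrow> 'k" and t
    assume t: "\<And>k j. t k j = u k * a j + v k * b j" "t 1 1 = 0" "t 2 2 = 0" "t 3 3 = 0" "t 4 4 = 0"
      "t 2 1 = t 1 2" "t 4 2 = t 1 3" "t 3 2 = - t 1 4" "t 4 1 = - t 2 3" "t 3 1 = t 2 4" "t 4 3 = t 3 4"
      "\<exists>j\<in>{1..4}. a j \<noteq> 0"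
    have "eval (mpt u v) (subst M_of_N (g S)) = eval (case_uv u v) (minor8 fs S)"
      using g[OF S] by (simp add: eval_subst M_of_N_mpt flip: eval_npt)
        (simp add: eval_npt)
    also have "\<dots> = Determinant.det (row_matrix u v (\<lambda>i. fs ! (sorted_list_of_set S ! i)))"
      by (rule eval_minor8[OF S])
    also have "\<dots> = 0"
      by (rule det_row_matrix_zero[OF _ t]) (use fsD len minor_rowsD(4)[OF S] in \<open>auto intro: nth_mem\<close>)
    finally show "eval (mpt u v) (subst M_of_N (g S)) = 0" .
  qed
  moreover have "plucker_poly \<in> Van X"
    by (rule surface_vanishing[OF X]) (simp add: eval_plucker mpt_def algebra_simps)
  ultimately show "insert plucker_poly ((\<lambda>S. subst M_of_N (g S)) ` minor_rows) \<subseteq> Van X" by blast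
qed

text \<open>\<open>subst M_of_N h\<close> and \<open>q\<close> agree on all lines, so they differ by
  a multiple of \<open>P\<close>. Applying \<open>M_of_N\<close> again, which fixes
  \<open>P\<close>, recovers \<open>h\<close> as an element of \<open>I\<close>.\<close>

lemma minor_combination_in_ideal:
  assumes "minor_combination g (\<lambda>u v. eval (mpt u v) h)"
  shows "h \<in> I"
proof -
  obtain q where q: "q \<in> ideal_gen (g ` minor_rows)" "\<forall>u v. eval (npt u v) q = eval (mpt u v) h"
    using assms unfolding minor_combination_def by (elim bexE)
  have "subst M_of_N h - q \<in> ideal_gen {plucker_poly}"
    by (rule kernel_N_form) (simp add: eval_diff q(2) eval_subst eval_M_of_N)
  then have "subst M_of_N h - q \<in> ideal_gen (insert plucker_poly (g ` minor_rows))"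
    using ideal_mono[of "{plucker_poly}" "insert plucker_poly (g ` minor_rows)"] by blast
  moreover have "q \<in> ideal_gen (insert plucker_poly (g ` minor_rows))"
    using q(1) ideal_mono[of "g ` minor_rows" "insert plucker_poly (g ` minor_rows)"] by blast
  ultimately have "(subst M_of_N h - q) + q \<in> ideal_gen (insert plucker_poly (g ` minor_rows))"
    by (rule ideal_add)
  then have "subst M_of_N h \<in> ideal_gen (insert plucker_poly (g ` minor_rows))" by simp
  then have "subst M_of_N (subst M_of_N h) \<in> I"
    unfolding I by (rule subst_ideal) (auto simp: M_of_N_plucker intro: ideal_base)
  then show ?thesis by (simp add: M_of_N_M_of_N)
qed

lemma rels_det_minor_combination:
  assumes "length l = 8" "\<forall>a\<in>set l. a < 10"
  shows "minor_combination g (\<lambda>u v. rels_det u v l)"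
proof -
  have "minor_combination g (\<lambda>u v. Determinant.det (row_matrix u v (\<lambda>i. rels ! (l ! i))))"
  proof (rule minor_combination_rows[OF g])
    show "length fs = 10" "Modules.module.span scale (set fs) = dual_relations R_relations"
      using fs by (simp_all add: dual_basis_def)
    fix i assume "i < (8 :: nat)"
    then have "l ! i < 10" using assms by simp
    then show "rels ! (l ! i) \<in> dual_relations R_relations" using rels_dual nth_mem[of "l ! i" rels] by auto
  qed
  then show ?thesis by (simp add: det_rels[OF assms] rels_det_def)
qed

lemma T_gens_mult_var:
  assumes "t \<in> T_gens"
  shows "t * var w \<in> I"
proof -
  have "minor_combination g (\<lambda>u v. eval (mpt u v) (t * var w))"
    using assms unfolding T_gens_def
    by (elim insertE emptyE; cases w;
      simp only: T_gens_dets_1 T_gens_dets_2 T_gens_dets_3 T_gens_dets_4;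
      intro minor_combination_add minor_combination_uminus minor_combination_diff rels_det_minor_combination; simp)
  then show ?thesis by (rule minor_combination_in_ideal)
qed

text \<open>The polynomials whose product with \<open>var w\<close> lies in \<open>I\<close> form an
  ideal, so only \<open>P\<close> and the four cubics have to be checked.\<close>

lemma intersection_mult_var:
  assumes "\<And>X. X \<in> surfaces \<Longrightarrow> f \<in> Van X"
  shows "var w * f \<in> I"
proof -
  have "ideal_gen (insert plucker_poly T_gens) \<subseteq> {f. f * var w \<in> I}"
  proof (rule ideal_minimal)
    have "var w * plucker_poly \<in> I"
      unfolding I by (intro ideal_scale ideal_base) simp
    then have "plucker_poly * var w \<in> I" by (simp only: mult.commute)
    then show "insert plucker_poly T_gens \<subseteq> {f. f * var w \<in> I}" using T_gens_mult_var by blast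
    show "Modules.module.subspace (*) {f. f * var w \<in> I}"
      unfolding subspace_iff I
      by (auto simp: distrib_right mult.assoc intro: ideal_zero ideal_add ideal_scale)
  qed
  then show ?thesis using intersection_of_surfaces[OF assms] by (auto simp: mult.commute)
qed

end

section \<open>Existence of the quartics\<close>

text \<open>One word from each element of \<open>rels\<close> gives biorthogonal coordinates, from
  which distinctness, independence and the expansion of any dual relation follow.\<close>

lemma rels_delta:
  assumes "a < 10" "b < 10"
  shows "Poly_Mapping.lookup (rels ! a) (map Word [[1, 1], [2, 2], [3, 3], [4, 4], [1, 2], [1, 3], [1, 4], [2, 3], [2, 4], [3, 4]] ! b) =
    (if a = b then 1 else 0)"
  using nat_less_10[OF assms(1)] nat_less_10[OF assms(2)]
  by (elim insertE emptyE; simp add: rels_nth lookup_word2 lookup_add lookup_minus)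

lemma dual_basis_rels: "dual_basis R_relations (rels :: (nat, 'k::field) free_alg list)"
proof -
  let ?w = "\<lambda>b. map Word [[1, 1], [2, 2], [3, 3], [4, 4], [1, 2], [1, 3], [1, 4], [2, 3], [2, 4], [3, 4]] ! b"
  let ?D = "dual_relations R_relations :: (nat, 'k) free_alg set"
  have dist: "distinct (rels :: (nat, 'k) free_alg list)"
    unfolding distinct_conv_nth
  proof (intro allI impI)
    fix a b assume ab: "a < length (rels :: (nat, 'k) free_alg list)" "b < length (rels :: (nat, 'k) free_alg list)" "a \<noteq> b"
    then show "(rels :: (nat, 'k) free_alg list) ! a \<noteq> rels ! b"
      using rels_delta[of a b, where 'a = 'k] rels_delta[of b b, where 'a = 'k] by (auto simp del: list.map)
  qed
  have indep: "\<not> Modules.module.dependent scale (set (rels :: (nat, 'k) free_alg list))"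
    unfolding Modules.module.dependent_explicit[OF module_scale]
  proof (intro notI, elim exE conjE)
    fix t and c :: "(nat, 'k) free_alg \<Rightarrow> 'k"
    assume t: "finite t" "t \<subseteq> set rels" "(\<Sum>f\<in>t. scale (c f) f) = 0" "\<exists>f\<in>t. c f \<noteq> 0"
    then obtain f where f: "f \<in> t" "c f \<noteq> 0" by blast
    then have "f \<in> set rels" using t(2) by blast
    then obtain b where b: "b < 10" "f = rels ! b" by (metis in_set_conv_nth length_rels)
    have "0 = (\<Sum>h\<in>t. c h * Poly_Mapping.lookup h (?w b))"
      using arg_cong[OF t(3), of "\<lambda>h. Poly_Mapping.lookup h (?w b)"] by (simp add: lookup_sum lookup_const_mult del: list.map)
    also have "\<dots> = (\<Sum>h\<in>t. if h = f then c f else 0)"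
    proof (rule sum.cong[OF refl])
      fix h assume "h \<in> t"
      then have "h \<in> set rels" using t(2) by blast
      then obtain a where a: "a < 10" "h = rels ! a" by (metis in_set_conv_nth length_rels)
      have "h = f \<longleftrightarrow> a = b" using nth_eq_iff_index_eq[OF dist, of a b] a b by simp
      then show "c h * Poly_Mapping.lookup h (?w b) = (if h = f then c f else 0)"
        using rels_delta[OF a(1) b(1), where 'a = 'k] a b by (simp del: list.map)
    qed
    also have "\<dots> = c f" using f(1) t(1) by simp
    finally show False using f(2) by simp
  qed
  have sub: "Modules.module.subspace scale ?D"
    unfolding Modules.module.subspace_def[OF module_scale]
  proof (intro conjI ballI allI)
    show "0 \<in> ?D" by (simp add: dual_relations_R quadratic_def)
    show "f + h \<in> ?D" if "f \<in> ?D" "h \<in> ?D" for f h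
      using that by (simp add: dual_relations_R quadratic_add lookup_add)
    show "scale c f \<in> ?D" if "f \<in> ?D" for c f
    proof -
      have "Poly_Mapping.keys (scale c f) \<subseteq> Poly_Mapping.keys f" by (auto simp: in_keys_iff lookup_const_mult)
      then have "quadratic (scale c f)" using that by (auto simp: dual_relations_R quadratic_def)
      then show ?thesis using that by (simp add: dual_relations_R lookup_const_mult)
    qed
  qed
  have "?D \<subseteq> Modules.module.span scale (set rels)"
  proof
    fix f :: "(nat, 'k) free_alg" assume f: "f \<in> ?D"
    \<comment> \<open>The expansion of \<open>f\<close> in the biorthogonal coordinates. Both
      \<open>f\<close> and \<open>h\<close> are dual relations, so agreement at the ten words forces
      agreement at all sixteen.\<close>
    define h where "h = (\<Sum>b<10. scale (Poly_Mapping.lookup f (?w b)) (rels ! b))"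
    have "h \<in> Modules.module.span scale (set rels)"
      unfolding h_def
      by (intro Modules.module.span_sum[OF module_scale] Modules.module.span_scale[OF module_scale]
          Modules.module.span_base[OF module_scale]) simp
    moreover have "f = h"
    proof (rule poly_mapping_eqI)
      fix w
      have idx: "{..<10 :: nat} = {0, 1, 2, 3, 4, 5, 6, 7, 8, 9}" by auto
      have hD: "h \<in> ?D" unfolding h_def
        using rels_dual
        by (intro Modules.module.subspace_sum[OF module_scale sub] Modules.module.subspace_scale[OF module_scale sub]) auto
      have hb: "Poly_Mapping.lookup h (?w b) = Poly_Mapping.lookup f (?w b)" if b: "b < 10" for b
      proof -
        have "Poly_Mapping.lookup h (?w b) = (\<Sum>a<10. if a = b then Poly_Mapping.lookup f (?w a) else 0)"
          unfolding h_def lookup_sum lookup_const_mult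
          by (rule sum.cong[OF refl]) (use rels_delta[OF _ b, where 'a = 'k] in \<open>simp del: list.map\<close>)
        then show ?thesis using b by simp
      qed
      have e: "Poly_Mapping.lookup h (Word [1, 1]) = Poly_Mapping.lookup f (Word [1, 1])"
        "Poly_Mapping.lookup h (Word [2, 2]) = Poly_Mapping.lookup f (Word [2, 2])"
        "Poly_Mapping.lookup h (Word [3, 3]) = Poly_Mapping.lookup f (Word [3, 3])"
        "Poly_Mapping.lookup h (Word [4, 4]) = Poly_Mapping.lookup f (Word [4, 4])"
        "Poly_Mapping.lookup h (Word [1, 2]) = Poly_Mapping.lookup f (Word [1, 2])"
        "Poly_Mapping.lookup h (Word [1, 3]) = Poly_Mapping.lookup f (Word [1, 3])"
        "Poly_Mapping.lookup h (Word [1, 4]) = Poly_Mapping.lookup f (Word [1, 4])"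
        "Poly_Mapping.lookup h (Word [2, 3]) = Poly_Mapping.lookup f (Word [2, 3])"
        "Poly_Mapping.lookup h (Word [2, 4]) = Poly_Mapping.lookup f (Word [2, 4])"
        "Poly_Mapping.lookup h (Word [3, 4]) = Poly_Mapping.lookup f (Word [3, 4])"
        using hb[of 0] hb[of 1] hb[of 2] hb[of 3] hb[of 4] hb[of 5] hb[of 6] hb[of 7] hb[of 8] hb[of 9] by simp_all
      show "Poly_Mapping.lookup f w = Poly_Mapping.lookup h w"
      proof (cases "\<exists>i j. w = Word [i, j] \<and> i \<in> {1..4} \<and> j \<in> {1..4}")
        case True
        then obtain i j where ij: "w = Word [i, j]" "i \<in> {1..4}" "j \<in> {1..4}" by blast
        have r: "{1..4 :: nat} = {1, 2, 3, 4}" by auto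
        from f hD e ij(2,3) show ?thesis unfolding ij(1) dual_relations_R r
          by (elim insertE emptyE; simp)
      next
        case False
        have "quadratic f" "quadratic h" using f hD unfolding dual_relations_R by blast+
        then have "w \<notin> Poly_Mapping.keys f" "w \<notin> Poly_Mapping.keys h"
          using False unfolding quadratic_def by blast+
        then show ?thesis by (simp add: in_keys_iff)
      qed
    qed
    ultimately show "f \<in> Modules.module.span scale (set rels)" by simp
  qed
  moreover have "Modules.module.span scale (set rels) \<subseteq> ?D"
    by (rule Modules.module.span_minimal[OF module_scale rels_dual sub])
  ultimately show ?thesis using dist indep unfolding dual_basis_def by auto
qed

text \<open>Interchanging the columns \<open>j\<close> and \<open>j + 4\<close> changes the sign of every term of the Leibniz
  expansion; averaging over these four transpositions turns the products of entries of the two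
  columns into 2 by 2 minors, which are linear in the \<open>N\<^sub>i\<^sub>j\<close>.\<close>

lemma det_paired_columns:
  fixes A :: "'a::comm_ring_1 mat"
  assumes A: "A \<in> carrier_mat 8 8"
  shows "16 * Determinant.det A = (\<Sum>p | p permutes {0..<8}. signof p *
    (\<Prod>j<4. A $$ (p j, j) * A $$ (p (j + 4), j + 4) - A $$ (p (j + 4), j) * A $$ (p j, j + 4)))"
proof -
  define X where "X p j = A $$ (p j, j) * A $$ (p (j + 4), j + 4)" for p :: "nat \<Rightarrow> nat" and j
  define Y where "Y p j = A $$ (p (j + 4), j) * A $$ (p j, j + 4)" for p :: "nat \<Rightarrow> nat" and j
  \<comment> \<open>The first \<open>k\<close> column pairs have been antisymmetrised, each at the
    cost of a factor 2.\<close>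
  have "2 ^ k * Determinant.det A = (\<Sum>p | p permutes {0..<8}. signof p *
      ((\<Prod>j<k. X p j - Y p j) * (\<Prod>j = k..<4. X p j)))" if "k \<le> 4" for k
    using that
  proof (induction k)
    case 0
    have "(\<Prod>j<8. A $$ (p j, j)) = (\<Prod>j = 0..<4. X p j)" for p
      unfolding X_def by (simp add: eval_nat_numeral mult_ac)
    then show ?case using det_col[OF A] by simp
  next
    case (Suc k)
    define F where "F p = (\<Prod>j<k. X p j - Y p j) * (\<Prod>j = Suc k..<4. X p j)" for p
    have k: "k < 4" using Suc.prems by simp
    have split: "(\<Prod>j<k. X p j - Y p j) * (\<Prod>j = k..<4. X p j) = F p * X p k" for p
      using k by (simp add: F_def prod.atLeast_Suc_lessThan mult_ac)
    define \<tau> where "\<tau> = transpose k (k + 4)"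
    have \<tau>: "\<tau> permutes {0..<8}" unfolding \<tau>_def using k by (intro permutes_swap_id) auto
    have \<tau>_other: "\<tau> j = j" "\<tau> (j + 4) = j + 4" if "j \<noteq> k" "j < 4" for j
      using that k by (simp_all add: \<tau>_def transpose_def)
    have \<tau>_k: "\<tau> k = k + 4" "\<tau> (k + 4) = k" by (simp_all add: \<tau>_def)
    have "(\<Sum>p | p permutes {0..<8}. signof p * (F p * X p k)) =
        (\<Sum>p | p permutes {0..<8}. signof (p \<circ> \<tau>) * (F (p \<circ> \<tau>) * X (p \<circ> \<tau>) k))"
      by (rule sum_permutations_compose_right[OF \<tau>])
    also have "\<dots> = (\<Sum>p | p permutes {0..<8}. - (signof p * (F p * Y p k)))"
    proof (rule sum.cong[OF refl])
      fix p assume "p \<in> {p. p permutes {0..<8 :: nat}}"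
      then have "permutation p" using permutation_permutes by blast
      moreover have "permutation \<tau>" using \<tau> permutation_permutes by blast
      ultimately have sg: "sign (p \<circ> \<tau>) = - sign p" by (simp add: sign_compose \<tau>_def sign_swap_id)
      have "F (p \<circ> \<tau>) = F p"
        unfolding F_def X_def Y_def
        by (intro arg_cong2[where f = "(*)"] prod.cong refl) (use \<tau>_other k in auto)
      moreover have "X (p \<circ> \<tau>) k = Y p k" by (simp add: X_def Y_def \<tau>_k)
      ultimately show "signof (p \<circ> \<tau>) * (F (p \<circ> \<tau>) * X (p \<circ> \<tau>) k) = - (signof p * (F p * Y p k))"
        by (simp add: sg)
    qed
    finally have swap: "(\<Sum>p | p permutes {0..<8}. signof p * (F p * X p k)) =
        - (\<Sum>p | p permutes {0..<8}. signof p * (F p * Y p k))" by (simp add: sum_negf)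
    have "2 ^ Suc k * Determinant.det A = 2 * (\<Sum>p | p permutes {0..<8}. signof p * (F p * X p k))"
      using Suc by (simp add: split mult.assoc)
    also have "\<dots> = (\<Sum>p | p permutes {0..<8}. signof p * (F p * X p k)) -
        (\<Sum>p | p permutes {0..<8}. signof p * (F p * Y p k))"
      unfolding mult_2 by (subst (2) swap) simp
    also have "\<dots> = (\<Sum>p | p permutes {0..<8}. signof p * (F p * (X p k - Y p k)))"
      unfolding sum_subtractf[symmetric] by (rule sum.cong[OF refl]) (simp add: algebra_simps)
    also have "\<dots> = (\<Sum>p | p permutes {0..<8}. signof p *
        ((\<Prod>j<Suc k. X p j - Y p j) * (\<Prod>j = Suc k..<4. X p j)))"
      by (rule sum.cong[OF refl]) (simp add: F_def mult_ac)
    finally show ?case .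
  qed
  from this[of 4] show ?thesis by (simp add: X_def Y_def)
qed

text \<open>The antisymmetric extension of the six variables to all index pairs from 1 to 4, zero on
  the diagonal.\<close>

definition N_var :: "nat \<Rightarrow> nat \<Rightarrow> (plucker, 'k::field) mpoly" where
  "N_var k l = (if (k, l) = (1, 2) then var M12 else if (k, l) = (1, 3) then var M13
     else if (k, l) = (1, 4) then var M14 else if (k, l) = (2, 3) then var M23
     else if (k, l) = (2, 4) then var M24 else if (k, l) = (3, 4) then var M34
     else if (k, l) = (2, 1) then - var M12 else if (k, l) = (3, 1) then - var M13
     else if (k, l) = (4, 1) then - var M14 else if (k, l) = (3, 2) then - var M23
     else if (k, l) = (4, 2) then - var M24 else if (k, l) = (4, 3) then - var M34 else 0)"

lemma homogeneous_N_var: "homogeneous 1 (N_var k l)"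
  unfolding N_var_def by (auto intro!: hom_intros)

lemma subst_N_var:
  assumes "k \<in> {1..4}" "l \<in> {1..4}"
  shows "subst N_form (N_var k l) = (N_uv k l :: (uv, 'k::field_char_0) mpoly)"
proof -
  have r: "{1..4 :: nat} = {1, 2, 3, 4}" by auto
  show ?thesis using assms unfolding r
    by (elim insertE emptyE; simp add: N_var_def subst_simps N_uv_def)
qed

text \<open>The 2 by 2 minor in columns \<open>j\<close> and \<open>j + 4\<close> lifts to the
  linear form \<open>M p j\<close> in the \<open>N\<close> variables. The sum over permutations of
  products of four such forms is the quartic, and \<open>1/16\<close> undoes the factor from
  \<open>det_paired_columns\<close>.\<close>

lemma quartic_expression:
  fixes fs :: "(nat, 'k::field_char_0) free_alg list"
  assumes S: "S \<in> minor_rows"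
  shows "\<exists>g. homogeneous 4 g \<and> subst N_form g = minor8 fs S"
proof -
  define c where "c i k j = Poly_Mapping.lookup (fs ! (sorted_list_of_set S ! i)) (Word [k, j + 1])" for i k j
  define A :: "(uv, 'k) mpoly mat" where "A = mat 8 8 (\<lambda>(i, j). uv_matrix fs $$ (sorted_list_of_set S ! i, j))"
  have A: "A \<in> carrier_mat 8 8" by (simp add: A_def)
  have AU: "A $$ (i, j) = (\<Sum>k = 1..4. const (c i k j) * var (U k))"
    and AV: "A $$ (i, j + 4) = (\<Sum>k = 1..4. const (c i k j) * var (V k))" if "i < 8" "j < 4" for i j
    using that minor_rowsD(4)[OF S, of i] by (simp_all add: A_def uv_matrix_def hat_M_def c_def)
  define M :: "(nat \<Rightarrow> nat) \<Rightarrow> nat \<Rightarrow> (plucker, 'k) mpoly" where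
    "M p j = (\<Sum>k = 1..4. \<Sum>l = 1..4. const (c (p j) k j * c (p (j + 4)) l j) * N_var k l)" for p j
  have M: "subst N_form (M p j) = A $$ (p j, j) * A $$ (p (j + 4), j + 4) - A $$ (p (j + 4), j) * A $$ (p j, j + 4)"
    if p: "p permutes {0..<8}" and j: "j < 4" for p j
  proof -
    have p8: "p j < 8" "p (j + 4) < 8"
      using permutes_in_image[OF p, of j] permutes_in_image[OF p, of "j + 4"] j by auto
    let ?a = "\<lambda>k. const (c (p j) k j) :: (uv, 'k) mpoly" and ?b = "\<lambda>k. const (c (p (j + 4)) k j) :: (uv, 'k) mpoly"
    have cc: "const (x * y) = const x * (const y :: (uv, 'k) mpoly)" for x y by (simp add: const_def mult_single)
    have "subst N_form (M p j) = (\<Sum>k = 1..4. \<Sum>l = 1..4. ?a k * ?b l * N_uv k l)"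
      unfolding M_def subst_sum
      by (intro sum.cong refl) (simp add: subst_mult subst_const subst_N_var cc)
    also have "\<dots> = (\<Sum>k = 1..4. \<Sum>l = 1..4. (?a k * var (U k)) * (?b l * var (V l))) -
        (\<Sum>k = 1..4. \<Sum>l = 1..4. (?b l * var (U l)) * (?a k * var (V k)))"
      unfolding sum_subtractf[symmetric] N_uv_def
      by (intro sum.cong refl) (simp add: algebra_simps)
    also have "(\<Sum>k = 1..4. \<Sum>l = 1..4. (?b l * var (U l)) * (?a k * var (V k))) =
        (\<Sum>l = 1..4. \<Sum>k = 1..4. (?b l * var (U l)) * (?a k * var (V k)))" by (rule sum.swap)
    finally show ?thesis by (simp only: AU[OF p8(1) j] AV[OF p8(2) j] AU[OF p8(2) j] AV[OF p8(1) j] sum_product)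
  qed
  have hM: "homogeneous 1 (M p j)" for p j
    unfolding M_def by (intro multihomogeneous_sum multihomogeneous_smult homogeneous_N_var)
  define g where "g = const (1/16) * (\<Sum>p | p permutes {0..<8}. const (signof p) * (\<Prod>j<4. M p j))"
  have "homogeneous 4 (\<Prod>j<4. M p j)" for p
    using multihomogeneous_prod[of "{..<4 :: nat}" std_grading "\<lambda>_ _. 1" "M p"] hM by simp
  then have "homogeneous 4 g"
    unfolding g_def by (intro multihomogeneous_smult multihomogeneous_sum)
  moreover have "subst N_form g = minor8 fs S"
  proof -
    have sg: "const (signof p) = (signof p :: (uv, 'k) mpoly)" for p
      by (rule poly_eqI) (simp add: sign_def eval_uminus)
    have "subst N_form g = const (1/16) * (\<Sum>p | p permutes {0..<8}. signof p * (\<Prod>j<4. subst N_form (M p j)))"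
      by (simp add: g_def subst_simps sg)
    also have "(\<Sum>p | p permutes {0..<8}. signof p * (\<Prod>j<4. subst N_form (M p j))) = 16 * Determinant.det A"
      unfolding det_paired_columns[OF A]
      by (intro sum.cong refl arg_cong2[where f = "(*)"] prod.cong M) auto
    also have "const (1/16) * (16 * Determinant.det A) = Determinant.det A"
    proof -
      have e: "(16 :: (uv, 'k) mpoly) = Poly_Mapping.single 0 16" by (simp only: single_numeral)
      have "const (1/16) * 16 = (1 :: (uv, 'k) mpoly)" unfolding e const_def mult_single by simp
      then show ?thesis by (simp flip: mult.assoc)
    qed
    finally show ?thesis by (simp add: minor8_def A_def)
  qed
  ultimately show ?thesis by blast
qed

lemma line_scheme_ideal_exists: "\<exists>I :: (plucker, 'k::field_char_0) mpoly set. line_scheme_ideal R_relations I"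
proof -
  have "\<forall>S. \<exists>g. S \<in> minor_rows \<longrightarrow> homogeneous 4 g \<and> subst N_form g = minor8 (rels :: (nat, 'k) free_alg list) S"
    using quartic_expression by blast
  then obtain g where "\<forall>S. S \<in> minor_rows \<longrightarrow> homogeneous 4 (g S) \<and> subst N_form (g S) = minor8 (rels :: (nat, 'k) free_alg list) S"
    by (rule choice[THEN exE])
  then show ?thesis unfolding line_scheme_ideal_def using dual_basis_rels by blast
qed

section \<open>Conclusion\<close>

lemma vanishing_locus_ideal_gen: "\<V> (ideal_gen G) = \<V> G"
proof -
  have "ideal_gen G \<subseteq> p \<longleftrightarrow> G \<subseteq> p" if "p \<in> Proj" for p
    using that ideal_minimal[of G p] ideal_base[of _ G] by (auto simp: Proj_def prime_ideal_def)
  then show ?thesis by (auto simp: vanishing_locus_def)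
qed

lemma surface_cone_surfaces:
  assumes "X \<in> surfaces"
  shows "surface_cone (X :: (plucker \<Rightarrow> 'k::field_char_0) set)"
proof -
  have "surface_cone (zeros G1 :: (plucker \<Rightarrow> 'k) set)" "surface_cone (zeros G2 :: (plucker \<Rightarrow> 'k) set)"
    "surface_cone (zeros G3 :: (plucker \<Rightarrow> 'k) set)" "surface_cone (zeros G4 :: (plucker \<Rightarrow> 'k) set)"
    by (rule plane_surface_cone, rule charts)+
  moreover have "surface_cone (zeros G5 :: (plucker \<Rightarrow> 'k) set)" "surface_cone (zeros G6 :: (plucker \<Rightarrow> 'k) set)"
    "surface_cone (zeros G7 :: (plucker \<Rightarrow> 'k) set)"
    by (rule quadric_surface_cone, rule charts charts')+
  ultimately show ?thesis using assms unfolding surfaces_def by auto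
qed

definition surface_list :: "(plucker \<Rightarrow> 'k::field) set list" where
  "surface_list = [zeros G1, zeros G2, zeros G3, zeros G4, zeros G5, zeros G6, zeros G7]"

lemma surfaces_eq: "surfaces = set surface_list"
  by (simp add: surfaces_def surface_list_def)

text \<open>One point on each surface that avoids the other six; this gives distinctness and
  incomparability together.\<close>

lemma surface_points:
  assumes "i < 7" "j < 7"
  shows "[plucker_fun 0 1 2 1 2 1, plucker_fun 0 1 2 (- 1) (- 2) 1, plucker_fun 1 1 1 2 2 0,
      plucker_fun 1 1 (- 1) 2 (- 2) 0, plucker_fun 0 1 2 3 6 0, plucker_fun 1 2 1 1 2 3,
      plucker_fun 1 2 1 (- 1) (- 2) (- 3)] ! i \<in> (surface_list ! j :: (plucker \<Rightarrow> 'k::field_char_0) set) \<longleftrightarrow> i = j"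
proof -
  have neq: "(2 :: 'k) \<noteq> - 1" "(3 :: 'k) \<noteq> - 1" "(3 :: 'k) \<noteq> - 2" "(- 1 :: 'k) \<noteq> 2" "(1 :: 'k) \<noteq> - 1" "(- 1 :: 'k) \<noteq> 1"
    by (simp_all add: eq_neg_iff_add_eq_0 neg_eq_iff_add_eq_0)
  have "i \<in> {0, 1, 2, 3, 4, 5, 6}" "j \<in> {0, 1, 2, 3, 4, 5, 6}" using assms by auto
  then show ?thesis
    by (elim insertE emptyE; simp add: surface_list_def zeros_G neq)
qed

lemma distinct_surface_list: "distinct (surface_list :: (plucker \<Rightarrow> 'k::field_char_0) set list)"
  unfolding distinct_conv_nth
proof (intro allI impI)
  fix i j :: nat
  assume "i < length (surface_list :: (plucker \<Rightarrow> 'k) set list)" "j < length (surface_list :: (plucker \<Rightarrow> 'k) set list)" "i \<noteq> j"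
  then have ij: "i < 7" "j < 7" "i \<noteq> j" by (simp_all add: surface_list_def)
  then show "(surface_list :: (plucker \<Rightarrow> 'k) set list) ! i \<noteq> surface_list ! j"
    using surface_points[OF ij(1,1), where 'k = 'k] surface_points[OF ij(1,2), where 'k = 'k] by metis
qed

lemma surfaces_incomparable:
  fixes X Y :: "(plucker \<Rightarrow> 'k::field_char_0) set"
  assumes "X \<in> surfaces" "Y \<in> surfaces" "Y \<subseteq> X"
  shows "X = Y"
proof -
  have "length (surface_list :: (plucker \<Rightarrow> 'k) set list) = 7" by (simp add: surface_list_def)
  then obtain i j where ij: "i < 7" "X = surface_list ! i" "j < 7" "Y = surface_list ! j"
    using assms(1,2) unfolding surfaces_eq by (metis in_set_conv_nth)
  have "j = i"
    using surface_points[OF ij(3,3), where 'k = 'k] surface_points[OF ij(3,1), where 'k = 'k] assms(3) ij(2,4) by blast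
  then show ?thesis using ij by simp
qed

theorem theorem4p2p3:
  fixes C1 C2 C3 C4 C5 C6 C7 :: "(plucker, 'k::{alg_closed_field, field_char_0}) mpoly set set"
  assumes C1: "C1 = \<V> {var M12, var M13 - var M23, var M14 - var M24}"
    and C2: "C2 = \<V> {var M12, var M13 + var M23, var M14 + var M24}"
    and C3: "C3 = \<V> {var M34, var M13 - var M14, var M23 - var M24}"
    and C4: "C4 = \<V> {var M34, var M13 + var M14, var M23 + var M24}"
    and C5: "C5 = \<V> {var M12, var M34, plucker_poly}"
    and C6: "C6 = \<V> {var M14 - var M23, var M13 - var M24, plucker_poly}"
    and C7: "C7 = \<V> {var M14 + var M23, var M13 + var M24, plucker_poly}"
  shows "(\<exists>I :: (plucker, 'k) mpoly set. line_scheme_ideal R_relations I) \<and>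
    (\<forall>I :: (plucker, 'k) mpoly set. line_scheme_ideal R_relations I \<longrightarrow>
      irreducible_components (subscheme_space I) = {C1, C2, C3, C4, C5, C6, C7} \<and>
      distinct [C1, C2, C3, C4, C5, C6, C7] \<and>
      (\<forall>C\<in>{C1, C2, C3, C4}. isomorphic_to_P2 C) \<and>
      (\<forall>C\<in>{C5, C6, C7}. isomorphic_to_P1_P1 C) \<and>
      equidimensional (subscheme_space I) 2 \<and>
      reduced_subscheme I)"
proof (intro conjI allI impI)
  show "\<exists>I :: (plucker, 'k) mpoly set. line_scheme_ideal R_relations I" by (rule line_scheme_ideal_exists)
next
  fix I :: "(plucker, 'k) mpoly set"
  assume "line_scheme_ideal R_relations I"
  then obtain fs g where fs: "dual_basis R_relations fs"
    and g: "\<And>S. S \<in> minor_rows \<Longrightarrow> subst N_form (g S) = minor8 fs S"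
    and I: "I = ideal_gen (insert plucker_poly ((\<lambda>S. subst M_of_N (g S)) ` minor_rows))"
    unfolding line_scheme_ideal_def by blast
  have C_eq: "C1 = \<V> (Van (zeros G1))" "C2 = \<V> (Van (zeros G2))" "C3 = \<V> (Van (zeros G3))"
    "C4 = \<V> (Van (zeros G4))" "C5 = \<V> (Van (zeros G5))" "C6 = \<V> (Van (zeros G6))" "C7 = \<V> (Van (zeros G7))"
    unfolding C1 C2 C3 C4 C5 C6 C7 Van_G Van_G' vanishing_locus_ideal_gen by (simp_all only: G_defs)
  interpret L: surface_union I surfaces
  proof
    show "I \<subseteq> Van X" if "X \<in> surfaces" for X by (rule line_ideal_sub[OF fs g I that])
    show "Modules.module.subspace (*) I" unfolding I by (rule ideal_subspace)
    show "var v * f \<in> I" if "\<And>X. X \<in> surfaces \<Longrightarrow> f \<in> Van X" for f v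
      by (rule intersection_mult_var[OF fs g I that])
    show "finite (surfaces :: (plucker \<Rightarrow> 'k) set set)" by (simp add: surfaces_def)
    show "surface_cone X" if "X \<in> surfaces" for X :: "(plucker \<Rightarrow> 'k) set"
      by (rule surface_cone_surfaces[OF that])
    show "X = Y" if XY: "X \<in> surfaces" "Y \<in> surfaces" "Van X \<subseteq> Van Y" for X Y :: "(plucker \<Rightarrow> 'k) set"
    proof -
      \<comment> \<open>Since \<open>X\<close> is a zero set, an inclusion of vanishing ideals
        reverses to an inclusion of cones.\<close>
      obtain G where "X = zeros G" using XY(1) unfolding surfaces_def by blast
      then have "Y \<subseteq> X" using zeros_closed[of _ G] XY(3) by (auto simp: Van_def)
      then show ?thesis by (rule surfaces_incomparable[OF XY(1,2)])
    qed
  qed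
  show "irreducible_components (subscheme_space I) = {C1, C2, C3, C4, C5, C6, C7}"
    unfolding L.components C_eq surfaces_def by simp
  have "distinct (map (\<lambda>X. \<V> (Van X)) (surface_list :: (plucker \<Rightarrow> 'k) set list))"
    unfolding distinct_map using distinct_surface_list L.locus_inj by (simp add: surfaces_eq)
  then show "distinct [C1, C2, C3, C4, C5, C6, C7]" unfolding C_eq surface_list_def by simp
  show "\<forall>C\<in>{C1, C2, C3, C4}. isomorphic_to_P2 C"
    unfolding C_eq ball_simps
    using plane_isomorphic_to_P2[OF charts(1) zeros_closed] plane_isomorphic_to_P2[OF charts(2) zeros_closed]
      plane_isomorphic_to_P2[OF charts(3) zeros_closed] plane_isomorphic_to_P2[OF charts(4) zeros_closed]
    by (intro conjI TrueI)
  show "\<forall>C\<in>{C5, C6, C7}. isomorphic_to_P1_P1 C"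
    unfolding C_eq ball_simps
    using quadric_isomorphic_to_P1_P1[OF charts(5) zeros_closed] quadric_isomorphic_to_P1_P1[OF charts'(1) zeros_closed]
      quadric_isomorphic_to_P1_P1[OF charts'(2) zeros_closed]
    by (intro conjI TrueI)
  show "equidimensional (subscheme_space I) 2" by (rule L.equidim)
  show "reduced_subscheme I" by (rule L.reduced)
qed

end
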